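(* Let $\Omega\subset\mathbb{C}^d$ be a Kobayashi hyperbolic (not necessarily bounded) local Gromov model domain that is hyperbolically embedded in $\mathbb{C}^d$. Suppose that $\Omega$ admits squeezing functions, and that the squeezing function tends to $1$ at the boundary, i.e., for every $\xi\in\partial\Omega$, $\lim_{\Omega\ni z\to\xi}s_\Omega(z)=1$. Then, for every $\xi\in\partial\Omega$ and every two $\mathsf{k}_\Omega$-geodesic rays $\gamma,\sigma$ in $\Omega$ landing at $\xi$, $\gamma$ and $\sigma$ are strongly asymptotic, i.e., there exists $T\in\mathbb{R}$ such that $$\lim_{t\to\infty}\mathsf{k}_\Omega(\gamma(t),\sigma(t+T))=0.$$
   Context: For a domain $\Omega\subset\mathbb{C}^d$, $\mathsf{k}_\Omega$ denotes the Kobayashi (pseudo)distance; $\Omega$ is (Kobayashi) hyperbolic if $\mathsf{k}_\Omega$ is a distance, and complete (Kobayashi) hyperbolic if moreover $(\Omega,\mathsf{k}_\Omega)$ is complete (then it is a proper geodesic space). $\overline{\Omega}$ and $\partial\Omega$ are the Euclidean closure and boundary in $\mathbb{C}^d$. A geodesic ray in a distance space $(X,d)$ is an isometric embedding $[0,\infty)\to X$; a $\mathsf{k}_\Omega$-geodesic ray is a geodesic ray in $(\Omega,\mathsf{k}_\Omega)$. It lands at $\xi\in\partial\Omega$ if $\lim_{t\to\infty}\gamma(t)=\xi$ (in the Euclidean topology). For a proper geodesic Gromov hyperbolic space $(X,d)$, the Gromov boundary $\partial^G X$ is the set of equivalence classes of geodesic rays, where $\gamma\sim\sigma$ iff $\sup_{t\ge0}d(\gamma(t),\sigma(t))<\infty$.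 The Gromov compactification $\overline{X}^G=X\sqcup\partial^G X$ carries its usual metrizable compact topology: a sequence $(x_n)\subset X$ converges to $\xi\in\partial^G X$ iff there is $p\in X$ such that, for every choice of geodesic segments $\gamma_n$ joining $p$ to $x_n$, every subsequence of $(\gamma_n)$ has a further subsequence converging uniformly on compact subsets of $[0,\infty)$ to a geodesic ray representing $\xi$; similarly, $(\xi_n)\subset\partial^G X$ converges to $\xi\in\partial^G X$ iff there is $p\in X$ such that the same holds for every choice of geodesic rays $\gamma_n$ emanating from $p$ and representing $\xi_n$. A (possibly unbounded) hyperbolic domain $\Omega\subset\mathbb{C}^d$ is a local Gromov model domain if for every $\xi\in\partial\Omega$ there is a bounded neighbourhood $U$ of $\xi$ such that $U\cap\Omega$ is connected, complete Kobayashi hyperbolic, Gromov hyperbolic relative to its Kobayashi distance $\mathsf{k}_{U\cap\Omega}$, and such that the identity map of $U\cap\Omega$ extends to a homeomorphism from the Gromov compactification $\overline{U\cap\Omega}^G$ of $(U\cap\Omega,\mathsf{k}_{U\cap\Omega})$ to the Euclidean closure $\overline{U\cap\Omega}$. $\Omega$ is hyperbolically embedded in $\mathbb{C}^d$ if for all $p,q\in\partial\Omega$ with $p\neq q$, $\liminf_{(x,y)\to(p,q),\ x,y\in\Omega}\mathsf{k}_\Omega(x,y)>0$. Squeezing function: let $\mathbb{B}^d$ be the open Euclidean unit ball of $\mathbb{C}^d$ and $B(0;r)$ the open ball of radius $r$ centred at $0$. $\Omega$ admits squeezing functions if there is an injective holomorphic map $\Omega\to\mathbb{B}^d$. In that case,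 for $z\in\Omega$, $s_\Omega(z)$ is the supremum of all $r\in(0,1]$ for which there is an injective holomorphic map $\phi:\Omega\to\mathbb{B}^d$ with $\phi(z)=0$ and $B(0;r)\subset\phi(\Omega)$. *)

theory Defs
  imports "HOL-Analysis.Analysis"
begin

section \<open>Holomorphic maps between subsets of complex coordinate spaces\<close>

definition complex_domain :: "(complex ^ 'n) set \<Rightarrow> bool" where
  "complex_domain \<Omega> \<longleftrightarrow> open \<Omega> \<and> connected \<Omega> \<and> \<Omega> \<noteq> {}"

text \<open>The real derivative \<open>D\<close> is required to be linear over the complex numbers.\<close>

definition holomorphic_vec_on :: "(complex ^ 'n \<Rightarrow> complex ^ 'm) \<Rightarrow> (complex ^ 'n) set \<Rightarrow> bool" where
  "holomorphic_vec_on f S \<longleftrightarrow>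
     (\<forall>z\<in>S. \<exists>D. (f has_derivative D) (at z within S) \<and> (\<forall>c v. D (c *s v) = c *s D v))"

definition disc_map_into :: "(complex ^ 'n) set \<Rightarrow> (complex \<Rightarrow> complex ^ 'n) \<Rightarrow> bool" where
  "disc_map_into \<Omega> f \<longleftrightarrow> (\<forall>i. (\<lambda>z. f z $ i) holomorphic_on ball 0 1) \<and> f ` ball 0 1 \<subseteq> \<Omega>"

section \<open>The Kobayashi pseudodistance\<close>

text \<open>Normalised so that the distance from \<open>0\<close> to \<open>z\<close> is \<open>artanh (cmod z)\<close>.\<close>

definition poincare_dist :: "complex \<Rightarrow> complex \<Rightarrow> real" where
  "poincare_dist a b = artanh (cmod ((a - b) / (1 - cnj a * b)))"

definition kobayashi_chain_lengths ::
  "(complex ^ 'n) set \<Rightarrow> complex ^ 'n \<Rightarrow> complex ^ 'n \<Rightarrow> real set" where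
  "kobayashi_chain_lengths \<Omega> x y =
     {(\<Sum>j<n. poincare_dist (a j) (b j)) | (n::nat) a b f z.
        z 0 = x \<and> z n = y \<and>
        (\<forall>j<n. disc_map_into \<Omega> (f j) \<and> a j \<in> ball 0 1 \<and> b j \<in> ball 0 1 \<and>
               f j (a j) = z j \<and> f j (b j) = z (Suc j))}"

text \<open>Only meaningful for a domain \<open>\<Omega>\<close>, where any two points are joined by a chain. The value \<open>0\<close>
  off \<open>\<Omega>\<close> is a dummy: \<^const>\<open>Metric_space\<close> demands symmetry and nonnegativity on the whole type.\<close>

definition kobayashi_dist :: "(complex ^ 'n) set \<Rightarrow> complex ^ 'n \<Rightarrow> complex ^ 'n \<Rightarrow> real" where
  "kobayashi_dist \<Omega> x y =
     (if x \<in> \<Omega> \<and> y \<in> \<Omega> then Inf (kobayashi_chain_lengths \<Omega> x y) else 0)"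

definition kobayashi_hyperbolic :: "(complex ^ 'n) set \<Rightarrow> bool" where
  "kobayashi_hyperbolic \<Omega> \<longleftrightarrow> Metric_space \<Omega> (kobayashi_dist \<Omega>)"

definition complete_kobayashi_hyperbolic :: "(complex ^ 'n) set \<Rightarrow> bool" where
  "complete_kobayashi_hyperbolic \<Omega> \<longleftrightarrow>
     kobayashi_hyperbolic \<Omega> \<and> Metric_space.mcomplete \<Omega> (kobayashi_dist \<Omega>)"

text \<open>For boundary points \<open>p\<close>, \<open>q\<close> of an open \<open>\<Omega>\<close> the point \<open>(p, q)\<close> is not in \<open>\<Omega> \<times> \<Omega>\<close>, so the
  puncture in the filter below has no effect.\<close>

definition hyperbolically_embedded :: "(complex ^ 'n) set \<Rightarrow> bool" where
  "hyperbolically_embedded \<Omega> \<longleftrightarrow>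
     (\<forall>p\<in>frontier \<Omega>. \<forall>q\<in>frontier \<Omega>. p \<noteq> q \<longrightarrow>
        Liminf (at (p, q) within \<Omega> \<times> \<Omega>) (\<lambda>(x, y). ereal (kobayashi_dist \<Omega> x y)) > 0)"

section \<open>Gromov hyperbolicity and the Gromov compactification\<close>

definition gromov_product :: "('a \<Rightarrow> 'a \<Rightarrow> real) \<Rightarrow> 'a \<Rightarrow> 'a \<Rightarrow> 'a \<Rightarrow> real" where
  "gromov_product d o' x y = (d x o' + d y o' - d x y) / 2"

definition gromov_hyperbolic :: "'a set \<Rightarrow> ('a \<Rightarrow> 'a \<Rightarrow> real) \<Rightarrow> bool" where
  "gromov_hyperbolic M d \<longleftrightarrow>
     (\<exists>\<delta>\<ge>0. \<forall>o'\<in>M. \<forall>x\<in>M. \<forall>y\<in>M. \<forall>z\<in>M.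
        gromov_product d o' x z \<ge> min (gromov_product d o' x y) (gromov_product d o' y z) - \<delta>)"

text \<open>Rays are total functions on the reals whose values at negative arguments are irrelevant.\<close>

definition geodesic_ray :: "'a set \<Rightarrow> ('a \<Rightarrow> 'a \<Rightarrow> real) \<Rightarrow> (real \<Rightarrow> 'a) \<Rightarrow> bool" where
  "geodesic_ray M d \<gamma> \<longleftrightarrow>
     (\<forall>t\<ge>0. \<gamma> t \<in> M) \<and> (\<forall>s\<ge>0. \<forall>t\<ge>0. d (\<gamma> s) (\<gamma> t) = \<bar>s - t\<bar>)"

text \<open>A geodesic segment from \<open>p\<close> to \<open>x\<close> lives on \<open>{0..d p x}\<close>. It is extended by the constant \<open>x\<close>
  to the right, so that convergence on compact subsets of \<open>{0..}\<close> makes sense.\<close>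

definition geodesic_segment ::
  "'a set \<Rightarrow> ('a \<Rightarrow> 'a \<Rightarrow> real) \<Rightarrow> 'a \<Rightarrow> 'a \<Rightarrow> (real \<Rightarrow> 'a) \<Rightarrow> bool" where
  "geodesic_segment M d p x \<gamma> \<longleftrightarrow>
     \<gamma> 0 = p \<and> (\<forall>t\<ge>d p x. \<gamma> t = x) \<and> (\<forall>t\<in>{0..d p x}. \<gamma> t \<in> M) \<and>
     (\<forall>s\<in>{0..d p x}. \<forall>t\<in>{0..d p x}. d (\<gamma> s) (\<gamma> t) = \<bar>s - t\<bar>)"

definition asymptotic_rel ::
  "'a set \<Rightarrow> ('a \<Rightarrow> 'a \<Rightarrow> real) \<Rightarrow> ((real \<Rightarrow> 'a) \<times> (real \<Rightarrow> 'a)) set" where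
  "asymptotic_rel M d =
     {(\<gamma>, \<sigma>). geodesic_ray M d \<gamma> \<and> geodesic_ray M d \<sigma> \<and>
              bdd_above ((\<lambda>t. d (\<gamma> t) (\<sigma> t)) ` {0..})}"

definition gromov_boundary :: "'a set \<Rightarrow> ('a \<Rightarrow> 'a \<Rightarrow> real) \<Rightarrow> (real \<Rightarrow> 'a) set set" where
  "gromov_boundary M d = {\<gamma>. geodesic_ray M d \<gamma>} // asymptotic_rel M d"

definition compact_convergence ::
  "('a \<Rightarrow> 'a \<Rightarrow> real) \<Rightarrow> (nat \<Rightarrow> real \<Rightarrow> 'a) \<Rightarrow> (real \<Rightarrow> 'a) \<Rightarrow> bool" where
  "compact_convergence d \<Gamma> \<gamma> \<longleftrightarrow>
     (\<forall>K. compact K \<and> K \<subseteq> {0..} \<longrightarrow>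
        (\<forall>\<epsilon>>0. \<forall>\<^sub>F n in sequentially. \<forall>t\<in>K. d (\<Gamma> n t) (\<gamma> t) < \<epsilon>))"

definition subconverges_to_class ::
  "('a \<Rightarrow> 'a \<Rightarrow> real) \<Rightarrow> (nat \<Rightarrow> real \<Rightarrow> 'a) \<Rightarrow> (real \<Rightarrow> 'a) set \<Rightarrow> bool" where
  "subconverges_to_class d \<Gamma> \<xi> \<longleftrightarrow>
     (\<forall>r::nat \<Rightarrow> nat. strict_mono r \<longrightarrow>
        (\<exists>s::nat \<Rightarrow> nat. strict_mono s \<and> (\<exists>\<gamma>\<in>\<xi>. compact_convergence d (\<Gamma> \<circ> r \<circ> s) \<gamma>)))"

definition points_tendsto_boundary ::
  "'a set \<Rightarrow> ('a \<Rightarrow> 'a \<Rightarrow> real) \<Rightarrow> (nat \<Rightarrow> 'a) \<Rightarrow> (real \<Rightarrow> 'a) set \<Rightarrow> bool" where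
  "points_tendsto_boundary M d X \<xi> \<longleftrightarrow>
     (\<exists>p\<in>M. \<forall>\<Gamma>. (\<forall>n. geodesic_segment M d p (X n) (\<Gamma> n)) \<longrightarrow> subconverges_to_class d \<Gamma> \<xi>)"

definition boundary_tendsto_boundary ::
  "'a set \<Rightarrow> ('a \<Rightarrow> 'a \<Rightarrow> real) \<Rightarrow> (nat \<Rightarrow> (real \<Rightarrow> 'a) set) \<Rightarrow> (real \<Rightarrow> 'a) set \<Rightarrow> bool" where
  "boundary_tendsto_boundary M d \<Xi> \<xi> \<longleftrightarrow>
     (\<exists>p\<in>M. \<forall>\<Gamma>. (\<forall>n. geodesic_ray M d (\<Gamma> n) \<and> \<Gamma> n 0 = p \<and> \<Gamma> n \<in> \<Xi> n) \<longrightarrow>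
        subconverges_to_class d \<Gamma> \<xi>)"

text \<open>The topology of the Gromov compactification is metrizable, hence determined by its convergent
  sequences, and it suffices to consider sequences that stay in \<open>M\<close> or stay in the boundary. As \<open>M\<close>
  is proper, it is an open subset of its compactification and carries the metric topology there.\<close>

definition gromov_open ::
  "'a set \<Rightarrow> ('a \<Rightarrow> 'a \<Rightarrow> real) \<Rightarrow> ('a + (real \<Rightarrow> 'a) set) set \<Rightarrow> bool" where
  "gromov_open M d U \<longleftrightarrow>
     U \<subseteq> M <+> gromov_boundary M d \<and>
     openin (Metric_space.mtopology M d) (Inl -` U) \<and>
     (\<forall>\<xi> X. Inr \<xi> \<in> U \<and> range X \<subseteq> M \<and> points_tendsto_boundary M d X \<xi> \<longrightarrow>
        (\<forall>\<^sub>F n in sequentially. Inl (X n) \<in> U)) \<and>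
     (\<forall>\<xi> \<Xi>. Inr \<xi> \<in> U \<and> range \<Xi> \<subseteq> gromov_boundary M d \<and> boundary_tendsto_boundary M d \<Xi> \<xi> \<longrightarrow>
        (\<forall>\<^sub>F n in sequentially. Inr (\<Xi> n) \<in> U))"

definition gromov_compactification ::
  "'a set \<Rightarrow> ('a \<Rightarrow> 'a \<Rightarrow> real) \<Rightarrow> ('a + (real \<Rightarrow> 'a) set) topology" where
  "gromov_compactification M d = topology (gromov_open M d)"

lemma istopology_gromov_open: "istopology (gromov_open M d)"
  unfolding istopology_def
proof (intro conjI allI impI)
  fix S T assume "gromov_open M d S" "gromov_open M d T"
  then show "gromov_open M d (S \<inter> T)"
    unfolding gromov_open_def vimage_Int
    by (intro conjI allI impI openin_Int; simp add: le_infI1 eventually_conj_iff; blast)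
next
  fix \<K> assume K: "\<forall>U\<in>\<K>. gromov_open M d U"
  have up: "\<forall>\<^sub>F n in sequentially. f n \<in> \<Union>\<K>"
    if "U \<in> \<K>" "\<forall>\<^sub>F n in sequentially. f n \<in> U" for f U
    using that by (auto elim: eventually_mono)
  show "gromov_open M d (\<Union>\<K>)"
    unfolding gromov_open_def
  proof (intro conjI allI impI)
    show "\<Union>\<K> \<subseteq> M <+> gromov_boundary M d"
      using K unfolding gromov_open_def by (meson Sup_least)
    show "openin (Metric_space.mtopology M d) (Inl -` \<Union>\<K>)"
      unfolding vimage_Union using K unfolding gromov_open_def by blast
  next
    fix \<xi> X
    assume "Inr \<xi> \<in> \<Union>\<K> \<and> range X \<subseteq> M \<and> points_tendsto_boundary M d X \<xi>"
    then obtain U where "U \<in> \<K>" "Inr \<xi> \<in> U \<and> range X \<subseteq> M \<and> points_tendsto_boundary M d X \<xi>"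
      by auto
    then show "\<forall>\<^sub>F n in sequentially. Inl (X n) \<in> \<Union>\<K>"
      using K unfolding gromov_open_def by (intro up[of U]) blast+
  next
    fix \<xi> \<Xi>
    assume "Inr \<xi> \<in> \<Union>\<K> \<and> range \<Xi> \<subseteq> gromov_boundary M d \<and> boundary_tendsto_boundary M d \<Xi> \<xi>"
    then obtain U where "U \<in> \<K>"
        "Inr \<xi> \<in> U \<and> range \<Xi> \<subseteq> gromov_boundary M d \<and> boundary_tendsto_boundary M d \<Xi> \<xi>"
      by auto
    then show "\<forall>\<^sub>F n in sequentially. Inr (\<Xi> n) \<in> \<Union>\<K>"
      using K unfolding gromov_open_def by (intro up[of U]) blast+
  qed
qed

lemma openin_gromov_compactification:
  "openin (gromov_compactification M d) U \<longleftrightarrow> gromov_open M d U"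
  by (simp add: gromov_compactification_def istopology_gromov_open)

lemma topspace_gromov_compactification:
  assumes "Metric_space M d"
  shows "topspace (gromov_compactification M d) = M <+> gromov_boundary M d"
proof -
  have "Inl -` (M <+> gromov_boundary M d) = M"
    by auto
  moreover have "openin (Metric_space.mtopology M d) M"
    using Metric_space.topspace_mtopology[OF assms] openin_topspace by metis
  ultimately have "gromov_open M d (M <+> gromov_boundary M d)"
    by (auto simp: gromov_open_def range_subsetD intro!: always_eventually)
  then show ?thesis
    by (auto simp: topspace_def openin_gromov_compactification gromov_open_def)
qed

section \<open>Local Gromov model domains\<close>

definition gromov_model :: "(complex ^ 'n) set \<Rightarrow> bool" where
  "gromov_model W \<longleftrightarrow>
     connected W \<and> complete_kobayashi_hyperbolic W \<and>
     gromov_hyperbolic W (kobayashi_dist W) \<and>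
     (\<exists>F. homeomorphic_map (gromov_compactification W (kobayashi_dist W))
            (top_of_set (closure W)) F \<and> (\<forall>x\<in>W. F (Inl x) = x))"

text \<open>Taking the neighbourhood \<open>U\<close> open is no restriction: if only \<open>U \<inter> \<Omega>\<close> is open, replace \<open>U\<close> by
  \<open>interior U \<union> (U \<inter> \<Omega>)\<close>.\<close>

definition local_gromov_model_domain :: "(complex ^ 'n) set \<Rightarrow> bool" where
  "local_gromov_model_domain \<Omega> \<longleftrightarrow>
     complex_domain \<Omega> \<and> kobayashi_hyperbolic \<Omega> \<and>
     (\<forall>\<xi>\<in>frontier \<Omega>. \<exists>U. open U \<and> bounded U \<and> \<xi> \<in> U \<and> gromov_model (U \<inter> \<Omega>))"

section \<open>Squeezing functions\<close>

definition admits_squeezing :: "(complex ^ 'n) set \<Rightarrow> bool" where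
  "admits_squeezing \<Omega> \<longleftrightarrow>
     (\<exists>\<phi> :: complex ^ 'n \<Rightarrow> complex ^ 'n.
        holomorphic_vec_on \<phi> \<Omega> \<and> inj_on \<phi> \<Omega> \<and> \<phi> ` \<Omega> \<subseteq> ball 0 1)"

definition squeezing_function :: "(complex ^ 'n) set \<Rightarrow> complex ^ 'n \<Rightarrow> real" where
  "squeezing_function \<Omega> z =
     Sup {r. 0 < r \<and> r \<le> 1 \<and>
            (\<exists>\<phi> :: complex ^ 'n \<Rightarrow> complex ^ 'n.
               holomorphic_vec_on \<phi> \<Omega> \<and> inj_on \<phi> \<Omega> \<and> \<phi> ` \<Omega> \<subseteq> ball 0 1 \<and>
               \<phi> z = 0 \<and> ball 0 r \<subseteq> \<phi> ` \<Omega>)}"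

section \<open>Strongly asymptotic rays\<close>

definition strongly_asymptotic ::
  "('a \<Rightarrow> 'a \<Rightarrow> real) \<Rightarrow> (real \<Rightarrow> 'a) \<Rightarrow> (real \<Rightarrow> 'a) \<Rightarrow> bool" where
  "strongly_asymptotic d \<gamma> \<sigma> \<longleftrightarrow> (\<exists>T. ((\<lambda>t. d (\<gamma> t) (\<sigma> (t + T))) \<longlongrightarrow> 0) at_top)"

end

theory Submission
  imports Defs "HOL-Complex_Analysis.Complex_Analysis"
begin

text \<open>
  Near \<open>\<xi>\<close> the distances \<open>k\<^sub>\<Omega>\<close> and \<open>k\<^sub>W\<close>, \<open>W = U \<inter> \<Omega>\<close>, are locally comparable up to a constant factor,
  because \<open>\<Omega>\<close> is hyperbolically embedded. So both rays are eventually quasigeodesics of the Gromov hyperbolic space \<open>W\<close>;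
  by the Morse lemma each stays close to a geodesic ray of \<open>W\<close>, and the two geodesic rays are asymptotic
  because their classes correspond to the same Euclidean boundary point. Hence \<open>k\<^sub>\<Omega>(\<gamma>(t), \<sigma>(t))\<close> is bounded.

  If the rays did not approach each other, rescale along \<open>\<gamma>(t\<^sub>n)\<close> by injective maps into the ball that send \<open>\<gamma>(t\<^sub>n)\<close> to \<open>0\<close> and
  have almost full image. In the limit both rays become geodesic lines of the ball with the same endpoints \<open>e\<close> and \<open>-e\<close>,
  the first one through \<open>0\<close>. Along the second line the Busemann functions at \<open>e\<close> and \<open>-e\<close> add up to \<open>0\<close>, which forces it through \<open>0\<close> as well:
  a contradiction. That inverses of the rescaling maps are holomorphic along complex lines
  follows from Rado's theorem, applied to the Jacobian determinant.
\<close>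

section \<open>The Poincare distance\<close>

text \<open>\<open>\<Omega>\<close> is not assumed complete, so curves in \<open>\<Omega>\<close>
  come only from nearly optimal chains of discs; geodesics are constructed in the bounded complete
  piece \<open>W\<close> alone. The distances of \<open>\<Omega>\<close> and \<open>W\<close> are
  compared only at short range. This suffices: a ray can be cut into short pieces, which bounds
  \<open>kobayashi_dist W\<close> from above, while \<open>W \<subseteq> \<Omega>\<close> bounds it
  from below. For the rescaled rays to stay far apart in the limit,
  \<open>kobayashi_dist \<Omega>\<close> must be bounded from above by distances of the ball, that
  is, discs of the ball must be pulled back to \<open>\<Omega>\<close>. Distances of the ball are
  realised on affine complex lines, so the inverse maps need to be holomorphic on such lines only.
  Distances of the ball enter through the square of their hyperbolic cosine, a rational expression
  in the Hermitian product, to which limits apply directly. That every late point of one ray is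
  close to some point of the other does not yet give a single shift \<open>T\<close>; compactness of
  the possible shifts supplies it.\<close>

lemma tanh_artanh_real:
  fixes x :: real
  assumes "\<bar>x\<bar> < 1"
  shows "tanh (artanh x) = x"
proof -
  define y where "y = sqrt ((1 + x) / (1 - x))"
  have pos: "(1 + x) / (1 - x) > 0"
    using assms by auto
  then have y: "y > 0" "y ^ 2 = (1 + x) / (1 - x)"
    by (auto simp: y_def)
  have "artanh x = ln y"
    using pos by (simp add: artanh_def y_def ln_sqrt)
  then have "tanh (artanh x) = (y ^ 2 - 1) / (y ^ 2 + 1)"
    using tanh_ln_real[OF y(1)] by simp
  also have "\<dots> = x"
    unfolding y(2) using assms by (simp add: divide_simps)
  finally show ?thesis .
qed

lemma artanh_real_le_iff:
  fixes x y :: real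
  assumes "\<bar>x\<bar> < 1" "\<bar>y\<bar> < 1"
  shows "artanh x \<le> artanh y \<longleftrightarrow> x \<le> y"
  using tanh_real_le_iff[of "artanh x" "artanh y"] assms by (simp add: tanh_artanh_real)

lemma artanh_real_nonneg:
  fixes x :: real
  assumes "0 \<le> x" "x < 1"
  shows "0 \<le> artanh x"
  using artanh_real_le_iff[of 0 x] assms by simp

text \<open>This bound and \<open>artanh_le_double\<close> exchange \<open>artanh x\<close> for
  \<open>x\<close> at the cost of a factor 2 each. Together they produce the factor 4 in
  \<open>kobayashi_localization\<close>.\<close>

lemma artanh_ge_half:
  fixes x :: real
  assumes "0 \<le> x" "x < 1"
  shows "x / 2 \<le> artanh x"
proof -
  have "x \<le> - ln (1 - x)"
    using ln_one_minus_pos_upper_bound[of x] assms by simp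
  moreover have "0 \<le> ln (1 + x)"
    using assms by simp
  moreover have "artanh x = (ln (1 + x) - ln (1 - x)) / 2"
    using assms by (simp add: artanh_def ln_div)
  ultimately show ?thesis by simp
qed

lemma artanh_le_double:
  fixes x :: real
  assumes "0 \<le> x" "x \<le> 1/2"
  shows "artanh x \<le> 2 * x"
proof -
  have "- ln (1 - x) = ln (1 + x / (1 - x))"
    using assms by (simp add: ln_div[symmetric] ln_inverse[symmetric] field_simps)
  also have "\<dots> \<le> x / (1 - x)"
    using assms by (intro ln_add_one_self_le_self) auto
  also have "\<dots> \<le> 2 * x"
    using assms mult_left_mono[of 1 "2 * (1 - x)" x] by (simp add: divide_simps algebra_simps)
  finally have "- ln (1 - x) \<le> 2 * x" .
  moreover have "ln (1 + x) \<le> x"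
    using assms by (intro ln_add_one_self_le_self) auto
  moreover have "artanh x = (ln (1 + x) - ln (1 - x)) / 2"
    using assms by (simp add: artanh_def ln_div)
  ultimately show ?thesis using assms by simp
qed

text \<open>Passing from a distance to the square of its hyperbolic cosine removes
  \<open>artanh\<close> and leaves a rational function of the points.\<close>

lemma cosh_artanh_squared:
  fixes q :: real
  assumes "\<bar>q\<bar> < 1"
  shows "(cosh (artanh q))\<^sup>2 = 1 / (1 - q\<^sup>2)"
proof -
  have q: "tanh (artanh q) = q"
    using assms by (rule tanh_artanh_real)
  have "q\<^sup>2 < 1"
    using assms abs_square_less_1 by blast
  moreover have "(cosh (artanh q))\<^sup>2 * (1 - (tanh (artanh q))\<^sup>2) = 1"
  proof -
    have "(cosh (artanh q))\<^sup>2 * (1 - (tanh (artanh q))\<^sup>2) = (cosh (artanh q))\<^sup>2 - (sinh (artanh q))\<^sup>2"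
      by (simp add: tanh_def power_divide right_diff_distrib)
    then show ?thesis
      using cosh_square_eq[of "artanh q"] by simp
  qed
  ultimately show ?thesis
    unfolding q by (simp add: field_simps)
qed

lemma poincare_dist_Moebius:
  "poincare_dist a b = artanh (cmod (Moebius_function 0 a b))"
  unfolding poincare_dist_def Moebius_function_simple by (simp add: norm_divide norm_minus_commute)

lemma poincare_dist_nonneg:
  assumes "a \<in> ball 0 1" "b \<in> ball 0 1"
  shows "0 \<le> poincare_dist a b"
  unfolding poincare_dist_Moebius using assms Moebius_function_norm_lt_1
  by (intro artanh_real_nonneg) auto

lemma poincare_dist_0: "poincare_dist 0 b = artanh (cmod b)"
  by (simp add: poincare_dist_def)

lemma Moebius_compose_neg:
  assumes "a \<in> ball 0 1" "z \<in> ball 0 1"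
  shows "Moebius_function 0 (- a) (Moebius_function 0 a z) = z"
    and "Moebius_function 0 a (Moebius_function 0 (- a) z) = z"
  using assms Moebius_function_compose[of "-a" a z] Moebius_function_compose[of a "-a" z] by auto

lemma Moebius_ball:
  assumes "a \<in> ball 0 1" "z \<in> ball 0 1"
  shows "Moebius_function 0 a z \<in> ball 0 1" "Moebius_function 0 (- a) z \<in> ball 0 1"
  using assms Moebius_function_norm_lt_1 by auto

text \<open>Conjugation by the Moebius maps that move \<open>a\<close> and \<open>g a\<close> to 0
  reduces this to the Schwarz lemma.\<close>

lemma Schwarz_Pick:
  assumes hol: "g holomorphic_on ball 0 1" and img: "g ` ball 0 1 \<subseteq> ball 0 1"
    and a: "a \<in> ball 0 1" and b: "b \<in> ball 0 1"
  shows "cmod (Moebius_function 0 (g a) (g b)) \<le> cmod (Moebius_function 0 a b)"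
proof -
  define h where "h = Moebius_function 0 (g a) \<circ> g \<circ> Moebius_function 0 (- a)"
  have ga: "g a \<in> ball 0 1"
    using img a by blast
  have mapa: "Moebius_function 0 (- a) ` ball 0 1 \<subseteq> ball 0 1"
    using a Moebius_ball by blast
  have holh: "h holomorphic_on ball 0 1"
    unfolding h_def
  proof (intro holomorphic_on_compose_gen)
    show "Moebius_function 0 (- a) holomorphic_on ball 0 1"
      using a by (intro Moebius_function_holomorphic) auto
    show "g holomorphic_on ball 0 1" by fact
    show "Moebius_function 0 (g a) holomorphic_on ball 0 1"
      using ga by (intro Moebius_function_holomorphic) auto
  qed (use mapa img in auto)
  have "Moebius_function 0 (- a) 0 = a"
    by (simp add: Moebius_function_of_zero)
  then have "h 0 = 0"
    by (simp add: h_def Moebius_function_eq_zero)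
  moreover have "cmod (h z) < 1" if "cmod z < 1" for z
  proof -
    have "g (Moebius_function 0 (- a) z) \<in> ball 0 1"
      using mapa img that by (auto simp: image_subset_iff)
    then show ?thesis
      using Moebius_ball(1)[OF ga] unfolding h_def by auto
  qed
  ultimately have "cmod (h (Moebius_function 0 a b)) \<le> cmod (Moebius_function 0 a b)"
    using Schwarz_Lemma(1)[OF holh] Moebius_ball(1)[OF a b] by auto
  then show ?thesis
    unfolding h_def using Moebius_compose_neg(1)[OF a b] by simp
qed

lemma poincare_dist_contract:
  assumes "g holomorphic_on ball 0 1" "g ` ball 0 1 \<subseteq> ball 0 1" "a \<in> ball 0 1" "b \<in> ball 0 1"
  shows "poincare_dist (g a) (g b) \<le> poincare_dist a b"
proof -
  have g: "g a \<in> ball 0 1" "g b \<in> ball 0 1"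
    using assms by blast+
  show ?thesis
    unfolding poincare_dist_Moebius
    using Schwarz_Pick[OF assms] Moebius_ball(1)[OF g] Moebius_ball(1)[OF assms(3,4)]
    by (subst artanh_real_le_iff) auto
qed

lemma artanh_add_real:
  fixes x y :: real
  assumes "0 \<le> x" "x < 1" "0 \<le> y" "y < 1"
  shows "artanh x + artanh y = artanh ((x + y) / (1 + x * y))"
proof -
  have "tanh (artanh x + artanh y) = (x + y) / (1 + x * y)"
    using assms by (simp add: tanh_add tanh_artanh_real)
  then show ?thesis
    using artanh_tanh_real by metis
qed

lemma Moebius_one_minus_norm_squared:
  assumes "cmod w < 1" "cmod z < 1"
  shows "1 - (cmod (Moebius_function 0 w z))\<^sup>2
           = (1 - (cmod w)\<^sup>2) * (1 - (cmod z)\<^sup>2) / (cmod (1 - cnj w * z))\<^sup>2"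
proof -
  have "cmod (cnj w * z) < 1"
    using norm_mult_less[of "cnj w" 1 z 1] assms by simp
  then have nz: "1 - cnj w * z \<noteq> 0"
    by auto
  have "(cmod (1 - cnj w * z))\<^sup>2 - (cmod (z - w))\<^sup>2 = (1 - (cmod w)\<^sup>2) * (1 - (cmod z)\<^sup>2)"
    unfolding cmod_power2 by (simp add: algebra_simps power2_eq_square)
  with nz show ?thesis
    unfolding Moebius_function_simple by (simp add: norm_divide power_divide diff_divide_eq_iff)
qed

text \<open>This is the triangle inequality of the Poincare distance for 0, \<open>w\<close>,
  \<open>w'\<close>. Writing \<open>w'\<close> as a Moebius image of \<open>\<zeta>\<close>, whose
  norm encodes the distance from \<open>w\<close>, bounds \<open>cmod w'\<close> by the expression
  in the addition formula of \<open>tanh\<close>.\<close>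

lemma artanh_norm_le_poincare:
  assumes w: "w \<in> ball 0 1" "w' \<in> ball 0 1"
  shows "artanh (cmod w') \<le> artanh (cmod w) + poincare_dist w w'"
proof -
  define \<zeta> where "\<zeta> = Moebius_function 0 w w'"
  define x where "x = cmod w"
  define q where "q = cmod \<zeta>"
  have \<zeta>: "\<zeta> \<in> ball 0 1" and w': "w' = Moebius_function 0 (- w) \<zeta>"
    using Moebius_ball[OF w] Moebius_compose_neg[OF w] by (auto simp: \<zeta>_def)
  have x: "0 \<le> x" "x < 1" and q: "0 \<le> q" "q < 1"
    using w \<zeta> by (auto simp: x_def q_def)
  have xq: "0 < 1 + x * q"
    using x q by (simp add: add_pos_nonneg)
  have "0 \<le> (1 - x) * (1 - q)"
    using x q by simp
  then have lt: "(x + q) / (1 + x * q) \<le> 1"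
    using xq by (simp add: divide_simps algebra_simps)
  have lt1: "(x + q) / (1 + x * q) < 1"
  proof -
    have "0 < (1 - x) * (1 - q)" using x q by simp
    then show ?thesis using xq by (simp add: divide_simps algebra_simps)
  qed
  have "cmod (cnj w * \<zeta>) < 1"
    using norm_mult_less[of "cnj w" 1 \<zeta> 1] w \<zeta> by simp
  then have nz: "1 + cnj w * \<zeta> \<noteq> 0"
    by (metis add.inverse_unique norm_minus_cancel norm_one order_less_irrefl)
  have le: "cmod (1 + cnj w * \<zeta>) \<le> 1 + x * q"
    using norm_triangle_ineq[of 1 "cnj w * \<zeta>"] by (simp add: norm_mult x_def q_def)
  have "1 - (cmod w')\<^sup>2 = (1 - x\<^sup>2) * (1 - q\<^sup>2) / (cmod (1 + cnj w * \<zeta>))\<^sup>2"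
    unfolding w' using Moebius_one_minus_norm_squared[of "- w" \<zeta>] w \<zeta> by (simp add: x_def q_def)
  also have "\<dots> \<ge> (1 - x\<^sup>2) * (1 - q\<^sup>2) / (1 + x * q)\<^sup>2"
  proof (rule divide_left_mono)
    show "(cmod (1 + cnj w * \<zeta>))\<^sup>2 \<le> (1 + x * q)\<^sup>2"
      using le by (intro power_mono) auto
    show "0 \<le> (1 - x\<^sup>2) * (1 - q\<^sup>2)"
      using x q by (intro mult_nonneg_nonneg) (auto simp: power_le_one)
    show "0 < (1 + x * q)\<^sup>2 * (cmod (1 + cnj w * \<zeta>))\<^sup>2"
      using nz xq by (intro mult_pos_pos) auto
  qed
  finally have "(cmod w')\<^sup>2 \<le> 1 - (1 - x\<^sup>2) * (1 - q\<^sup>2) / (1 + x * q)\<^sup>2"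
    by simp
  also have "\<dots> = ((x + q) / (1 + x * q))\<^sup>2"
    using xq by (simp add: power_divide diff_divide_eq_iff) (simp add: power2_eq_square algebra_simps)
  finally have "cmod w' \<le> (x + q) / (1 + x * q)"
    using x q by (simp add: power2_le_iff_abs_le)
  then have "artanh (cmod w') \<le> artanh ((x + q) / (1 + x * q))"
    using lt1 w x q xq by (subst artanh_real_le_iff) auto
  also have "\<dots> = artanh x + artanh q"
    using x q by (simp add: artanh_add_real)
  finally show ?thesis
    by (simp add: x_def q_def \<zeta>_def poincare_dist_Moebius)
qed

text \<open>The unit speed geodesic from \<open>a\<close> towards \<open>b\<close>: a radius of the
  disc, carried from 0 back to \<open>a\<close>. If \<open>a = b\<close>, then \<open>sgn\<close>
  yields 0 and the segment is constant.\<close>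

definition poincare_segment :: "complex \<Rightarrow> complex \<Rightarrow> real \<Rightarrow> complex" where
  "poincare_segment a b s = Moebius_function 0 (- a) (of_real (tanh s) * sgn (Moebius_function 0 a b))"

lemma poincare_segment:
  assumes a: "a \<in> ball 0 1" and b: "b \<in> ball 0 1"
  shows "poincare_segment a b s \<in> ball 0 1"
    and "poincare_segment a b 0 = a"
    and "poincare_segment a b (poincare_dist a b) = b"
    and "poincare_dist (poincare_segment a b s) (poincare_segment a b t) \<le> \<bar>s - t\<bar>"
    and "continuous_on UNIV (poincare_segment a b)"
proof -
  define e where "e = sgn (Moebius_function 0 a b)"
  have e: "cmod e \<le> 1"
    by (simp add: e_def norm_sgn)
  have in_ball: "of_real (tanh s) * e \<in> ball 0 1" for s
  proof -
    have "cmod (of_real (tanh s) * e) \<le> \<bar>tanh s\<bar>"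
      using e by (simp add: norm_mult mult_left_le)
    also have "\<dots> < 1"
      using tanh_real_bounds[of s] by auto
    finally show ?thesis by simp
  qed
  show seg: "poincare_segment a b s \<in> ball 0 1" for s
    unfolding poincare_segment_def e_def[symmetric] using Moebius_ball(2)[OF a in_ball] .
  show "poincare_segment a b 0 = a"
    by (simp add: poincare_segment_def Moebius_function_of_zero)
  have "of_real (tanh (poincare_dist a b)) * e = Moebius_function 0 a b"
  proof -
    have "tanh (poincare_dist a b) = cmod (Moebius_function 0 a b)"
      using Moebius_ball(1)[OF a b] by (simp add: poincare_dist_Moebius tanh_artanh_real)
    then show ?thesis
      unfolding e_def by (simp add: sgn_div_norm scaleR_conv_of_real field_simps)
  qed
  then show "poincare_segment a b (poincare_dist a b) = b"
    using Moebius_compose_neg(1)[OF a b] unfolding poincare_segment_def e_def by simp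
  have img: "Moebius_function 0 (- a) ` ball 0 1 \<subseteq> ball 0 1"
    using Moebius_ball(2)[OF a] by blast
  have hol: "Moebius_function 0 (- a) holomorphic_on ball 0 1"
    using a by (intro Moebius_function_holomorphic) auto
  have "poincare_dist (poincare_segment a b s) (poincare_segment a b t)
      \<le> poincare_dist (of_real (tanh s) * e) (of_real (tanh t) * e)"
    unfolding poincare_segment_def e_def[symmetric]
    by (rule poincare_dist_contract[OF hol img in_ball in_ball])
  also have "\<dots> \<le> \<bar>s - t\<bar>"
  proof (cases "Moebius_function 0 a b = 0")
    case True
    then show ?thesis by (simp add: e_def poincare_dist_def)
  next
    case False
    then have e1: "cmod e = 1"
      by (simp add: e_def norm_sgn)
    have ee: "cnj e * e = 1"
      using e1 by (metis complex_norm_square mult.commute of_real_1 one_power2)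
    have "(of_real (tanh s) * e - of_real (tanh t) * e) / (1 - cnj (of_real (tanh s) * e) * (of_real (tanh t) * e))
        = e * of_real ((tanh s - tanh t) / (1 - tanh s * tanh t))"
    proof -
      have "cnj (of_real (tanh s) * e) * (of_real (tanh t) * e) = (cnj e * e) * of_real (tanh s * tanh t)"
        by simp
      also have "\<dots> = of_real (tanh s * tanh t)"
        by (simp only: ee mult_1)
      finally have eq: "cnj (of_real (tanh s) * e) * (of_real (tanh t) * e) = of_real (tanh s * tanh t)" .
      have num: "of_real (tanh s) * e - of_real (tanh t) * e = e * of_real (tanh s - tanh t)"
        by (simp add: algebra_simps)
      show ?thesis
        by (simp only: eq num of_real_diff of_real_divide of_real_1 times_divide_eq_right)
    qed
    then have "poincare_dist (of_real (tanh s) * e) (of_real (tanh t) * e)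
        = artanh \<bar>(tanh s - tanh t) / (1 - tanh s * tanh t)\<bar>"
      unfolding poincare_dist_def by (simp only: norm_mult e1 norm_of_real mult_1)
    also have "(tanh s - tanh t) / (1 - tanh s * tanh t) = tanh (s - t)"
      using tanh_add[of s "- t"] by simp
    also have "artanh \<bar>tanh (s - t)\<bar> = \<bar>s - t\<bar>"
      using artanh_tanh_real[of "\<bar>s - t\<bar>"] by (simp only: tanh_real_abs)
    finally show ?thesis by simp
  qed
  finally show "poincare_dist (poincare_segment a b s) (poincare_segment a b t) \<le> \<bar>s - t\<bar>" .
  have "continuous_on UNIV (Moebius_function 0 (- a) \<circ> (\<lambda>s. of_real (tanh s) * e))"
  proof (rule continuous_on_compose)
    show "continuous_on UNIV (\<lambda>s. of_real (tanh s) * e)"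
      by (intro continuous_intros) auto
    have "range (\<lambda>s. of_real (tanh s) * e) \<subseteq> ball 0 1"
      using in_ball by auto
    then show "continuous_on (range (\<lambda>s. of_real (tanh s) * e)) (Moebius_function 0 (- a))"
      using hol holomorphic_on_imp_continuous_on continuous_on_subset by blast
  qed
  then show "continuous_on UNIV (poincare_segment a b)"
    unfolding poincare_segment_def e_def comp_def .
qed

section \<open>The Kobayashi distance\<close>

lemma norm_vector_smult_complex: "norm (c *s v) = cmod c * norm (v :: complex ^ 'n)"
  by (simp add: norm_vec_def norm_mult L2_set_right_distrib)

lemma norm_le_sum_components: "norm (v :: complex ^ 'n) \<le> (\<Sum>i\<in>UNIV. cmod (v $ i))"
  unfolding norm_vec_def by (rule L2_set_le_sum) simp

text \<open>Separating the links from the endpoint conditions allows a chain to be truncated and its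
  intermediate points to be compared with the start.\<close>

definition kobayashi_chain ::
  "(complex ^ 'n) set \<Rightarrow> nat \<Rightarrow> (nat \<Rightarrow> complex) \<Rightarrow> (nat \<Rightarrow> complex) \<Rightarrow>
    (nat \<Rightarrow> complex \<Rightarrow> complex ^ 'n) \<Rightarrow> (nat \<Rightarrow> complex ^ 'n) \<Rightarrow> bool" where
  "kobayashi_chain \<Omega> n a b f z \<longleftrightarrow>
     (\<forall>j<n. disc_map_into \<Omega> (f j) \<and> a j \<in> ball 0 1 \<and> b j \<in> ball 0 1 \<and>
            f j (a j) = z j \<and> f j (b j) = z (Suc j))"

lemma kobayashi_chain_lengths_eq:
  "kobayashi_chain_lengths \<Omega> x y =
     {(\<Sum>j<n. poincare_dist (a j) (b j)) | n a b f z. z 0 = x \<and> z n = y \<and> kobayashi_chain \<Omega> n a b f z}"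
  unfolding kobayashi_chain_lengths_def kobayashi_chain_def by simp

lemma kobayashi_chainD:
  assumes "kobayashi_chain \<Omega> n a b f z" "j < n"
  shows "disc_map_into \<Omega> (f j)" "a j \<in> ball 0 1" "b j \<in> ball 0 1"
    "f j (a j) = z j" "f j (b j) = z (Suc j)"
  using assms unfolding kobayashi_chain_def by blast+

lemma kobayashi_chain_mono_length:
  assumes "kobayashi_chain \<Omega> n a b f z" "m \<le> n"
  shows "kobayashi_chain \<Omega> m a b f z"
  using assms unfolding kobayashi_chain_def by auto

lemma kobayashi_chain_length_nonneg:
  assumes "kobayashi_chain \<Omega> n a b f z"
  shows "0 \<le> (\<Sum>j<n. poincare_dist (a j) (b j))"
  using kobayashi_chainD(2,3)[OF assms] by (intro sum_nonneg poincare_dist_nonneg) auto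

lemma kobayashi_chain_point_mem:
  assumes "kobayashi_chain \<Omega> n a b f z" "z 0 \<in> \<Omega>" "j \<le> n"
  shows "z j \<in> \<Omega>"
proof (cases j)
  case 0
  then show ?thesis using assms by simp
next
  case (Suc i)
  then have "i < n" using assms by simp
  then have "disc_map_into \<Omega> (f i)" "b i \<in> ball 0 1" "f i (b i) = z j"
    using kobayashi_chainD[OF assms(1)] Suc by auto
  then show ?thesis
    unfolding disc_map_into_def by (metis image_subset_iff)
qed

lemma kobayashi_chain_lengths_nonneg:
  assumes "r \<in> kobayashi_chain_lengths \<Omega> x y"
  shows "0 \<le> r"
  using assms kobayashi_chain_length_nonneg unfolding kobayashi_chain_lengths_eq by fastforce

lemma kobayashi_dist_le_chain:
  assumes "x \<in> \<Omega>" "y \<in> \<Omega>" "r \<in> kobayashi_chain_lengths \<Omega> x y"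
  shows "kobayashi_dist \<Omega> x y \<le> r"
  using assms kobayashi_chain_lengths_nonneg unfolding kobayashi_dist_def
  by (auto intro!: cInf_lower bdd_belowI[of _ 0])

lemma disc_map_into_mem: "disc_map_into \<Omega> f \<Longrightarrow> a \<in> ball 0 1 \<Longrightarrow> f a \<in> \<Omega>"
  unfolding disc_map_into_def by blast

lemma kobayashi_dist_disc:
  assumes "disc_map_into \<Omega> f" "a \<in> ball 0 1" "b \<in> ball 0 1"
  shows "kobayashi_dist \<Omega> (f a) (f b) \<le> poincare_dist a b"
proof -
  have "kobayashi_chain \<Omega> 1 (\<lambda>_. a) (\<lambda>_. b) (\<lambda>_. f) (\<lambda>j. if j = 0 then f a else f b)"
    using assms by (simp add: kobayashi_chain_def)
  then have "poincare_dist a b \<in> kobayashi_chain_lengths \<Omega> (f a) (f b)"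
    unfolding kobayashi_chain_lengths_eq
    by (intro CollectI exI[of _ "1::nat"] exI[of _ "\<lambda>_. a"] exI[of _ "\<lambda>_. b"] exI[of _ "\<lambda>_. f"]
          exI[of _ "\<lambda>j. if j = 0 then f a else f b"]) simp
  then show ?thesis
    using assms disc_map_into_mem by (intro kobayashi_dist_le_chain)
qed

lemma kobayashi_chain_lengths_snoc:
  assumes r: "r \<in> kobayashi_chain_lengths \<Omega> x (f a)"
    and f: "disc_map_into \<Omega> f" "a \<in> ball 0 1" "b \<in> ball 0 1"
  shows "r + poincare_dist a b \<in> kobayashi_chain_lengths \<Omega> x (f b)"
proof -
  obtain n a' b' f' z where r': "r = (\<Sum>j<n. poincare_dist (a' j) (b' j))"
    and z: "z 0 = x" "z n = f a" and ch: "kobayashi_chain \<Omega> n a' b' f' z"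
    using r unfolding kobayashi_chain_lengths_eq by blast
  have "kobayashi_chain \<Omega> (Suc n) (a'(n := a)) (b'(n := b)) (f'(n := f)) (z(Suc n := f b))"
    using ch f z unfolding kobayashi_chain_def by (auto simp: less_Suc_eq)
  moreover have "(\<Sum>j<Suc n. poincare_dist ((a'(n := a)) j) ((b'(n := b)) j)) = r + poincare_dist a b"
    unfolding r' by simp
  ultimately show ?thesis
    unfolding kobayashi_chain_lengths_eq using z
    by (intro CollectI exI[of _ "Suc n"] exI[of _ "a'(n := a)"] exI[of _ "b'(n := b)"]
        exI[of _ "f'(n := f)"] exI[of _ "z(Suc n := f b)"]) auto
qed

section \<open>Affine discs and the existence of chains\<close>

lemma disc_map_into_affine:
  assumes "\<And>l. l \<in> ball 0 1 \<Longrightarrow> x + l *s v \<in> \<Omega>"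
  shows "disc_map_into \<Omega> (\<lambda>l. x + l *s v)"
  using assms unfolding disc_map_into_def by (auto intro!: holomorphic_intros)

lemma ball_disc_through:
  assumes "ball x r \<subseteq> \<Omega>" "y \<in> ball x r"
  obtains f b where "disc_map_into \<Omega> f" "b \<in> ball 0 1" "f 0 = x" "f b = y" "cmod b = dist x y / r"
proof -
  have r: "r > 0" "dist x y < r"
    using assms by (auto dest: order.strict_trans1[OF zero_le_dist])
  \<comment> \<open>For \<open>y = x\<close> this is 0 and the disc is constant, so no separate
    construction is made.\<close>
  define v where "v = r *\<^sub>R sgn (y - x)"
  define b where "b = complex_of_real (dist x y / r)"
  have nv: "norm v \<le> r"
    using r by (simp add: v_def norm_sgn)
  have "disc_map_into \<Omega> (\<lambda>l. x + l *s v)"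
  proof (rule disc_map_into_affine)
    fix l :: complex assume l: "l \<in> ball 0 1"
    have "cmod l * norm v \<le> cmod l * r"
      using nv by (intro mult_left_mono) auto
    also have "\<dots> < r" using l r by simp
    finally have "x + l *s v \<in> ball x r"
      by (simp add: dist_norm norm_vector_smult_complex)
    then show "x + l *s v \<in> \<Omega>" using assms by blast
  qed
  moreover have cb: "cmod b = dist x y / r"
    using r by (simp add: b_def norm_divide)
  moreover have "b \<in> ball 0 1" using r cb by simp
  moreover have "x + b *s v = y"
  proof -
    have "b *s v = (dist x y / r) *\<^sub>R v"
      by (simp add: vec_eq_iff b_def scaleR_conv_of_real[where 'a = complex])
    also have "\<dots> = dist x y *\<^sub>R sgn (y - x)"
      using r by (simp add: v_def)
    also have "\<dots> = y - x"
      by (cases "x = y") (simp_all add: dist_norm norm_minus_commute sgn_div_norm)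
    finally show ?thesis by simp
  qed
  ultimately show ?thesis
    using that[of "\<lambda>l. x + l *s v" b] by simp
qed

text \<open>Being reachable from \<open>x\<close> by a chain is locally constant: with radius
  \<open>r/3\<close>, any two points \<open>u\<close>, \<open>v\<close> of the small ball lie in a
  common affine disc centred at \<open>u\<close> of radius \<open>2*r/3\<close>, still inside
  \<open>ball w r\<close>. Connectedness does the rest, and the infimum in
  \<open>kobayashi_dist\<close> is then meaningful.\<close>

lemma kobayashi_chain_lengths_nonempty:
  assumes "complex_domain \<Omega>" "x \<in> \<Omega>" "y \<in> \<Omega>"
  shows "kobayashi_chain_lengths \<Omega> x y \<noteq> {}"
proof (rule connected_induction_simple[where S = \<Omega> and P = "\<lambda>y. kobayashi_chain_lengths \<Omega> x y \<noteq> {}" and a = x and b = y])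
  have "kobayashi_chain \<Omega> 0 (\<lambda>_. 0) (\<lambda>_. 0) (\<lambda>_ _. x) (\<lambda>_. x)"
    by (simp add: kobayashi_chain_def)
  then have "0 \<in> kobayashi_chain_lengths \<Omega> x x"
    unfolding kobayashi_chain_lengths_eq
    by (intro CollectI exI[of _ "0::nat"] exI[of _ "\<lambda>_. 0"] exI[of _ "\<lambda>_ _. x"] exI[of _ "\<lambda>_. x"]) simp
  then show "kobayashi_chain_lengths \<Omega> x x \<noteq> {}" by blast
  fix w assume w: "w \<in> \<Omega>"
  then obtain r where r: "r > 0" "ball w r \<subseteq> \<Omega>"
    using assms openE unfolding complex_domain_def by blast
  have step: "kobayashi_chain_lengths \<Omega> x v \<noteq> {}"
    if u: "u \<in> ball w (r/3)" and v: "v \<in> ball w (r/3)" and ne: "kobayashi_chain_lengths \<Omega> x u \<noteq> {}" for u v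
  proof -
    have "ball u (2*r/3) \<subseteq> \<Omega>"
      using u r(2) by (intro order.trans[OF _ r(2)]) (auto simp: ball_subset_ball_iff dist_commute)
    moreover have "v \<in> ball u (2*r/3)"
      using u v dist_triangle2[of u v w] by (simp add: dist_commute)
    ultimately obtain f b where "disc_map_into \<Omega> f" "b \<in> ball 0 1" "f 0 = u" "f b = v"
      using ball_disc_through by metis
    then show ?thesis
      using ne kobayashi_chain_lengths_snoc[of _ \<Omega> x f 0 b] by auto
  qed
  show "\<exists>T. openin (top_of_set \<Omega>) T \<and> w \<in> T \<and>
      (\<forall>u\<in>T. \<forall>v\<in>T. kobayashi_chain_lengths \<Omega> x u \<noteq> {} \<longrightarrow> kobayashi_chain_lengths \<Omega> x v \<noteq> {})"
  proof (intro exI[of _ "ball w (r/3)"] conjI ballI impI)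
    have "ball w (r/3) \<subseteq> \<Omega>"
      using r by (intro order.trans[OF _ r(2)] subset_ball) auto
    then show "openin (top_of_set \<Omega>) (ball w (r/3))"
      by (simp add: open_subset)
    show "w \<in> ball w (r/3)"
      using r(1) by simp
    show "kobayashi_chain_lengths \<Omega> x v \<noteq> {}"
      if "u \<in> ball w (r/3)" "v \<in> ball w (r/3)" "kobayashi_chain_lengths \<Omega> x u \<noteq> {}" for u v
      using step[OF that] .
  qed
qed (use assms in \<open>auto simp: complex_domain_def\<close>)

lemma kobayashi_near_chain:
  assumes "complex_domain \<Omega>" "x \<in> \<Omega>" "y \<in> \<Omega>" "kobayashi_dist \<Omega> x y < e"
  obtains n a b f z where "kobayashi_chain \<Omega> n a b f z" "z 0 = x" "z n = y"
    "kobayashi_dist \<Omega> x y \<le> (\<Sum>j<n. poincare_dist (a j) (b j))" "(\<Sum>j<n. poincare_dist (a j) (b j)) < e"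
proof -
  have "Inf (kobayashi_chain_lengths \<Omega> x y) < e"
    using assms by (simp add: kobayashi_dist_def)
  then obtain r where r: "r \<in> kobayashi_chain_lengths \<Omega> x y" "r < e"
    using cInf_lessD[OF kobayashi_chain_lengths_nonempty[OF assms(1-3)]] by blast
  then obtain n a b f z where "r = (\<Sum>j<n. poincare_dist (a j) (b j))" "z 0 = x" "z n = y" "kobayashi_chain \<Omega> n a b f z"
    unfolding kobayashi_chain_lengths_eq by blast
  then show ?thesis
    using that[of n a b f z] kobayashi_dist_le_chain[OF assms(2,3) r(1)] r(2) by simp
qed

text \<open>The source of all lower bounds below: a function that grows along each disc by at most
  the Poincare distance grows along a chain by at most its length. It is applied to Kobayashi
  distances of larger domains, to Euclidean distances and to distances in the ball.\<close>

lemma kobayashi_dist_lower_bound: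
  assumes dom: "complex_domain \<Omega>" and xy: "x \<in> \<Omega>" "y \<in> \<Omega>"
    and step: "\<And>f a b. disc_map_into \<Omega> f \<Longrightarrow> a \<in> ball 0 1 \<Longrightarrow> b \<in> ball 0 1 \<Longrightarrow>
                 \<rho> (f b) \<le> \<rho> (f a) + poincare_dist a b"
  shows "\<rho> y \<le> \<rho> x + kobayashi_dist \<Omega> x y"
proof (rule field_le_epsilon)
  fix e :: real assume "0 < e"
  then have "kobayashi_dist \<Omega> x y < kobayashi_dist \<Omega> x y + e"
    by simp
  then obtain n a b f z where ch: "kobayashi_chain \<Omega> n a b f z" and z: "z 0 = x" "z n = y"
    and "kobayashi_dist \<Omega> x y \<le> (\<Sum>j<n. poincare_dist (a j) (b j))"
    and lt: "(\<Sum>j<n. poincare_dist (a j) (b j)) < kobayashi_dist \<Omega> x y + e"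
    by (rule kobayashi_near_chain[OF dom xy])
  have "m \<le> n \<Longrightarrow> \<rho> (z m) \<le> \<rho> (z 0) + (\<Sum>j<m. poincare_dist (a j) (b j))" for m
  proof (induction m)
    case (Suc m)
    then show ?case
      using step[of "f m" "a m" "b m"] kobayashi_chainD[OF ch, of m] by auto
  qed simp
  from this[of n] show "\<rho> y \<le> \<rho> x + kobayashi_dist \<Omega> x y + e"
    using lt z by simp
qed

lemma kobayashi_dist_mono:
  assumes "complex_domain W" "W \<subseteq> \<Omega>" "kobayashi_hyperbolic \<Omega>" "x \<in> W" "y \<in> W"
  shows "kobayashi_dist \<Omega> x y \<le> kobayashi_dist W x y"
proof -
  interpret Metric_space \<Omega> "kobayashi_dist \<Omega>"
    using assms by (simp add: kobayashi_hyperbolic_def)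
  have "kobayashi_dist \<Omega> x y \<le> kobayashi_dist \<Omega> x x + kobayashi_dist W x y"
  proof (rule kobayashi_dist_lower_bound[of W x y "kobayashi_dist \<Omega> x"])
    fix f and a b :: complex assume f: "disc_map_into W f" "a \<in> ball 0 1" "b \<in> ball 0 1"
    then have f': "disc_map_into \<Omega> f"
      using assms(2) unfolding disc_map_into_def by auto
    show "kobayashi_dist \<Omega> x (f b) \<le> kobayashi_dist \<Omega> x (f a) + poincare_dist a b"
      using kobayashi_dist_disc[OF f' f(2,3)] disc_map_into_mem[OF f'] f assms
        triangle[of x "f a" "f b"] by (auto simp: subset_iff)
  qed (use assms in auto)
  then show ?thesis using assms by (auto simp: subset_iff)
qed

text \<open>The Kobayashi distance is a length distance: each link is replaced by the image of a
  Poincare segment, and the pieces are glued with the chain length as parameter. Continuity of the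
  resulting curve is what allows intermediate value arguments.\<close>

lemma kobayashi_chain_path:
  assumes "Metric_space \<Omega> (kobayashi_dist \<Omega>)" "kobayashi_chain \<Omega> n a b f z" "z 0 \<in> \<Omega>"
    and L: "L = (\<Sum>j<n. poincare_dist (a j) (b j))"
  shows "\<exists>c. continuous_on {0..L} c \<and> c 0 = z 0 \<and> c L = z n \<and> (\<forall>s\<in>{0..L}. c s \<in> \<Omega>) \<and>
    (\<forall>s\<in>{0..L}. \<forall>t\<in>{0..L}. kobayashi_dist \<Omega> (c s) (c t) \<le> \<bar>s - t\<bar>)"
  using assms(2) L
proof (induction n arbitrary: L)
  case 0
  interpret Metric_space \<Omega> "kobayashi_dist \<Omega>" by fact
  show ?case
    using 0 assms(3) by (intro exI[of _ "\<lambda>_. z 0"]) auto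
next
  case (Suc n)
  interpret Metric_space \<Omega> "kobayashi_dist \<Omega>" by fact
  define K where "K = (\<Sum>j<n. poincare_dist (a j) (b j))"
  have ch: "kobayashi_chain \<Omega> n a b f z"
    using Suc.prems(1) kobayashi_chain_mono_length by fastforce
  obtain c where c: "continuous_on {0..K} c" "c 0 = z 0" "c K = z n" "\<And>s. s \<in> {0..K} \<Longrightarrow> c s \<in> \<Omega>"
      "\<And>s t. s \<in> {0..K} \<Longrightarrow> t \<in> {0..K} \<Longrightarrow> kobayashi_dist \<Omega> (c s) (c t) \<le> \<bar>s - t\<bar>"
    using Suc.IH[OF ch K_def] by blast
  have K: "0 \<le> K"
    unfolding K_def by (rule kobayashi_chain_length_nonneg[OF ch])
  note f = kobayashi_chainD[OF Suc.prems(1), of n, simplified]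
  have ab: "a n \<in> ball 0 1" "b n \<in> ball 0 1" using f by auto
  define p where "p = poincare_dist (a n) (b n)"
  have p: "0 \<le> p" unfolding p_def using poincare_dist_nonneg ab by blast
  have LK: "L = K + p" using Suc.prems(2) by (simp add: K_def p_def)
  define g where "g s = f n (poincare_segment (a n) (b n) (s - K))" for s
  define c' where "c' s = (if s \<le> K then c s else g s)" for s
  have seg_ball: "poincare_segment (a n) (b n) s \<in> ball 0 1" for s
    using poincare_segment(1)[OF ab] .
  have g_mem: "g s \<in> \<Omega>" for s
    unfolding g_def by (rule disc_map_into_mem[OF f(1) seg_ball])
  have gK: "g K = c K"
    using c(3) f poincare_segment(2)[OF ab] by (simp add: g_def)
  have g_lip: "kobayashi_dist \<Omega> (g s) (g t) \<le> \<bar>s - t\<bar>" for s t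
    using kobayashi_dist_disc[OF f(1) seg_ball seg_ball, of "s - K" "t - K"]
      poincare_segment(4)[OF ab, of "s - K" "t - K"] by (simp add: g_def)
  have contf: "continuous_on (ball 0 1) (f n)"
  proof -
    have "continuous_on (ball 0 1) (\<lambda>l. \<chi> i. f n l $ i)"
      using f(1) holomorphic_on_imp_continuous_on unfolding disc_map_into_def
      by (intro continuous_on_vec_lambda) blast
    then show ?thesis by simp
  qed
  have "continuous_on UNIV (\<lambda>s. poincare_segment (a n) (b n) (s - K))"
    by (rule continuous_on_compose2[OF poincare_segment(5)[OF ab]]) (auto intro: continuous_intros)
  then have contg: "continuous_on UNIV g"
    unfolding g_def by (rule continuous_on_compose2[OF contf]) (use seg_ball in auto)
  have "continuous_on ({0..K} \<union> {K..L}) c'"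
    unfolding c'_def
  proof (rule continuous_on_If)
    show "continuous_on {0..K} c" by fact
    show "continuous_on {K..L} g" using contg continuous_on_subset by blast
  qed (use gK K in auto)
  then have "continuous_on {0..L} c'"
    using K p LK by (simp add: ivl_disj_un_two_touch)
  moreover have "c' 0 = z 0" using c K by (simp add: c'_def)
  moreover have "c' L = z (Suc n)"
  \<comment> \<open>For a link of length 0 the parameter \<open>L\<close> equals \<open>K\<close>
    and \<open>c'\<close> still takes the value of the old curve. Then \<open>a n\<close> and
    \<open>b n\<close> coincide, hence so do the points they represent.\<close>
  proof (cases "p = 0")
    case True
    then have "z (Suc n) = z n"
      using f poincare_segment(2,3)[OF ab] by (metis p_def)
    then show ?thesis using c True LK by (simp add: c'_def)
  next
    case False
    then show ?thesis
      using f poincare_segment(3)[OF ab] p LK by (simp add: c'_def g_def p_def)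
  qed
  moreover have "c' s \<in> \<Omega>" if "s \<in> {0..L}" for s
    using that c g_mem by (auto simp: c'_def)
  moreover have "kobayashi_dist \<Omega> (c' s) (c' t) \<le> \<bar>s - t\<bar>" if st: "s \<in> {0..L}" "t \<in> {0..L}" for s t
  proof -
    have *: "kobayashi_dist \<Omega> (c s) (g t) \<le> t - s" if "s \<in> {0..K}" "K \<le> t" for s t
      using triangle[of "c s" "c K" "g t"] c(5)[of s K] g_lip[of K t] c(4) g_mem that K gK by auto
    show ?thesis
      using st c(5)[of s t] g_lip[of s t] *[of s t] *[of t s] commute[of "g s" "c t"] by (auto simp: c'_def)
  qed
  ultimately show ?case by blast
qed

lemma kobayashi_near_path:
  assumes "complex_domain \<Omega>" "kobayashi_hyperbolic \<Omega>" "x \<in> \<Omega>" "y \<in> \<Omega>" "kobayashi_dist \<Omega> x y < e"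
  obtains c L where "continuous_on {0..L} c" "c 0 = x" "c L = y" "\<And>s. s \<in> {0..L} \<Longrightarrow> c s \<in> \<Omega>"
    "\<And>s t. s \<in> {0..L} \<Longrightarrow> t \<in> {0..L} \<Longrightarrow> kobayashi_dist \<Omega> (c s) (c t) \<le> \<bar>s - t\<bar>"
    "kobayashi_dist \<Omega> x y \<le> L" "0 \<le> L" "L < e"
proof -
  obtain n a b f z where ch: "kobayashi_chain \<Omega> n a b f z" "z 0 = x" "z n = y"
    "kobayashi_dist \<Omega> x y \<le> (\<Sum>j<n. poincare_dist (a j) (b j))" "(\<Sum>j<n. poincare_dist (a j) (b j)) < e"
    using kobayashi_near_chain[OF assms(1,3-5)] by metis
  define L where "L = (\<Sum>j<n. poincare_dist (a j) (b j))"
  obtain c where "continuous_on {0..L} c \<and> c 0 = z 0 \<and> c L = z n \<and> (\<forall>s\<in>{0..L}. c s \<in> \<Omega>) \<and>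
    (\<forall>s\<in>{0..L}. \<forall>t\<in>{0..L}. kobayashi_dist \<Omega> (c s) (c t) \<le> \<bar>s - t\<bar>)"
    using kobayashi_chain_path[OF _ ch(1) _ L_def] assms(2,3) ch(2) unfolding kobayashi_hyperbolic_def by blast
  moreover have "0 \<le> L"
    unfolding L_def by (rule kobayashi_chain_length_nonneg[OF ch(1)])
  ultimately show ?thesis
    using that[of L c] ch unfolding L_def by blast
qed

lemma kobayashi_dist_le_local:
  assumes "open \<Omega>" "x \<in> \<Omega>"
  obtains r C where "r > 0" "C > 0" "ball x r \<subseteq> \<Omega>" "\<And>y. y \<in> ball x r \<Longrightarrow> kobayashi_dist \<Omega> x y \<le> C * dist x y"
proof -
  obtain r where r: "r > 0" "ball x r \<subseteq> \<Omega>"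
    using assms openE by blast
  have "kobayashi_dist \<Omega> x y \<le> (2 / r) * dist x y" if y: "y \<in> ball x (r / 2)" for y
  proof -
    have "y \<in> ball x r" using y r by auto
    then obtain f b where f: "disc_map_into \<Omega> f" "b \<in> ball 0 1" "f 0 = x" "f b = y" "cmod b = dist x y / r"
      using ball_disc_through[OF r(2)] by metis
    have "kobayashi_dist \<Omega> x y \<le> artanh (dist x y / r)"
      using kobayashi_dist_disc[OF f(1), of 0 b] f by (simp add: poincare_dist_0)
    also have "\<dots> \<le> 2 * (dist x y / r)"
      using y r by (intro artanh_le_double) (auto simp: field_simps)
    finally show ?thesis by simp
  qed
  moreover have "ball x (r / 2) \<subseteq> \<Omega>"
    using r by (intro order.trans[OF subset_ball r(2)]) auto
  ultimately show ?thesis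
    using that[of "r / 2" "2 / r"] r by auto
qed

lemma kobayashi_dist_tendsto:
  assumes "open \<Omega>" "kobayashi_hyperbolic \<Omega>" "x \<in> \<Omega>" "(X \<longlongrightarrow> x) F"
  shows "((\<lambda>n. kobayashi_dist \<Omega> x (X n)) \<longlongrightarrow> 0) F"
proof -
  interpret Metric_space \<Omega> "kobayashi_dist \<Omega>"
    using assms by (simp add: kobayashi_hyperbolic_def)
  obtain r C where r: "r > 0" "C > 0" "\<And>y. y \<in> ball x r \<Longrightarrow> kobayashi_dist \<Omega> x y \<le> C * dist x y"
    using kobayashi_dist_le_local[OF assms(1,3)] by metis
  have "\<forall>\<^sub>F n in F. dist (X n) x < r"
    using assms(4) r(1) tendstoD by blast
  then have "\<forall>\<^sub>F n in F. norm (kobayashi_dist \<Omega> x (X n)) \<le> C * dist x (X n)"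
  proof eventually_elim
    case (elim n)
    then show ?case
      using r(3)[of "X n"] by (simp add: dist_commute)
  qed
  moreover have "((\<lambda>n. C * dist x (X n)) \<longlongrightarrow> C * dist x x) F"
    using assms(4) by (intro tendsto_intros)
  then have "((\<lambda>n. C * dist x (X n)) \<longlongrightarrow> 0) F"
    by simp
  ultimately show ?thesis
    by (rule Lim_null_comparison)
qed

lemma kobayashi_dist_tendsto2:
  assumes "open \<Omega>" "kobayashi_hyperbolic \<Omega>" "x \<in> \<Omega>" "y \<in> \<Omega>" "(X \<longlongrightarrow> x) F" "(Y \<longlongrightarrow> y) F"
  shows "((\<lambda>n. kobayashi_dist \<Omega> (X n) (Y n)) \<longlongrightarrow> kobayashi_dist \<Omega> x y) F"
proof -
  interpret Metric_space \<Omega> "kobayashi_dist \<Omega>"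
    using assms by (simp add: kobayashi_hyperbolic_def)
  have "\<forall>\<^sub>F n in F. X n \<in> \<Omega>" "\<forall>\<^sub>F n in F. Y n \<in> \<Omega>"
    using assms topological_tendstoD by blast+
  then have "\<forall>\<^sub>F n in F. norm (kobayashi_dist \<Omega> (X n) (Y n) - kobayashi_dist \<Omega> x y)
               \<le> kobayashi_dist \<Omega> x (X n) + kobayashi_dist \<Omega> y (Y n)"
  proof eventually_elim
    case (elim n)
    then show ?case
      using triangle[of "X n" x "Y n"] triangle[of x y "Y n"] triangle[of x "X n" y] triangle[of "X n" "Y n" y]
        commute[of "X n" x] commute[of "Y n" y] assms(3,4) unfolding real_norm_def by linarith
  qed
  moreover have "((\<lambda>n. kobayashi_dist \<Omega> x (X n) + kobayashi_dist \<Omega> y (Y n)) \<longlongrightarrow> 0 + 0) F"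
    using kobayashi_dist_tendsto assms by (intro tendsto_add) blast+
  then have "((\<lambda>n. kobayashi_dist \<Omega> x (X n) + kobayashi_dist \<Omega> y (Y n)) \<longlongrightarrow> 0) F"
    by simp
  ultimately have "((\<lambda>n. kobayashi_dist \<Omega> (X n) (Y n) - kobayashi_dist \<Omega> x y) \<longlongrightarrow> 0) F"
    by (rule Lim_null_comparison)
  then show ?thesis by (simp add: LIM_zero_iff)
qed

text \<open>Each component of a disc map, divided by a strict bound \<open>M\<close> of the norm on
  \<open>W\<close>, is a holomorphic self-map of the disc, so Schwarz-Pick controls it. One factor 2
  is the bound for the Moebius denominator, the other comes from \<open>artanh_ge_half\<close>, and
  \<open>CARD('n)\<close> from summing the components.\<close>

lemma dist_le_kobayashi_dist:
  fixes W :: "(complex ^ 'n) set"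
  assumes "complex_domain W" "bounded W"
  obtains C where "C > 0" "\<And>x y. x \<in> W \<Longrightarrow> y \<in> W \<Longrightarrow> dist x y \<le> C * kobayashi_dist W x y"
proof -
  obtain M where M: "M > 0" "\<And>x. x \<in> W \<Longrightarrow> norm x < M"
    using assms(2) unfolding bounded_pos_less by blast
  define C where "C = 4 * M * CARD('n)"
  have C: "C > 0" using M by (simp add: C_def)
  have step: "dist (f a) (f b) \<le> C * poincare_dist a b"
    if f: "disc_map_into W f" "a \<in> ball 0 1" "b \<in> ball 0 1" for f a b
  proof -
    have comp: "cmod (f b $ i - f a $ i) \<le> 4 * M * poincare_dist a b" for i
    proof -
      define g where "g = (\<lambda>l. f l $ i / of_real M)"
      have "g holomorphic_on ball 0 1"
        using f M unfolding g_def disc_map_into_def by (auto intro!: holomorphic_intros)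
      moreover have gb: "g l \<in> ball 0 1" if "l \<in> ball 0 1" for l
      proof -
        have "cmod (f l $ i) < M"
          using M(2)[OF disc_map_into_mem[OF f(1) that]] Finite_Cartesian_Product.norm_nth_le[of "f l" i]
          by linarith
        then show ?thesis
          using M(1) by (simp add: g_def norm_divide)
      qed
      ultimately have "cmod (Moebius_function 0 (g a) (g b)) \<le> cmod (Moebius_function 0 a b)"
        using f by (intro Schwarz_Pick) auto
      also have "\<dots> \<le> 2 * poincare_dist a b"
        using artanh_ge_half[of "cmod (Moebius_function 0 a b)"] Moebius_ball(1)[OF f(2,3)]
        by (simp add: poincare_dist_Moebius)
      finally have *: "cmod (g b - g a) / cmod (1 - cnj (g a) * g b) \<le> 2 * poincare_dist a b"
        by (simp add: Moebius_function_simple norm_divide)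
      have "cmod (cnj (g a) * g b) < 1"
        using norm_mult_less[of "cnj (g a)" 1 "g b" 1] gb f by simp
      then have "0 < cmod (1 - cnj (g a) * g b)" "cmod (1 - cnj (g a) * g b) \<le> 2"
        using norm_triangle_ineq4[of 1 "cnj (g a) * g b"] by auto
      then have "cmod (g b - g a) \<le> 2 * poincare_dist a b * cmod (1 - cnj (g a) * g b)"
        using * by (simp add: pos_divide_le_eq)
      also have "\<dots> \<le> 2 * poincare_dist a b * 2"
        using \<open>cmod (1 - cnj (g a) * g b) \<le> 2\<close> poincare_dist_nonneg[OF f(2,3)] by (intro mult_left_mono) auto
      finally have "cmod (g b - g a) \<le> 2 * poincare_dist a b * 2" .
      moreover have "g b - g a = (f b $ i - f a $ i) / of_real M"
        by (simp add: g_def diff_divide_distrib)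
      ultimately show ?thesis
        using M(1) by (simp add: norm_divide field_simps)
    qed
    have "dist (f a) (f b) = norm (f b - f a)"
      by (simp add: dist_norm norm_minus_commute)
    also have "\<dots> \<le> (\<Sum>i\<in>UNIV. cmod ((f b - f a) $ i))"
      by (rule norm_le_sum_components)
    also have "\<dots> \<le> (\<Sum>i\<in>(UNIV :: 'n set). 4 * M * poincare_dist a b)"
      using comp by (intro sum_mono) simp
    finally show ?thesis by (simp add: C_def algebra_simps)
  qed
  have "dist x y \<le> C * kobayashi_dist W x y" if "x \<in> W" "y \<in> W" for x y
  proof -
    have "dist x y / C \<le> dist x x / C + kobayashi_dist W x y"
    proof (rule kobayashi_dist_lower_bound[OF assms(1) that, of "\<lambda>y. dist x y / C"])
      fix f and a b :: complex assume "disc_map_into W f" "a \<in> ball 0 1" "b \<in> ball 0 1"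
      from step[OF this] have "dist x (f b) \<le> dist x (f a) + C * poincare_dist a b"
        using dist_triangle[of x "f b" "f a"] by linarith
      then show "dist x (f b) / C \<le> dist x (f a) / C + poincare_dist a b"
        using C by (simp add: field_simps)
    qed
    then show ?thesis using C by (simp add: field_simps)
  qed
  with C show ?thesis using that by blast
qed

section \<open>Localization near the boundary\<close>

lemma continuous_on_kobayashi_dist:
  assumes "open \<Omega>" "kobayashi_hyperbolic \<Omega>" "q \<in> \<Omega>"
  shows "continuous_on \<Omega> (kobayashi_dist \<Omega> q)"
  unfolding continuous_on_def
proof
  fix y assume "y \<in> \<Omega>"
  then show "(kobayashi_dist \<Omega> q \<longlongrightarrow> kobayashi_dist \<Omega> q y) (at y within \<Omega>)"
    using kobayashi_dist_tendsto2[OF assms(1,2,3) _ tendsto_const, of y "\<lambda>y. y" "at y within \<Omega>"] by simp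
qed

text \<open>A nearly shortest curve from \<open>x\<close> never leaves the Kobayashi ball of radius
  \<open>e\<close> about \<open>x\<close> and must cross every sphere between its ends. Separation
  from all far points is thereby reduced to separation from a sphere, which is compact even if
  \<open>\<Omega>\<close> is unbounded.\<close>

lemma kobayashi_path_crosses_sphere:
  assumes dom: "complex_domain \<Omega>" and hyp: "kobayashi_hyperbolic \<Omega>"
    and xy: "x \<in> \<Omega>" "y \<in> \<Omega>" "kobayashi_dist \<Omega> x y < e" "dist p x \<le> s" "s \<le> dist p y"
  obtains w where "w \<in> \<Omega>" "dist p w = s" "kobayashi_dist \<Omega> x w < e"
proof -
  obtain c L where c: "continuous_on {0..L} c" "c 0 = x" "c L = y" "\<And>t. t \<in> {0..L} \<Longrightarrow> c t \<in> \<Omega>"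
    "\<And>s t. s \<in> {0..L} \<Longrightarrow> t \<in> {0..L} \<Longrightarrow> kobayashi_dist \<Omega> (c s) (c t) \<le> \<bar>s - t\<bar>"
    "0 \<le> L" "L < e"
    using kobayashi_near_path[OF dom hyp xy(1-3)] by metis
  have "continuous_on {0..L} (\<lambda>t. dist p (c t))"
    by (intro continuous_intros c)
  then obtain t where t: "0 \<le> t" "t \<le> L" "dist p (c t) = s"
    using IVT'[of "\<lambda>t. dist p (c t)" 0 s L] xy c(2,3,6) by auto
  have "kobayashi_dist \<Omega> x (c t) \<le> t"
    using c(5)[of 0 t] c(2) t by simp
  then show ?thesis
    using that[of "c t"] c t by simp
qed

text \<open>Barth's theorem: the Kobayashi distance of a hyperbolic domain induces the Euclidean topology.\<close>

lemma kobayashi_ball_small: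
  assumes dom: "complex_domain \<Omega>" and hyp: "kobayashi_hyperbolic \<Omega>" and q: "q \<in> \<Omega>" and s: "s > 0"
  obtains c where "c > 0" "\<And>y. y \<in> \<Omega> \<Longrightarrow> kobayashi_dist \<Omega> q y < c \<Longrightarrow> dist q y < s"
proof -
  interpret Metric_space \<Omega> "kobayashi_dist \<Omega>"
    using hyp by (simp add: kobayashi_hyperbolic_def)
  have op: "open \<Omega>" using dom by (simp add: complex_domain_def)
  then obtain r where r: "r > 0" "cball q r \<subseteq> \<Omega>"
    using q open_contains_cball by metis
  define s' where "s' = min s r"
  have s': "s' > 0" "s' \<le> s" "sphere q s' \<subseteq> \<Omega>"
    using s r by (auto simp: s'_def subset_iff)
  have "sphere q s' \<noteq> {}"
    using s' vector_choose_dist[of s' q] by (metis less_imp_le mem_sphere empty_iff)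
  moreover have "continuous_on (sphere q s') (kobayashi_dist \<Omega> q)"
    using continuous_on_kobayashi_dist[OF op hyp q] s'(3) continuous_on_subset by blast
  ultimately obtain w where w: "w \<in> sphere q s'"
      "\<And>y. y \<in> sphere q s' \<Longrightarrow> kobayashi_dist \<Omega> q w \<le> kobayashi_dist \<Omega> q y"
    using continuous_attains_inf[of "sphere q s'" "kobayashi_dist \<Omega> q"] by auto
  have "w \<in> \<Omega>" "w \<noteq> q" using w s' by auto
  then have pos: "kobayashi_dist \<Omega> q w > 0"
    using q by (metis zero nonneg order_le_less)
  moreover have "dist q y < s" if y: "y \<in> \<Omega>" "kobayashi_dist \<Omega> q y < kobayashi_dist \<Omega> q w" for y
  proof (rule ccontr)
    assume "\<not> dist q y < s"
    then have "s' \<le> dist q y" using s' by simp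
    then obtain v where "v \<in> \<Omega>" "dist q v = s'" "kobayashi_dist \<Omega> q v < kobayashi_dist \<Omega> q w"
      using kobayashi_path_crosses_sphere[OF dom hyp q y, of q s'] s' by auto
    then show False using w(2)[of v] by auto
  qed
  ultimately show ?thesis using that by blast
qed

lemma kobayashi_tendsto_imp:
  assumes dom: "complex_domain \<Omega>" and hyp: "kobayashi_hyperbolic \<Omega>" and q: "q \<in> \<Omega>"
    and X: "\<forall>\<^sub>F n in F. X n \<in> \<Omega>" and lim: "((\<lambda>n. kobayashi_dist \<Omega> q (X n)) \<longlongrightarrow> 0) F"
  shows "(X \<longlongrightarrow> q) F"
proof (rule tendstoI)
  fix e :: real assume "e > 0"
  then obtain c where c: "c > 0" "\<And>y. y \<in> \<Omega> \<Longrightarrow> kobayashi_dist \<Omega> q y < c \<Longrightarrow> dist q y < e"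
    using kobayashi_ball_small[OF dom hyp q] by metis
  have "\<forall>\<^sub>F n in F. kobayashi_dist \<Omega> q (X n) < c"
    using lim c(1) by (rule order_tendstoD(2))
  then show "\<forall>\<^sub>F n in F. dist (X n) q < e"
    using X
  proof eventually_elim
    case (elim n)
    then show ?case
      using c(2)[of "X n"] by (simp add: dist_commute)
  qed
qed

lemma hyperbolically_embedded_sequence:
  assumes emb: "hyperbolically_embedded \<Omega>" and p: "p \<in> frontier \<Omega>" and q: "q \<in> frontier \<Omega>" and op: "open \<Omega>"
    and X: "\<And>n. X n \<in> \<Omega>" "X \<longlonglongrightarrow> p" and Y: "\<And>n. Y n \<in> \<Omega>" "Y \<longlonglongrightarrow> q"
    and lim: "(\<lambda>n. kobayashi_dist \<Omega> (X n) (Y n)) \<longlonglongrightarrow> 0"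
  shows "p = q"
proof (rule ccontr)
  assume "p \<noteq> q"
  let ?L = "Liminf (at (p, q) within \<Omega> \<times> \<Omega>) (\<lambda>(x, y). ereal (kobayashi_dist \<Omega> x y))"
  have "0 < ?L"
    using emb p q \<open>p \<noteq> q\<close> unfolding hyperbolically_embedded_def by blast
  then obtain c where c: "0 < c" "ereal c < ?L"
    by (metis ereal_dense2 ereal_less(2))
  \<comment> \<open>The filter excludes \<open>(p, q)\<close> itself; this keeps the sequence of
    pairs off that point.\<close>
  have "p \<notin> \<Omega>"
    using p op by (simp add: frontier_def interior_open)
  then have "filterlim (\<lambda>n. (X n, Y n)) (at (p, q) within \<Omega> \<times> \<Omega>) sequentially"
    unfolding filterlim_at using X Y by (intro conjI tendsto_Pair always_eventually) auto
  then have "\<forall>\<^sub>F n in sequentially. ereal c < ereal (kobayashi_dist \<Omega> (X n) (Y n))"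
    using less_LiminfD[OF c(2)] unfolding filterlim_iff by auto
  moreover have "\<forall>\<^sub>F n in sequentially. kobayashi_dist \<Omega> (X n) (Y n) < c"
    using lim c(1) by (rule order_tendstoD(2))
  ultimately have "\<forall>\<^sub>F n in sequentially. False"
    by eventually_elim auto
  then show False by simp
qed

text \<open>Otherwise there are points \<open>X n\<close> tending to \<open>\<xi>\<close> and points
  \<open>Y n\<close> on the sphere of radius \<open>\<rho>\<close> at vanishing Kobayashi distance.
  A limit \<open>q\<close> of the \<open>Y n\<close> cannot lie in \<open>\<Omega>\<close>, since
  then \<open>X n\<close> would tend to \<open>q\<close> by Barth's theorem, and it cannot lie on
  the boundary by hyperbolic embeddedness.\<close>

lemma hyperbolically_embedded_separation:
  assumes dom: "complex_domain \<Omega>" and hyp: "kobayashi_hyperbolic \<Omega>" and emb: "hyperbolically_embedded \<Omega>"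
    and \<xi>: "\<xi> \<in> frontier \<Omega>" and \<rho>: "\<rho> > 0"
  obtains \<delta> c where "\<delta> > 0" "c > 0"
    "\<And>x y. x \<in> \<Omega> \<Longrightarrow> dist \<xi> x < \<delta> \<Longrightarrow> y \<in> \<Omega> \<Longrightarrow> kobayashi_dist \<Omega> x y < c \<Longrightarrow> dist \<xi> y < \<rho>"
proof -
  interpret Metric_space \<Omega> "kobayashi_dist \<Omega>"
    using hyp by (simp add: kobayashi_hyperbolic_def)
  have op: "open \<Omega>" using dom by (simp add: complex_domain_def)
  have \<xi>\<Omega>: "\<xi> \<notin> \<Omega>" using \<xi> op by (simp add: frontier_def interior_open)
  have "\<exists>n. \<forall>x y. x \<in> \<Omega> \<longrightarrow> dist \<xi> x < 1 / Suc n \<longrightarrow> y \<in> \<Omega> \<longrightarrow> dist \<xi> y = \<rho> \<longrightarrow> 1 / Suc n \<le> kobayashi_dist \<Omega> x y"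
  proof (rule ccontr)
    assume "\<not> ?thesis"
    then have "\<forall>n. \<exists>x y. x \<in> \<Omega> \<and> dist \<xi> x < 1 / Suc n \<and> y \<in> \<Omega> \<and> dist \<xi> y = \<rho> \<and> kobayashi_dist \<Omega> x y < 1 / Suc n"
      by (meson not_le)
    then obtain X Y where XY: "\<And>n. X n \<in> \<Omega>" "\<And>n. dist \<xi> (X n) < 1 / Suc n" "\<And>n. Y n \<in> \<Omega>"
        "\<And>n. dist \<xi> (Y n) = \<rho>" "\<And>n. kobayashi_dist \<Omega> (X n) (Y n) < 1 / Suc n"
      by metis
    have lim0: "(\<lambda>n. 1 / real (Suc n)) \<longlonglongrightarrow> 0"
      using LIMSEQ_inverse_real_of_nat by (simp add: inverse_eq_divide)
    have X\<xi>: "X \<longlonglongrightarrow> \<xi>"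
    proof (rule iffD2[OF tendsto_dist_iff])
      show "(\<lambda>n. dist (X n) \<xi>) \<longlonglongrightarrow> 0"
      proof (rule Lim_null_comparison[OF _ lim0])
        show "\<forall>\<^sub>F n in sequentially. norm (dist (X n) \<xi>) \<le> 1 / real (Suc n)"
          using XY(2) by (intro always_eventually allI) (simp add: dist_commute less_imp_le)
      qed
    qed
    obtain q r where q: "dist \<xi> q = \<rho>" and r: "strict_mono r" "(Y \<circ> r) \<longlonglongrightarrow> q"
      using compact_sphere[of \<xi> \<rho>] XY(4) unfolding compact_def by (metis mem_sphere)
    have kXY: "(\<lambda>n. kobayashi_dist \<Omega> (X n) (Y n)) \<longlonglongrightarrow> 0"
    proof (rule Lim_null_comparison[OF _ lim0])
      show "\<forall>\<^sub>F n in sequentially. norm (kobayashi_dist \<Omega> (X n) (Y n)) \<le> 1 / real (Suc n)"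
        using XY(5) by (intro always_eventually allI) (simp add: less_imp_le)
    qed
    have Xr: "(X \<circ> r) \<longlonglongrightarrow> \<xi>" and kr: "(\<lambda>n. kobayashi_dist \<Omega> ((X \<circ> r) n) ((Y \<circ> r) n)) \<longlonglongrightarrow> 0"
      using LIMSEQ_subseq_LIMSEQ[OF X\<xi> r(1)] LIMSEQ_subseq_LIMSEQ[OF kXY r(1)] by (simp_all add: comp_def)
    have ne: "q \<noteq> \<xi>" using q \<rho> by auto
    have "q \<in> closure \<Omega>"
      unfolding closure_sequential using r(2) XY(3) by (intro exI[of _ "Y \<circ> r"]) auto
    then consider "q \<in> \<Omega>" | "q \<in> frontier \<Omega>"
      using op by (auto simp: frontier_def interior_open)
    then show False
    proof cases
      case 1
      have kq: "(\<lambda>n. kobayashi_dist \<Omega> q ((Y \<circ> r) n)) \<longlonglongrightarrow> 0"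
        by (rule kobayashi_dist_tendsto[OF op hyp 1 r(2)])
      have "(\<lambda>n. kobayashi_dist \<Omega> q ((X \<circ> r) n)) \<longlonglongrightarrow> 0"
      proof (rule Lim_null_comparison)
        show "(\<lambda>n. kobayashi_dist \<Omega> q ((Y \<circ> r) n) + kobayashi_dist \<Omega> ((X \<circ> r) n) ((Y \<circ> r) n)) \<longlonglongrightarrow> 0"
          using tendsto_add[OF kq kr] by simp
        show "\<forall>\<^sub>F n in sequentially. norm (kobayashi_dist \<Omega> q ((X \<circ> r) n))
            \<le> kobayashi_dist \<Omega> q ((Y \<circ> r) n) + kobayashi_dist \<Omega> ((X \<circ> r) n) ((Y \<circ> r) n)"
        proof (intro always_eventually allI)
          fix n
          show "norm (kobayashi_dist \<Omega> q ((X \<circ> r) n))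
            \<le> kobayashi_dist \<Omega> q ((Y \<circ> r) n) + kobayashi_dist \<Omega> ((X \<circ> r) n) ((Y \<circ> r) n)"
            using triangle[OF 1 XY(3)[of "r n"] XY(1)[of "r n"]] commute[of "Y (r n)" "X (r n)"] by simp
        qed
      qed
      then have "(X \<circ> r) \<longlonglongrightarrow> q"
        by (intro kobayashi_tendsto_imp[OF dom hyp 1]) (use XY in auto)
      then show False using Xr ne LIMSEQ_unique by blast
    next
      case 2
      have "\<xi> = q"
        by (rule hyperbolically_embedded_sequence[OF emb \<xi> 2 op _ Xr _ r(2) kr]) (use XY in auto)
      then show False using ne by simp
    qed
  qed
  then obtain n where n: "\<And>x y. x \<in> \<Omega> \<Longrightarrow> dist \<xi> x < 1 / Suc n \<Longrightarrow> y \<in> \<Omega> \<Longrightarrow> dist \<xi> y = \<rho> \<Longrightarrow>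
      1 / Suc n \<le> kobayashi_dist \<Omega> x y"
    by blast
  have "dist \<xi> y < \<rho>"
    if h: "x \<in> \<Omega>" "dist \<xi> x < min \<rho> (1 / Suc n)" "y \<in> \<Omega>" "kobayashi_dist \<Omega> x y < 1 / Suc n" for x y
  proof (rule ccontr)
    assume "\<not> dist \<xi> y < \<rho>"
    then obtain w where "w \<in> \<Omega>" "dist \<xi> w = \<rho>" "kobayashi_dist \<Omega> x w < 1 / Suc n"
      using kobayashi_path_crosses_sphere[OF dom hyp h(1,3,4), of \<xi> \<rho>] h(2) by auto
    then show False using n[of x w] h by auto
  qed
  note conclusion = this
  show ?thesis
  proof (rule that[of "min \<rho> (1 / Suc n)" "1 / Suc n"])
    show "min \<rho> (1 / Suc n) > 0" "1 / real (Suc n) > 0"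
      using \<rho> by simp_all
  qed (rule conclusion)
qed

text \<open>Royden's localization: a disc through a point near \<open>\<xi>\<close> stays in \<open>U\<close> on a disc of fixed radius.\<close>

lemma kobayashi_localization:
  assumes dom: "complex_domain \<Omega>" and hyp: "kobayashi_hyperbolic \<Omega>" and emb: "hyperbolically_embedded \<Omega>"
    and \<xi>: "\<xi> \<in> frontier \<Omega>" and U: "open U" "\<xi> \<in> U" and hypW: "kobayashi_hyperbolic (U \<inter> \<Omega>)"
  obtains A \<delta> \<eta> where "A > 0" "\<delta> > 0" "\<eta> > 0"
    "\<And>x y. x \<in> \<Omega> \<Longrightarrow> dist \<xi> x < \<delta> \<Longrightarrow> y \<in> \<Omega> \<Longrightarrow> kobayashi_dist \<Omega> x y < \<eta> \<Longrightarrow>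
       x \<in> U \<and> y \<in> U \<and> kobayashi_dist (U \<inter> \<Omega>) x y \<le> A * kobayashi_dist \<Omega> x y"
proof -
  let ?W = "U \<inter> \<Omega>"
  interpret Metric_space \<Omega> "kobayashi_dist \<Omega>"
    using hyp by (simp add: kobayashi_hyperbolic_def)
  interpret W: Metric_space ?W "kobayashi_dist ?W"
    using hypW by (simp add: kobayashi_hyperbolic_def)
  obtain \<rho> where \<rho>: "\<rho> > 0" "ball \<xi> \<rho> \<subseteq> U"
    using U openE by blast
  obtain \<delta> c where c: "\<delta> > 0" "c > 0"
    "\<And>x y. x \<in> \<Omega> \<Longrightarrow> dist \<xi> x < \<delta> \<Longrightarrow> y \<in> \<Omega> \<Longrightarrow> kobayashi_dist \<Omega> x y < c \<Longrightarrow> dist \<xi> y < \<rho>"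
    using hyperbolically_embedded_separation[OF dom hyp emb \<xi> \<rho>(1)] by metis
  \<comment> \<open>The Euclidean disc of radius \<open>r\<close> about 0 is the Poincare disc of
    radius \<open>c / 2\<close>; the other half of \<open>c\<close> is left for the distance from
    \<open>x\<close> to the centre of the disc.\<close>
  define r where "r = tanh (c / 2)"
  have r: "0 < r" "r < 1"
    using c(2) tanh_real_bounds[of "c / 2"] by (auto simp: r_def)
  \<comment> \<open>The first entry keeps the points of a short chain within \<open>c / 2\<close> of
    \<open>x\<close>. The second makes the parameter of each link at most \<open>r / 2\<close>, so
    that it stays at most \<open>1 / 2\<close> after rescaling by \<open>r\<close> and
    \<open>artanh_le_double\<close> applies.\<close>
  define \<eta> where "\<eta> = min (c / 2) (artanh (r / 2))"
  have "0 < artanh (r / 2)"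
    using artanh_ge_half[of "r / 2"] r by linarith
  then have \<eta>: "\<eta> > 0" using c by (simp add: \<eta>_def)
  have main: "x \<in> U \<and> y \<in> U \<and> kobayashi_dist ?W x y \<le> (4 / r) * kobayashi_dist \<Omega> x y"
    if x: "x \<in> \<Omega>" "dist \<xi> x < \<delta>" and y: "y \<in> \<Omega>" "kobayashi_dist \<Omega> x y < \<eta>" for x y
  proof -
    have near: "w \<in> ?W" if "w \<in> \<Omega>" "kobayashi_dist \<Omega> x w < c" for w
      using c(3)[OF x that] \<rho>(2) that(1) by auto
    have "x \<in> U" "y \<in> U"
      using near[of x] near[of y] x y c(2) by (auto simp: \<eta>_def)
    moreover have "kobayashi_dist ?W x y \<le> (4 / r) * kobayashi_dist \<Omega> x y"
    proof (rule dense_ge)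
      fix u assume u: "(4 / r) * kobayashi_dist \<Omega> x y < u"
      define e where "e = min \<eta> (u * r / 4)"
      have "kobayashi_dist \<Omega> x y < e"
        using u r y by (simp add: e_def field_simps)
      then obtain n a b f z where ch: "kobayashi_chain \<Omega> n a b f z" and z: "z 0 = x" "z n = y"
        and "kobayashi_dist \<Omega> x y \<le> (\<Sum>j<n. poincare_dist (a j) (b j))"
        and lt: "(\<Sum>j<n. poincare_dist (a j) (b j)) < e"
        by (rule kobayashi_near_chain[OF dom x(1) y(1)])
      define P where "P m = (\<Sum>j<m. poincare_dist (a j) (b j))" for m
      have nonneg_j: "0 \<le> poincare_dist (a j) (b j)" if "j < n" for j
        using kobayashi_chainD(2,3)[OF ch that] poincare_dist_nonneg by blast
      have P_mono: "P m \<le> P n" if "m \<le> n" for m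
        unfolding P_def using that nonneg_j by (intro sum_mono2) auto
      have Pn: "P n < \<eta>" "P n < u * r / 4"
        using lt by (auto simp: P_def e_def)
      have z\<Omega>: "z j \<in> \<Omega>" if "j \<le> n" for j
        using kobayashi_chain_point_mem[OF ch _ that] z x by simp
      have dz: "m \<le> n \<Longrightarrow> kobayashi_dist \<Omega> x (z m) \<le> P m" for m
      proof (induction m)
        case 0
        then show ?case using z x by (simp add: P_def)
      next
        case (Suc m)
        then have m: "m < n" by simp
        have "kobayashi_dist \<Omega> (z m) (z (Suc m)) \<le> poincare_dist (a m) (b m)"
          using kobayashi_dist_disc kobayashi_chainD[OF ch m] by metis
        then show ?case
          using triangle[OF x(1), of "z m" "z (Suc m)"] z\<Omega> Suc by (auto simp: P_def)
      qed
      have zW: "z j \<in> ?W" if "j \<le> n" for j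
      proof -
        have "kobayashi_dist \<Omega> x (z j) < c"
          using dz[OF that] P_mono[OF that] Pn c(2) by (simp add: \<eta>_def)
        then show ?thesis using near z\<Omega>[OF that] by blast
      qed
      have step: "kobayashi_dist ?W (z j) (z (Suc j)) \<le> (4 / r) * poincare_dist (a j) (b j)" if j: "j < n" for j
      proof -
        note f = kobayashi_chainD[OF ch j]
        \<comment> \<open>The disc of the link, recentred so that 0 goes to \<open>z j\<close> and
          shrunk to radius \<open>r\<close>. In this form it maps into \<open>?W\<close>.\<close>
        define g where "g l = f j (Moebius_function 0 (- a j) (of_real r * l))" for l
        have rl: "of_real r * l \<in> ball 0 1" if "l \<in> ball 0 1" for l :: complex
          using that r norm_mult_less[of "of_real r" 1 l 1] by simp
        have M: "Moebius_function 0 (- a j) (of_real r * l) \<in> ball 0 1" if "l \<in> ball 0 1" for l :: complex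
          using Moebius_ball(2)[OF f(2) rl[OF that]] .
        have g0: "g 0 = z j"
          using f by (simp add: g_def Moebius_function_of_zero)
        have gW: "g l \<in> ?W" if l: "l \<in> ball 0 1" for l
        proof (rule near)
          show g\<Omega>: "g l \<in> \<Omega>"
            unfolding g_def by (rule disc_map_into_mem[OF f(1) M[OF l]])
          have "kobayashi_dist \<Omega> (z j) (g l) \<le> poincare_dist (a j) (Moebius_function 0 (- a j) (of_real r * l))"
            using kobayashi_dist_disc[OF f(1,2) M[OF l]] f(4) by (simp add: g_def)
          also have "\<dots> = artanh (cmod (of_real r * l))"
            using Moebius_compose_neg(2)[OF f(2) rl[OF l]] by (simp add: poincare_dist_Moebius)
          also have "\<dots> \<le> artanh r"
            using rl[OF l] r l by (subst artanh_real_le_iff) (auto simp: norm_mult mult_left_le)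
          also have "artanh r = c / 2"
            by (simp add: r_def artanh_tanh_real)
          finally have "kobayashi_dist \<Omega> (z j) (g l) \<le> c / 2" .
          moreover have "kobayashi_dist \<Omega> x (z j) < c / 2"
            using dz[of j] P_mono[of j] Pn j by (simp add: \<eta>_def)
          ultimately show "kobayashi_dist \<Omega> x (g l) < c"
            using triangle[OF x(1) z\<Omega>[of j] g\<Omega>] j by simp
        qed
        have gdisc: "disc_map_into ?W g"
          unfolding disc_map_into_def
        proof (intro conjI allI)
          fix i
          have "Moebius_function 0 (- a j) \<circ> (*) (of_real r) holomorphic_on ball 0 1"
            using f(2) rl by (intro holomorphic_on_compose_gen[of _ _ _ "ball 0 1"] Moebius_function_holomorphic)
              (auto intro!: holomorphic_intros)
          then have "(\<lambda>z. f j z $ i) \<circ> (Moebius_function 0 (- a j) \<circ> (*) (of_real r)) holomorphic_on ball 0 1"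
            using f(1) M unfolding disc_map_into_def
            by (intro holomorphic_on_compose_gen[of _ _ "\<lambda>z. f j z $ i" "ball 0 1"]) auto
          then show "(\<lambda>l. g l $ i) holomorphic_on ball 0 1"
            by (simp add: g_def comp_def)
        qed (use gW in auto)
        define \<beta> where "\<beta> = Moebius_function 0 (a j) (b j)"
        have \<beta>1: "cmod \<beta> < 1"
          using Moebius_ball(1)[OF f(2,3)] by (simp add: \<beta>_def)
        have "artanh (cmod \<beta>) = poincare_dist (a j) (b j)"
          by (simp add: \<beta>_def poincare_dist_Moebius)
        also have "\<dots> \<le> P n"
          unfolding P_def using j nonneg_j by (intro member_le_sum) auto
        also have "\<dots> < artanh (r / 2)"
          using Pn by (simp add: \<eta>_def)
        finally have \<beta>r: "cmod \<beta> \<le> r / 2"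
          using artanh_real_le_iff[of "cmod \<beta>" "r / 2"] \<beta>1 r by simp
        then have "\<beta> / of_real r \<in> ball 0 1"
          using r by (simp add: norm_divide field_simps)
        then have "kobayashi_dist ?W (g 0) (g (\<beta> / of_real r)) \<le> artanh (cmod (\<beta> / of_real r))"
          using kobayashi_dist_disc[OF gdisc, of 0] by (simp add: poincare_dist_0)
        also have "g (\<beta> / of_real r) = z (Suc j)"
          using r Moebius_compose_neg(1)[OF f(2,3)] f(5) by (simp add: g_def \<beta>_def)
        also have "artanh (cmod (\<beta> / of_real r)) \<le> 2 * (cmod \<beta> / r)"
          using \<beta>r r artanh_le_double[of "cmod \<beta> / r"] by (simp add: norm_divide field_simps)
        also have "\<dots> \<le> (4 / r) * artanh (cmod \<beta>)"
          using artanh_ge_half[of "cmod \<beta>"] \<beta>1 r by (simp add: field_simps)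
        finally show ?thesis
          by (simp add: g0 \<beta>_def poincare_dist_Moebius)
      qed
      have "m \<le> n \<Longrightarrow> kobayashi_dist ?W x (z m) \<le> (4 / r) * P m" for m
      proof (induction m)
        case 0
        then show ?case using z zW[of 0] by (simp add: P_def)
      next
        case (Suc m)
        then have "kobayashi_dist ?W x (z (Suc m)) \<le> kobayashi_dist ?W x (z m) + kobayashi_dist ?W (z m) (z (Suc m))"
          using W.triangle zW[of 0] zW[of m] zW[of "Suc m"] z by simp
        then show ?case
          using Suc step[of m] by (simp add: P_def distrib_left)
      qed
      from this[of n] have "kobayashi_dist ?W x y \<le> (4 / r) * P n"
        using z by simp
      also have "\<dots> \<le> u"
        using Pn r by (simp add: field_simps)
      finally show "kobayashi_dist ?W x y \<le> u" .
    qed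
    ultimately show ?thesis by simp
  qed
  show ?thesis
    using that[of "4 / r" \<delta> \<eta>] main c(1) \<eta> r by simp
qed

section \<open>Gromov hyperbolic length spaces\<close>

text \<open>In the Morse lemma \<open>n\<close> is the rounded distance from the geodesic to the
  quasigeodesic and \<open>m\<close> counts the halvings of a chain with \<open>6 * n + 2\<close>
  links. A loss logarithmic in \<open>n\<close> cannot compensate a linear gain, so \<open>n\<close>
  is bounded.\<close>

lemma linear_vs_power_two_bound:
  fixes a b :: real
  assumes "0 \<le> a" "0 \<le> b"
  shows "\<exists>n0::nat. \<forall>n::nat. (\<forall>m::nat. 6 * n + 2 \<le> 2 ^ m \<longrightarrow> real n \<le> a + b * m) \<longrightarrow> n \<le> n0"
proof -
  obtain K :: nat where K: "6 * a + 12 * b + 3 < K"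
    using reals_Archimedean2 by blast
  have "n \<le> 4 ^ K" if n: "\<And>m::nat. 6 * n + 2 \<le> 2 ^ m \<Longrightarrow> real n \<le> a + b * m" for n
  proof -
    \<comment> \<open>Powers of 4 make \<open>4 ^ (k - 1)\<close> the square of
      \<open>2 ^ (k - 1)\<close>, hence at least \<open>k * k\<close>. The assumption gives a bound
      linear in \<open>k\<close>, which a quadratic quantity eventually violates.\<close>
    define k where "k = (LEAST k. 6 * n + 2 \<le> (4::nat) ^ k)"
    have "6 * n + 2 < (4::nat) ^ (6 * n + 2)"
      by (rule less_le_trans[OF less_exp power_mono]) auto
    then have k: "6 * n + 2 \<le> (4::nat) ^ k"
      unfolding k_def by (metis (mono_tags, lifting) LeastI less_imp_le)
    have "k < K"
    proof (rule ccontr)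
      assume "\<not> k < K"
      then have kK: "6 * a + 12 * b + 3 < real k"
        using K by simp
      then have "k > 0" using assms by (cases k) auto
      then have "\<not> 6 * n + 2 \<le> (4::nat) ^ (k - 1)"
        using not_less_Least[of "k - 1" "\<lambda>k. 6 * n + 2 \<le> (4::nat) ^ k"] unfolding k_def by simp
      moreover have "(4::nat) ^ (k - 1) = 2 ^ (k - 1) * 2 ^ (k - 1)"
        by (simp add: power_mult_distrib[symmetric])
      moreover have "k \<le> 2 ^ (k - 1)"
        using less_exp[of "k - 1"] \<open>k > 0\<close> by linarith
      then have "k * k \<le> 2 ^ (k - 1) * 2 ^ (k - 1)"
        by (rule mult_le_mono) fact
      ultimately have "k * k < 6 * n + 2" by linarith
      then have "real (k * k) < real (6 * n + 2)"
        by (simp only: of_nat_less_iff)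
      then have kk: "real k * real k < 6 * real n + 2"
        by simp
      have "6 * n + 2 \<le> (2::nat) ^ (2 * k)"
        using k by (simp add: power_mult)
      then have "real n \<le> a + b * real (2 * k)"
        by (rule n)
      then have "real k * real k < 6 * a + 12 * b * real k + 2"
        using kk by simp
      moreover have "(6 * a + 12 * b + 3) * real k \<le> real k * real k"
        using kK by (intro mult_right_mono) auto
      moreover have "6 * a * 1 \<le> 6 * a * real k"
        using \<open>k > 0\<close> assms by (intro mult_left_mono) auto
      moreover have "1 \<le> real k"
        using \<open>k > 0\<close> by simp
      ultimately show False by (simp add: algebra_simps)
    qed
    then have "(4::nat) ^ k \<le> 4 ^ K" by (intro power_increasing) auto
    then show ?thesis using k by linarith
  qed
  then show ?thesis by blast
qed

text \<open>Splitting the chain in two costs a single \<open>\<delta>\<close>, so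
  \<open>\<delta>\<close> is paid per halving and not per link.\<close>

lemma gromov_product_chain:
  fixes d :: "'a \<Rightarrow> 'a \<Rightarrow> real"
  assumes \<delta>: "0 \<le> \<delta>"
    and hyp: "\<And>x y z. x \<in> M \<Longrightarrow> y \<in> M \<Longrightarrow> z \<in> M \<Longrightarrow>
      gromov_product d p x z \<ge> min (gromov_product d p x y) (gromov_product d p y z) - \<delta>"
    and "1 \<le> N" "N \<le> 2 ^ m" "\<And>i. i \<le> N \<Longrightarrow> x i \<in> M"
      "\<And>i. i < N \<Longrightarrow> B \<le> gromov_product d p (x i) (x (Suc i))"
  shows "B - m * \<delta> \<le> gromov_product d p (x 0) (x N)"
  using assms(3-)
proof (induction m arbitrary: N x)
  case 0
  then have "N = 1" by simp
  then show ?case using 0 by simp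
next
  case (Suc m)
  show ?case
  proof (cases "N \<le> 2 ^ m")
    case True
    have "B - m * \<delta> \<le> gromov_product d p (x 0) (x N)"
      by (rule Suc.IH) (use Suc.prems True in auto)
    then show ?thesis using \<delta> by (simp add: algebra_simps)
  next
    case False
    define k :: nat where "k = 2 ^ m"
    have k: "1 \<le> k" "k < N" using False by (auto simp: k_def)
    have 1: "B - m * \<delta> \<le> gromov_product d p (x 0) (x k)"
      by (rule Suc.IH) (use Suc.prems k in \<open>auto simp: k_def\<close>)
    have "B - m * \<delta> \<le> gromov_product d p (x (0 + k)) (x ((N - k) + k))"
      by (rule Suc.IH) (use Suc.prems k in \<open>auto simp: k_def\<close>)
    then have 2: "B - m * \<delta> \<le> gromov_product d p (x k) (x N)"
      using k by simp
    have "min (gromov_product d p (x 0) (x k)) (gromov_product d p (x k) (x N)) - \<delta> \<le> gromov_product d p (x 0) (x N)"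
      using hyp Suc.prems(3) k by simp
    then show ?thesis using 1 2 by (simp add: algebra_simps)
  qed
qed

lemma geodesic_segmentD:
  assumes "geodesic_segment M d p x g"
  shows "g 0 = p" "\<And>t. d p x \<le> t \<Longrightarrow> g t = x" "\<And>t. 0 \<le> t \<Longrightarrow> t \<le> d p x \<Longrightarrow> g t \<in> M"
    "\<And>s t. 0 \<le> s \<Longrightarrow> s \<le> d p x \<Longrightarrow> 0 \<le> t \<Longrightarrow> t \<le> d p x \<Longrightarrow> d (g s) (g t) = \<bar>s - t\<bar>"
  using assms unfolding geodesic_segment_def by auto

context Metric_space
begin

lemma geodesic_segment_Lipschitz:
  assumes g: "geodesic_segment M d p x g" and x: "x \<in> M" and st: "0 \<le> s" "0 \<le> t"
  shows "g s \<in> M" "d (g s) (g t) \<le> \<bar>s - t\<bar>"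
proof -
  have eq: "g s = g (min s (d p x))" for s
    using geodesic_segmentD(2)[OF g] by (auto simp: min_def)
  show "g s \<in> M"
    using geodesic_segmentD(2,3)[OF g] x st by (metis linear)
  have "d (g s) (g t) = \<bar>min s (d p x) - min t (d p x)\<bar>"
    unfolding eq[of s] eq[of t] using st by (intro geodesic_segmentD(4)[OF g]) auto
  then show "d (g s) (g t) \<le> \<bar>s - t\<bar>" by (auto simp: min_def)
qed

text \<open>Both \<open>g t\<close> and \<open>g' t\<close> have Gromov product exactly
  \<open>t\<close> with the common endpoint \<open>x\<close>, so their mutual product is at least
  \<open>t - \<delta>\<close>. As both are at distance \<open>t\<close> from \<open>p\<close>, this
  bounds their distance.\<close>

lemma geodesic_segments_close:
  assumes hyp: "\<And>x y z. x \<in> M \<Longrightarrow> y \<in> M \<Longrightarrow> z \<in> M \<Longrightarrow>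
      gromov_product d p x z \<ge> min (gromov_product d p x y) (gromov_product d p y z) - \<delta>"
    and g: "geodesic_segment M d p x g" "geodesic_segment M d p x g'" and x: "x \<in> M"
    and t: "0 \<le> t" "t \<le> d p x"
  shows "d (g t) (g' t) \<le> 2 * \<delta>"
proof -
  have *: "d (g t) p = t \<and> d (g t) x = d p x - t \<and> g t \<in> M" if g: "geodesic_segment M d p x g" for g
    using geodesic_segmentD(4)[OF g, of t 0] geodesic_segmentD(4)[OF g, of t "d p x"]
      geodesic_segmentD(1,3)[OF g] geodesic_segmentD(2)[OF g, of "d p x"] t by auto
  have gp: "gromov_product d p (g t) x = t" "gromov_product d p x (g' t) = t"
    using *[OF g(1)] *[OF g(2)] commute[of x p] commute[of x "g' t"] by (simp_all add: gromov_product_def)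
  have "t - \<delta> \<le> gromov_product d p (g t) (g' t)"
    using hyp[of "g t" x "g' t"] *[OF g(1)] *[OF g(2)] x gp by simp
  then show ?thesis
    using *[OF g(1)] *[OF g(2)] by (simp add: gromov_product_def)
qed

text \<open>The Morse lemma: a point of the geodesic far from the quasigeodesic would have small Gromov product
  with its endpoints, but a chain along the quasigeodesic of length comparable to the distance keeps it large.\<close>

lemma geodesic_near_quasigeodesic:
  assumes hyp: "gromov_hyperbolic M d" and A: "0 \<le> A"
    and c: "\<And>s. 0 \<le> s \<Longrightarrow> c s \<in> M"
      "\<And>s t. 0 \<le> s \<Longrightarrow> 0 \<le> t \<Longrightarrow> \<bar>s - t\<bar> \<le> d (c s) (c t)"
      "\<And>s t. 0 \<le> s \<Longrightarrow> 0 \<le> t \<Longrightarrow> d (c s) (c t) \<le> A * \<bar>s - t\<bar>"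
  shows "\<exists>D. \<forall>T g u. 0 \<le> T \<longrightarrow> geodesic_segment M d (c 0) (c T) g \<longrightarrow> 0 \<le> u \<longrightarrow>
    u \<le> d (c 0) (c T) \<longrightarrow> (\<exists>s\<in>{0..T}. d (g u) (c s) \<le> D)"
proof -
  obtain \<delta> where \<delta>: "0 \<le> \<delta>" and hyp': "\<And>p x y z. p \<in> M \<Longrightarrow> x \<in> M \<Longrightarrow> y \<in> M \<Longrightarrow> z \<in> M \<Longrightarrow>
      gromov_product d p x z \<ge> min (gromov_product d p x y) (gromov_product d p y z) - \<delta>"
    using hyp unfolding gromov_hyperbolic_def by blast
  obtain n0 :: nat where n0: "\<And>n::nat. (\<And>m::nat. 6 * n + 2 \<le> 2 ^ m \<Longrightarrow> real n \<le> (1 + A / 2) + \<delta> * m) \<Longrightarrow> n \<le> n0"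
    using linear_vs_power_two_bound[of "1 + A / 2" \<delta>] \<delta> A by auto
  have main: "\<exists>s\<in>{0..T}. d (g u) (c s) \<le> n0"
    if T: "0 \<le> T" and g: "geodesic_segment M d (c 0) (c T) g" and u: "0 \<le> u" "u \<le> d (c 0) (c T)" for T g u
  proof -
    define L where "L = d (c 0) (c T)"
    note gD = geodesic_segmentD[OF g, folded L_def]
    have L0: "0 \<le> L" by (simp add: L_def)
    \<comment> \<open>Radii are restricted to integers so that a least one exists. Minimality of
      \<open>n = Suc D\<close> gives a point \<open>g u0\<close> at distance more than
      \<open>D\<close> from the quasigeodesic, while every point of the segment is within
      \<open>D + 1\<close> of it.\<close>
    define Q where "Q n \<longleftrightarrow> (\<forall>u\<in>{0..L}. \<exists>s\<in>{0..T}. d (g u) (c s) \<le> real n)" for n :: nat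
    obtain n1 :: nat where "L \<le> n1" using real_arch_simple by blast
    have "Q n1"
      unfolding Q_def
    proof
      fix v assume v: "v \<in> {0..L}"
      then have "d (g v) (c 0) = v" using gD(1) gD(4)[of v 0] by auto
      then show "\<exists>s\<in>{0..T}. d (g v) (c s) \<le> n1" using v \<open>L \<le> n1\<close> T by (intro bexI[of _ 0]) auto
    qed
    define n where "n = (LEAST n. Q n)"
    have Qn: "Q n" unfolding n_def by (rule LeastI) fact
    have "n \<le> n0"
    proof (cases n)
      case (Suc D)
      then have "\<not> Q D" using not_less_Least[of D Q] by (simp add: n_def)
      then obtain u0 where u0: "0 \<le> u0" "u0 \<le> L" and far: "\<And>s. s \<in> {0..T} \<Longrightarrow> D < d (g u0) (c s)"
        unfolding Q_def by (meson atLeastAtMost_iff not_le)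
      define o' where "o' = g u0"
      have o': "o' \<in> M" using gD(3) u0 by (simp add: o'_def)
      \<comment> \<open>The offset \<open>2 * D + 2\<close> lets the jump of length at most
        \<open>D + 1\<close> from the segment to the quasigeodesic keep a Gromov product of at least
        \<open>D\<close> seen from \<open>o'\<close>. If the offset overshoots an end of the
        segment, that end already lies on the quasigeodesic and no jump takes place.\<close>
      define u1 where "u1 = max 0 (u0 - (2 * D + 2))"
      define u2 where "u2 = min L (u0 + (2 * D + 2))"
      have u12: "0 \<le> u1" "u1 \<le> u0" "u0 \<le> u2" "u2 \<le> L" using u0 by (auto simp: u1_def u2_def)
      have near: "\<exists>s\<in>{0..T}. d (g v) (c s) \<le> D + 1" if "0 \<le> v" "v \<le> L" for v
        using Qn that by (auto simp: Q_def Suc)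
      obtain s1 where s1: "s1 \<in> {0..T}" "d (g u1) (c s1) \<le> D + 1" "u1 = 0 \<longrightarrow> g u1 = c s1"
      proof (cases "u1 = 0")
        case True
        then show ?thesis using that[of 0] T gD(1) c(1)[of 0] by simp
      next
        case False
        then show ?thesis using near[of u1] u12 that by auto
      qed
      obtain s2 where s2: "s2 \<in> {0..T}" "d (g u2) (c s2) \<le> D + 1" "u2 = L \<longrightarrow> g u2 = c s2"
      proof (cases "u2 = L")
        case True
        then show ?thesis using that[of T] T gD(2)[of L] c(1)[of T] by simp
      next
        case False
        then show ?thesis using near[of u2] u12 that by auto
      qed
      have gM: "g u1 \<in> M" "g u2 \<in> M" using gD(3) u12 by auto
      have cM: "c s1 \<in> M" "c s2 \<in> M" using c(1) s1 s2 by auto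
      have du: "d (g u1) o' = u0 - u1" "d (g u2) o' = u2 - u0" "d (g u1) (g u2) = u2 - u1"
        unfolding o'_def using gD(4) u12 by auto
      have "\<bar>s1 - s2\<bar> \<le> d (c s1) (c s2)" using c(2) s1 s2 by auto
      also have "\<dots> \<le> d (c s1) (g u1) + d (g u1) (g u2) + d (g u2) (c s2)"
        using triangle[OF cM(1) gM(1) cM(2)] triangle[OF gM cM(2)] by linarith
      also have "\<dots> \<le> 6 * D + 6"
      proof -
        have "u2 - u1 \<le> 4 * D + 4" using u0 by (auto simp: u1_def u2_def min_def max_def)
        then show ?thesis using s1(2) s2(2) du(3) commute[of "c s1" "g u1"] by linarith
      qed
      finally have s12: "\<bar>s1 - s2\<bar> \<le> 6 * real n" by (simp add: Suc)
      \<comment> \<open>The parameters \<open>s1\<close> and \<open>s2\<close> differ by at most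
        \<open>6 * n\<close>, so \<open>k\<close> equal steps have length at most 1 each. With the
        two jumps the chain has \<open>k + 2\<close> links.\<close>
      define k where "k = 6 * n"
      have k: "k > 0" by (simp add: k_def Suc)
      define \<tau> where "\<tau> i = s1 + (s2 - s1) * (real i / real k)" for i :: nat
      have \<tau>: "\<tau> i \<in> {0..T}" if "i \<le> k" for i
      proof -
        have "real i / real k \<in> {0..1}" using that k by simp
        moreover have "\<tau> i = (1 - real i / real k) * s1 + (real i / real k) * s2"
          using k by (simp add: \<tau>_def field_simps)
        ultimately show ?thesis
          using s1(1) s2(1) convex_bound_le[of s1 T s2 "1 - real i / real k" "real i / real k"] by auto
      qed
      have \<tau>step: "\<bar>\<tau> i - \<tau> (Suc i)\<bar> \<le> 1" for i
      proof -
        have "\<tau> i - \<tau> (Suc i) = (s1 - s2) / real k"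
          using k by (simp add: \<tau>_def field_simps)
        then show ?thesis using s12 k by (simp add: k_def)
      qed
      define x where "x i = (if i = 0 then g u1 else if i \<le> Suc k then c (\<tau> (i - 1)) else g u2)" for i :: nat
      have x0: "x 0 = g u1" and x1: "x 1 = c s1" and xk: "x (Suc k) = c s2" and xN: "x (Suc (Suc k)) = g u2"
        using k by (simp_all add: x_def \<tau>_def)
      have dcs: "D < d (c s) o'" if "s \<in> {0..T}" for s
        using far[OF that] commute by (simp add: o'_def)
      have B: "D - A / 2 \<le> gromov_product d o' (x i) (x (Suc i))" if i: "i < k + 2" for i
      proof -
        consider "i = 0" | "i = Suc k" | "1 \<le> i" "i \<le> k" using i by linarith
        then show ?thesis
        proof cases
          case 1
          show ?thesis
          proof (cases "u1 = 0")
            case True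
            then show ?thesis using 1 x0 x1 s1(3) dcs[OF s1(1)] A cM by (simp add: gromov_product_def)
          next
            case False
            then have "u0 - u1 = 2 * D + 2" by (auto simp: u1_def max_def split: if_splits)
            then show ?thesis
              using 1 x0 x1 dcs[OF s1(1)] s1(2) du A by (simp add: gromov_product_def)
          qed
        next
          case 2
          show ?thesis
          proof (cases "u2 = L")
            case True
            then show ?thesis using 2 xk xN s2(3) dcs[OF s2(1)] A cM by (simp add: gromov_product_def)
          next
            case False
            then have "u2 - u0 = 2 * D + 2" by (auto simp: u2_def min_def split: if_splits)
            then show ?thesis
              using 2 xk xN dcs[OF s2(1)] s2(2) du A commute[of "g u2" "c s2"] by (simp add: gromov_product_def)
          qed
        next
          case 3
          then have \<tau>i: "\<tau> (i - 1) \<in> {0..T}" "\<tau> i \<in> {0..T}" using \<tau> by auto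
          have xi: "x i = c (\<tau> (i - 1))" "x (Suc i) = c (\<tau> i)" using 3 by (auto simp: x_def)
          have "d (c (\<tau> (i - 1))) (c (\<tau> i)) \<le> A * \<bar>\<tau> (i - 1) - \<tau> i\<bar>"
            using c(3) \<tau>i by simp
          also have "\<dots> \<le> A * 1"
            using A \<tau>step[of "i - 1"] 3 by (intro mult_left_mono) auto
          finally have "d (c (\<tau> (i - 1))) (c (\<tau> i)) \<le> A" by simp
          then show ?thesis
            unfolding xi using dcs[OF \<tau>i(1)] dcs[OF \<tau>i(2)] by (simp add: gromov_product_def)
        qed
      qed
      have xM: "x i \<in> M" if "i \<le> k + 2" for i
        using gM c(1) \<tau> that by (auto simp: x_def)
      show "n \<le> n0"
      proof (rule n0)
        fix m :: nat assume m: "6 * n + 2 \<le> 2 ^ m"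
        have "(D - A / 2) - m * \<delta> \<le> gromov_product d o' (x 0) (x (k + 2))"
        proof (rule gromov_product_chain[OF \<delta>, of M])
          show "k + 2 \<le> 2 ^ m" using m by (simp add: k_def)
        qed (use hyp'[OF o'] B xM in auto)
        \<comment> \<open>The base point \<open>o'\<close> lies on the geodesic between the two ends
          of the chain.\<close>
        also have "\<dots> = 0"
          using x0 xN du by (simp add: gromov_product_def)
        finally show "real n \<le> 1 + A / 2 + \<delta> * m" by (simp add: Suc algebra_simps)
      qed
    qed simp
    moreover have "\<exists>s\<in>{0..T}. d (g u) (c s) \<le> n" using Qn u by (simp add: Q_def L_def)
    ultimately show ?thesis by (meson of_nat_mono order_trans)
  qed
  show ?thesis
    by (intro exI[of _ "real n0"] allI impI main)
qed

end

text \<open>Arzela-Ascoli on the intervals \<open>{- real i..real i}\<close>, followed by a diagonal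
  subsequence. Pointwise convergence is all that is recorded; the Lipschitz bounds recover
  uniformity on compact sets where it is required.\<close>

lemma Lipschitz_pointwise_convergent_subsequence:
  fixes F :: "nat \<Rightarrow> real \<Rightarrow> 'a::euclidean_space"
  assumes C: "0 \<le> C" and lip: "\<And>n s t. dist (F n s) (F n t) \<le> C * \<bar>s - t\<bar>" and M: "\<And>n. norm (F n 0) \<le> M"
  shows "\<exists>r g. strict_mono (r :: nat \<Rightarrow> nat) \<and> (\<forall>t. (\<lambda>n. F (r n) t) \<longlonglongrightarrow> g t)"
proof -
  define P where "P i k \<longleftrightarrow> (\<forall>t\<in>{- real i..real i}. convergent (\<lambda>n. F (k n) t))" for i :: nat and k :: "nat \<Rightarrow> nat"
  have sub: "\<exists>k. strict_mono k \<and> P i (r \<circ> k)" for i and r :: "nat \<Rightarrow> nat"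
  proof -
    obtain g k where gk: "strict_mono (k :: nat \<Rightarrow> nat)"
      "\<And>e. 0 < e \<Longrightarrow> \<exists>N. \<forall>n x. n \<ge> N \<and> x \<in> {- real i..real i} \<longrightarrow> norm (F (r (k n)) x - g x) < e"
    proof (rule Arzela_Ascoli[of "{- real i..real i}" "\<lambda>n. F (r n)" "M + C * i"])
      fix n x assume x: "x \<in> {- real i..real i}"
      have "norm (F (r n) x) \<le> norm (F (r n) 0) + dist (F (r n) x) (F (r n) 0)"
        by (metis add.commute dist_norm norm_triangle_sub)
      also have "\<dots> \<le> M + C * \<bar>x - 0\<bar>"
        by (intro add_mono M lip)
      also have "\<dots> \<le> M + C * i"
        using x C by (auto intro!: mult_left_mono)
      finally show "norm (F (r n) x) \<le> M + C * i" .
    next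
      fix x e :: real assume e: "e > 0"
      have "norm (F (r n) x - F (r n) y) < e" if "norm (x - y) < e / (C + 1)" for n y
      proof -
        have "norm (F (r n) x - F (r n) y) \<le> C * \<bar>x - y\<bar>"
          using lip[of "r n" x y] by (simp add: dist_norm)
        also have "\<dots> \<le> (C + 1) * \<bar>x - y\<bar>"
          by (intro mult_right_mono) auto
        also have "\<dots> < e" using that C by (simp add: field_simps)
        finally show ?thesis .
      qed
      then show "\<exists>d>0. \<forall>n y. y \<in> {- real i..real i} \<and> norm (x - y) < d \<longrightarrow> norm (F (r n) x - F (r n) y) < e"
        using e C by (intro exI[of _ "e / (C + 1)"]) auto
    qed auto
    have "(\<lambda>n. F (r (k n)) t) \<longlonglongrightarrow> g t" if "t \<in> {- real i..real i}" for t
      unfolding LIMSEQ_iff using gk(2) that by meson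
    then have "P i (r \<circ> k)" unfolding P_def convergent_def comp_def by blast
    then show ?thesis using gk(1) by blast
  qed
  have P_P: "P i (r \<circ> k2)" if P: "P i (r \<circ> k1)" and k2: "\<And>j. N \<le> j \<Longrightarrow> \<exists>j'. j \<le> j' \<and> k2 j = k1 j'" for i r k1 k2 and N :: nat
    unfolding P_def
  proof
    fix t assume t: "t \<in> {- real i..real i}"
    have "convergent (\<lambda>n. F ((r \<circ> k1) n) t)"
      using P t unfolding P_def by blast
    then obtain l where l: "(\<lambda>n. F (r (k1 n)) t) \<longlonglongrightarrow> l"
      unfolding convergent_def comp_def by blast
    have "(\<lambda>n. F (r (k2 n)) t) \<longlonglongrightarrow> l"
      unfolding LIMSEQ_iff
    proof (intro allI impI)
      fix e :: real assume "e > 0"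
      then obtain N' where N': "\<And>n. n \<ge> N' \<Longrightarrow> norm (F (r (k1 n)) t - l) < e"
        using l unfolding LIMSEQ_iff by blast
      have "norm (F (r (k2 n)) t - l) < e" if n: "n \<ge> max N N'" for n
      proof -
        obtain j' where "n \<le> j'" "k2 n = k1 j'" using k2[of n] n by auto
        then show ?thesis using N'[of j'] n by simp
      qed
      then show "\<exists>no. \<forall>n\<ge>no. norm (F (r (k2 n)) t - l) < e" by blast
    qed
    then show "convergent (\<lambda>n. F ((r \<circ> k2) n) t)" unfolding convergent_def comp_def by blast
  qed
  obtain k where k: "strict_mono (k :: nat \<Rightarrow> nat)" "\<And>i. P i (id \<circ> k)"
  proof (rule subsequence_diagonalization_lemma[of P id, OF sub P_P])
    fix k :: "nat \<Rightarrow> nat" assume "strict_mono k" "\<And>i. P i (id \<circ> k)"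
    then show thesis by (rule that)
  qed
  have "convergent (\<lambda>n. F (k n) t)" for t
  proof -
    obtain i :: nat where "\<bar>t\<bar> \<le> i" using real_arch_simple by blast
    then have "t \<in> {- real i..real i}" by auto
    then show ?thesis using k(2)[of i] unfolding P_def comp_def id_def by blast
  qed
  then have "\<And>t. (\<lambda>n. F (k n) t) \<longlonglongrightarrow> lim (\<lambda>n. F (k n) t)"
    by (simp add: convergent_LIMSEQ_iff)
  then show ?thesis
    using k(1) by (intro exI[of _ k] exI[of _ "\<lambda>t. lim (\<lambda>n. F (k n) t)"]) simp
qed

lemma equiv_asymptotic_rel:
  assumes "Metric_space M d"
  shows "equiv {\<gamma>. geodesic_ray M d \<gamma>} (asymptotic_rel M d)"
proof -
  interpret Metric_space M d by fact
  show ?thesis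
  proof (rule equivI)
    show "refl_on {\<gamma>. geodesic_ray M d \<gamma>} (asymptotic_rel M d)"
      unfolding refl_on_def asymptotic_rel_def
      by (auto simp: geodesic_ray_def intro!: bdd_aboveI[of _ 0])
    show "asymptotic_rel M d \<subseteq> {\<gamma>. geodesic_ray M d \<gamma>} \<times> {\<gamma>. geodesic_ray M d \<gamma>}"
      by (auto simp: asymptotic_rel_def)
    show "sym (asymptotic_rel M d)"
      unfolding sym_def asymptotic_rel_def by (simp add: commute)
    show "trans (asymptotic_rel M d)"
    proof (rule transI)
      fix \<alpha> \<beta> \<gamma> assume "(\<alpha>, \<beta>) \<in> asymptotic_rel M d" "(\<beta>, \<gamma>) \<in> asymptotic_rel M d"
      then have r: "geodesic_ray M d \<alpha>" "geodesic_ray M d \<beta>" "geodesic_ray M d \<gamma>"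
        and b: "bdd_above ((\<lambda>t. d (\<alpha> t) (\<beta> t)) ` {0..})" "bdd_above ((\<lambda>t. d (\<beta> t) (\<gamma> t)) ` {0..})"
        by (auto simp: asymptotic_rel_def)
      obtain K1 where K1: "\<And>t. 0 \<le> t \<Longrightarrow> d (\<alpha> t) (\<beta> t) \<le> K1"
        using b(1) by (auto simp: bdd_above_def)
      obtain K2 where K2: "\<And>t. 0 \<le> t \<Longrightarrow> d (\<beta> t) (\<gamma> t) \<le> K2"
        using b(2) by (auto simp: bdd_above_def)
      have "d (\<alpha> t) (\<gamma> t) \<le> K1 + K2" if "0 \<le> t" for t
        using triangle[of "\<alpha> t" "\<beta> t" "\<gamma> t"] K1[OF that] K2[OF that] r that by (simp add: geodesic_ray_def)
      then have "bdd_above ((\<lambda>t. d (\<alpha> t) (\<gamma> t)) ` {0..})"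
        by (intro bdd_aboveI[of _ "K1 + K2"]) auto
      then show "(\<alpha>, \<gamma>) \<in> asymptotic_rel M d"
        using r by (simp add: asymptotic_rel_def)
    qed
  qed
qed

section \<open>Bounded regions with a complete length distance\<close>

lemma filterlim_subseq_compose:
  "filterlim f F sequentially \<Longrightarrow> strict_mono r \<Longrightarrow> filterlim (\<lambda>n. f (r n)) F sequentially"
  by (rule filterlim_compose[OF _ filterlim_subseq])

text \<open>What the coarse geometry needs to know about the Kobayashi distance of
  \<open>U \<inter> \<Omega>\<close>. Boundedness of \<open>W\<close> and \<open>dist_le\<close>
  give Euclidean compactness of Lipschitz families, \<open>length\<close> replaces geodesics before
  their existence is known, and \<open>compl\<close> prevents limits from escaping to the
  boundary.\<close>

locale bounded_length_region = Metric_space W k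
  for W :: "'a::euclidean_space set" and k +
  fixes C :: real
  assumes opn: "open W" and bdd: "bounded W" and C_pos: "C > 0"
    and dist_le: "x \<in> W \<Longrightarrow> y \<in> W \<Longrightarrow> dist x y \<le> C * k x y"
    and tendsto: "x \<in> W \<Longrightarrow> X \<longlonglongrightarrow> x \<Longrightarrow> (\<lambda>n. k x (X n)) \<longlonglongrightarrow> 0"
    and length: "x \<in> W \<Longrightarrow> y \<in> W \<Longrightarrow> k x y < e \<Longrightarrow>
      \<exists>L c. 0 \<le> L \<and> L < e \<and> c 0 = x \<and> c L = y \<and> (\<forall>s\<in>{0..L}. c s \<in> W) \<and>
        (\<forall>s\<in>{0..L}. \<forall>t\<in>{0..L}. k (c s) (c t) \<le> \<bar>s - t\<bar>)"
    and compl: "mcomplete"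
begin

lemma tendsto2:
  assumes x: "x \<in> W" "y \<in> W" "X \<longlonglongrightarrow> x" "Y \<longlonglongrightarrow> y"
  shows "(\<lambda>n. k (X n) (Y n)) \<longlonglongrightarrow> k x y"
proof -
  have "\<forall>\<^sub>F n in sequentially. X n \<in> W" "\<forall>\<^sub>F n in sequentially. Y n \<in> W"
    using x opn topological_tendstoD by blast+
  then have "\<forall>\<^sub>F n in sequentially. norm (k (X n) (Y n) - k x y) \<le> k x (X n) + k y (Y n)"
  proof eventually_elim
    case (elim n)
    then show ?case
      using triangle[of "X n" x "Y n"] triangle[of x y "Y n"] triangle[of x "X n" y] triangle[of "X n" "Y n" y]
        commute[of "X n" x] commute[of "Y n" y] x(1,2) unfolding real_norm_def by linarith
  qed
  moreover have "(\<lambda>n. k x (X n) + k y (Y n)) \<longlonglongrightarrow> 0"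
    using tendsto_add[OF tendsto[OF x(1,3)] tendsto[OF x(2,4)]] by simp
  ultimately have "(\<lambda>n. k (X n) (Y n) - k x y) \<longlonglongrightarrow> 0"
    by (rule Lim_null_comparison)
  then show ?thesis by (simp add: LIM_zero_iff)
qed

lemma tendsto_imp:
  assumes "x \<in> W" "\<And>n. X n \<in> W" "(\<lambda>n. k x (X n)) \<longlonglongrightarrow> 0"
  shows "X \<longlonglongrightarrow> x"
proof (rule iffD2[OF tendsto_dist_iff], rule Lim_null_comparison)
  show "\<forall>\<^sub>F n in sequentially. norm (dist (X n) x) \<le> C * k x (X n)"
    using dist_le[OF assms(1,2)] by (intro always_eventually) (simp add: dist_commute)
  show "(\<lambda>n. C * k x (X n)) \<longlonglongrightarrow> 0"
    using tendsto_mult_left[OF assms(3), of C] by simp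
qed

text \<open>Cutting a nearly shortest curve at time \<open>r\<close> yields \<open>x\<close>. Thus a
  slightly larger ball is contained in a small neighbourhood of the ball of radius
  \<open>r\<close>.\<close>

lemma split_distance:
  assumes "p \<in> W" "y \<in> W" "0 \<le> r" "0 < e" "k p y < r + e"
  obtains x where "x \<in> W" "k p x \<le> r" "k x y < e"
proof (cases "k p y \<le> r")
  case True
  then show ?thesis using that[of y] assms by simp
next
  case False
  obtain L c where c: "0 \<le> L" "L < r + e" "c 0 = p" "c L = y" "\<forall>s\<in>{0..L}. c s \<in> W"
      "\<forall>s\<in>{0..L}. \<forall>t\<in>{0..L}. k (c s) (c t) \<le> \<bar>s - t\<bar>"
    using length[OF assms(1,2,5)] by blast
  have "k p y \<le> L" using c(6)[rule_format, of 0 L] c(1,3,4) by simp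
  then have rL: "r \<le> L" using False by simp
  have "k p (c r) \<le> r" using c(6)[rule_format, of 0 r] c(3) rL assms(3) by simp
  moreover have "k (c r) y \<le> L - r" using c(6)[rule_format, of r L] c(4) rL assms(3) by simp
  ultimately show ?thesis using that[of "c r"] c rL assms(3) by auto
qed

text \<open>This is the Hopf--Rinow theorem: \<open>W\<close> is bounded, so a closed metric ball is compact if its Euclidean limit points lie in \<open>W\<close>.\<close>

lemma kball_limit_mem:
  assumes p: "p \<in> W" and r: "0 \<le> r" and Y: "\<And>n. Y n \<in> W" "\<And>n. k p (Y n) \<le> r" "Y \<longlonglongrightarrow> y"
  shows "y \<in> W"
proof -
  define B where "B r = {y \<in> W. k p y \<le> r}" for r
  \<comment> \<open>For such \<open>r\<close> the set \<open>B r\<close> is Euclidean closed, hence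
    compact. The set of these radii is shown to contain 0, to be open to the right
    (\<open>extend\<close>) and to contain suprema (\<open>limit\<close>), so it contains every
    radius.\<close>
  define ok where "ok r \<longleftrightarrow> (\<forall>Y y. (\<forall>n. Y n \<in> B r) \<and> Y \<longlonglongrightarrow> y \<longrightarrow> y \<in> W)" for r
  have ok_mono: "ok r" if "ok s" "r \<le> s" for r s
    using that unfolding ok_def B_def by (smt (verit) mem_Collect_eq)
  have ok_limit: "y \<in> B r" if "ok r" "\<And>n. Y n \<in> B r" "Y \<longlonglongrightarrow> y" for r Y y
  proof -
    have y: "y \<in> W" using that unfolding ok_def by blast
    have "(\<lambda>n. k p (Y n)) \<longlonglongrightarrow> k p y"
      by (rule tendsto2[OF p y tendsto_const that(3)])
    then have "k p y \<le> r"
      using that(2) by (intro LIMSEQ_le_const2) (auto simp: B_def)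
    then show ?thesis using y by (simp add: B_def)
  qed
  have ok_compact: "compact (B r)" if "ok r" for r
  proof -
    have "closed (B r)"
      unfolding closed_sequential_limits using ok_limit[OF that] by blast
    moreover have "bounded (B r)"
      by (rule bounded_subset[OF bdd]) (auto simp: B_def)
    ultimately show ?thesis by (simp add: compact_eq_bounded_closed)
  qed
  have ok0: "ok 0"
    unfolding ok_def
  proof (intro allI impI)
    fix Y y assume Y: "(\<forall>n. Y n \<in> B 0) \<and> Y \<longlonglongrightarrow> y"
    have "Y n = p" for n
    proof -
      have "Y n \<in> W" "k p (Y n) \<le> 0" using Y by (auto simp: B_def)
      then show ?thesis using p nonneg[of p "Y n"] zero[of p "Y n"] by simp
    qed
    then have "Y = (\<lambda>_. p)" by auto
    then show "y \<in> W" using Y p LIMSEQ_const_iff by metis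
  qed
  have extend: "\<exists>\<eta>>0. ok (R + \<eta>)" if R: "ok R" "0 \<le> R" for R
  proof -
    have "B R \<subseteq> W" by (auto simp: B_def)
    then obtain e where e: "e > 0" "(\<Union>x\<in>B R. cball x e) \<subseteq> W"
      using compact_subset_open_imp_cball_epsilon_subset[OF ok_compact[OF R(1)] opn] by metis
    \<comment> \<open>A point of the enlarged ball is within \<open>2 * \<eta>\<close> of
      \<open>B R\<close> for \<open>k\<close>, hence within \<open>e / 2\<close> in the Euclidean
      distance; the remaining \<open>e / 2\<close> is spent on reaching the limit.\<close>
    define \<eta> where "\<eta> = e / (4 * C)"
    have \<eta>: "\<eta> > 0" using e C_pos by (simp add: \<eta>_def)
    have "ok (R + \<eta>)"
      unfolding ok_def
    proof (intro allI impI)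
      fix Y y assume Y: "(\<forall>n. Y n \<in> B (R + \<eta>)) \<and> Y \<longlonglongrightarrow> y"
      then obtain n where n: "dist (Y n) y < e / 2"
        using e by (metis half_gt_zero metric_LIMSEQ_D order_refl)
      have Yn: "Y n \<in> W" "k p (Y n) < R + 2 * \<eta>"
        using Y \<eta> by (auto simp: B_def intro: order.strict_trans1)
      then obtain x where x: "x \<in> W" "k p x \<le> R" "k x (Y n) < 2 * \<eta>"
        using split_distance[OF p Yn(1) R(2), of "2 * \<eta>"] \<eta> by auto
      have "dist x (Y n) \<le> C * (2 * \<eta>)"
        using dist_le[OF x(1) Yn(1)] x(3) C_pos by (smt (verit) mult_left_mono)
      also have "\<dots> = e / 2" using C_pos by (simp add: \<eta>_def)
      finally have "dist x y \<le> e"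
        using n dist_triangle[of x y "Y n"] by simp
      then have "y \<in> cball x e" by simp
      moreover have "x \<in> B R" using x by (simp add: B_def)
      ultimately show "y \<in> W" using e(2) by blast
    qed
    then show ?thesis using \<eta> by blast
  qed
  have limit: "ok R" if R: "0 < R" "\<And>r. 0 \<le> r \<Longrightarrow> r < R \<Longrightarrow> ok r" for R
  proof -
    \<comment> \<open>A net of a slightly smaller ball, compact by hypothesis, is also a coarser net
      of \<open>B R\<close>. Total boundedness makes a subsequence Cauchy, and completeness provides
      its limit in \<open>W\<close>.\<close>
    have "mtotally_bounded (B R)"
      unfolding mtotally_bounded_def
    proof (intro allI impI)
      fix e :: real assume e: "e > 0"
      define r where "r = max 0 (R - e / 4)"
      have r: "0 \<le> r" "r < R" "R \<le> r + e / 4" using R(1) e by (auto simp: r_def)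
      have "mtotally_bounded (B r)"
        unfolding mtotally_bounded_sequentially
      proof (intro conjI allI impI)
        show "B r \<subseteq> W" by (auto simp: B_def)
        fix \<sigma> :: "nat \<Rightarrow> 'a" assume \<sigma>: "range \<sigma> \<subseteq> B r"
        then obtain l s where l: "l \<in> B r" "strict_mono s" "(\<sigma> \<circ> s) \<longlonglongrightarrow> l"
          using ok_compact[OF R(2)[OF r(1,2)]] unfolding compact_def by (metis range_subsetD)
        have lW: "l \<in> W" using l(1) by (simp add: B_def)
        have \<sigma>W: "range (\<sigma> \<circ> s) \<subseteq> W" using \<sigma> by (auto simp: B_def)
        have "(\<lambda>n. k ((\<sigma> \<circ> s) n) l) \<longlonglongrightarrow> 0"
          using tendsto[OF lW l(3)] by (simp add: commute)
        then have "limitin mtopology (\<sigma> \<circ> s) l sequentially"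
          using lW \<sigma>W by (auto simp: limitin_metric_dist_null intro!: always_eventually)
        then have "MCauchy (\<sigma> \<circ> s)"
          using convergent_imp_MCauchy \<sigma>W by blast
        then show "\<exists>s. strict_mono s \<and> MCauchy (\<sigma> \<circ> s)" using l(2) by blast
      qed
      then obtain N where N: "finite N" "N \<subseteq> B r" "B r \<subseteq> (\<Union>x\<in>N. mball x (e / 2))"
        using e unfolding mtotally_bounded_def by (meson half_gt_zero)
      have "B R \<subseteq> (\<Union>x\<in>N. mball x e)"
      proof
        fix y assume y: "y \<in> B R"
        then have "y \<in> W" "k p y < r + e / 2" using r e by (auto simp: B_def)
        then obtain x where x: "x \<in> W" "k p x \<le> r" "k x y < e / 2"
          using split_distance[OF p _ r(1), of y "e / 2"] e by auto
        then have "x \<in> B r" by (simp add: B_def)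
        then obtain z where z: "z \<in> N" "x \<in> mball z (e / 2)" using N(3) by blast
        then have "k z y < e"
          using triangle[of z x y] x \<open>y \<in> W\<close> by (auto simp: in_mball)
        then show "y \<in> (\<Union>x\<in>N. mball x e)"
          using z \<open>y \<in> W\<close> by (auto simp: in_mball)
      qed
      moreover have "N \<subseteq> B R" using N(2) r by (auto simp: B_def)
      ultimately show "\<exists>K. finite K \<and> K \<subseteq> B R \<and> B R \<subseteq> (\<Union>x\<in>K. mball x e)"
        using N(1) by blast
    qed
    note seq = iffD1[OF mtotally_bounded_sequentially this, THEN conjunct2, rule_format]
    show ?thesis
      unfolding ok_def
    proof (intro allI impI)
      fix Y y assume Y: "(\<forall>n. Y n \<in> B R) \<and> Y \<longlonglongrightarrow> y"
      then obtain s where s: "strict_mono s" "MCauchy (Y \<circ> s)" using seq[of Y] by (metis image_subsetI)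
      then obtain l where "limitin mtopology (Y \<circ> s) l sequentially"
        using compl unfolding mcomplete_def by blast
      then have l: "l \<in> W" "(\<lambda>n. k ((Y \<circ> s) n) l) \<longlonglongrightarrow> 0"
        by (auto simp: limitin_metric_dist_null)
      have "(Y \<circ> s) \<longlonglongrightarrow> l"
      proof (rule tendsto_imp[OF l(1)])
        show "(Y \<circ> s) n \<in> W" for n using Y by (simp add: B_def)
        show "(\<lambda>n. k l ((Y \<circ> s) n)) \<longlonglongrightarrow> 0"
          using l(2) by (subst commute)
      qed
      moreover have "(Y \<circ> s) \<longlonglongrightarrow> y" using Y s(1) LIMSEQ_subseq_LIMSEQ by blast
      ultimately show "y \<in> W" using l(1) LIMSEQ_unique by blast
    qed
  qed
  have "ok r"
  proof (rule ccontr)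
    assume "\<not> ok r"
    define S where "S = {s. 0 \<le> s \<and> \<not> ok s}"
    have S: "r \<in> S" "\<And>s. s \<in> S \<Longrightarrow> 0 \<le> s" using r \<open>\<not> ok r\<close> by (auto simp: S_def)
    have bd: "bdd_below S" by (rule bdd_belowI[OF S(2)])
    define R where "R = Inf S"
    have R0: "0 \<le> R" unfolding R_def using S by (intro cInf_greatest) auto
    have "ok s" if "0 \<le> s" "s < R" for s
    proof (rule ccontr)
      assume "\<not> ok s"
      then have "s \<in> S" using that by (simp add: S_def)
      then have "R \<le> s" unfolding R_def using bd by (rule cInf_lower)
      then show False using that by simp
    qed
    then have "ok R" using limit[of R] ok0 R0 by (cases "R = 0") auto
    then obtain \<eta> where \<eta>: "\<eta> > 0" "ok (R + \<eta>)" using extend R0 by blast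
    have "Inf S < R + \<eta>" using \<eta>(1) by (simp add: R_def)
    then obtain s where "s \<in> S" "s < R + \<eta>" using cInf_lessD[of S] S(1) by blast
    then show False using ok_mono[OF \<eta>(2), of s] by (simp add: S_def)
  qed
  then show ?thesis using Y p unfolding ok_def B_def by blast
qed

lemma dist_at_top:
  assumes p: "p \<in> W" and X: "\<And>n. X n \<in> W" "X \<longlonglongrightarrow> \<xi>" and \<xi>: "\<xi> \<notin> W"
  shows "filterlim (\<lambda>n. k p (X n)) at_top sequentially"
  unfolding filterlim_at_top
proof (rule ccontr)
  assume "\<not> (\<forall>Z. \<forall>\<^sub>F n in sequentially. Z \<le> k p (X n))"
  then obtain Z where Z: "\<exists>\<^sub>F n in sequentially. k p (X n) < Z"
    by (auto simp: not_eventually not_le)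
  then have "infinite {n. k p (X n) < Z}"
    by (auto simp: frequently_sequentially infinite_nat_iff_unbounded_le)
  then obtain s :: "nat \<Rightarrow> nat" where s: "strict_mono s" "\<And>n. s n \<in> {n. k p (X n) < Z}"
    using infinite_enumerate by blast
  then have s: "strict_mono s" "\<And>n. k p (X (s n)) < Z" by auto
  have "0 \<le> Z" using s(2)[of 0] nonneg[of p "X (s 0)"] by linarith
  have "(X \<circ> s) \<longlonglongrightarrow> \<xi>" using X(2) s(1) LIMSEQ_subseq_LIMSEQ by blast
  then have "\<xi> \<in> W"
    using kball_limit_mem[OF p \<open>0 \<le> Z\<close>, of "X \<circ> s"] X(1) s(2) less_imp_le by fastforce
  then show False using \<xi> by simp
qed

text \<open>All the points \<open>F n t\<close> lie in the closed \<open>k\<close>-ball of radius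
  \<open>\<bar>t\<bar>\<close> about \<open>p\<close>, so \<open>kball_limit_mem\<close> keeps their
  Euclidean limit inside \<open>W\<close>.\<close>

lemma Lipschitz_limit:
  assumes p: "p \<in> W" and F: "\<And>n t. F n t \<in> W" "\<And>n s t. k (F n s) (F n t) \<le> \<bar>s - t\<bar>" "\<And>n. F n 0 = p"
  shows "\<exists>r g. strict_mono (r :: nat \<Rightarrow> nat) \<and> (\<forall>t. (\<lambda>n. F (r n) t) \<longlonglongrightarrow> g t) \<and> (\<forall>t. g t \<in> W) \<and>
    (\<forall>s t. k (g s) (g t) \<le> \<bar>s - t\<bar>) \<and> g 0 = p"
proof -
  have "dist (F n s) (F n t) \<le> C * \<bar>s - t\<bar>" for n s t
    using dist_le[OF F(1) F(1), of n s n t] mult_left_mono[OF F(2)[of n s t], of C] C_pos by linarith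
  then have "\<exists>r g. strict_mono (r :: nat \<Rightarrow> nat) \<and> (\<forall>t. (\<lambda>n. F (r n) t) \<longlonglongrightarrow> g t)"
    by (rule Lipschitz_pointwise_convergent_subsequence[OF less_imp_le[OF C_pos], of F "norm p"]) (simp add: F(3))
  then obtain r g where rg: "strict_mono (r :: nat \<Rightarrow> nat)" "\<And>t. (\<lambda>n. F (r n) t) \<longlonglongrightarrow> g t"
    by blast
  have gW: "g t \<in> W" for t
  proof (rule kball_limit_mem[OF p _ _ _ rg(2)])
    show "k p (F (r n) t) \<le> \<bar>t\<bar>" for n
      using F(2)[of "r n" 0 t] F(3) by simp
  qed (use F in auto)
  have "k (g s) (g t) \<le> \<bar>s - t\<bar>" for s t
    by (rule LIMSEQ_le_const2[OF tendsto2[OF gW gW rg(2) rg(2)]]) (use F(2) in blast)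
  moreover have "g 0 = p"
    using rg(2)[of 0] F(3) by (simp add: LIMSEQ_const_iff)
  ultimately show ?thesis using rg gW by blast
qed

text \<open>A limit of curves whose lengths decrease to \<open>L\<close>, each extended by constants
  on both sides. Since curve number \<open>n\<close> may reach \<open>y\<close> only after time
  \<open>L\<close>, the limit is first seen to equal \<open>y\<close> for \<open>t > L\<close> and
  then, being Lipschitz, at \<open>L\<close> itself. Equality in the triangle inequality makes it
  isometric.\<close>

lemma geodesic_exists:
  assumes x: "x \<in> W" "y \<in> W"
  obtains g where "geodesic_segment W k x y g"
proof -
  define L where "L = k x y"
  have "\<exists>l c. 0 \<le> l \<and> l < L + 1 / Suc n \<and> c 0 = x \<and> c l = y \<and> (\<forall>s\<in>{0..l}. c s \<in> W) \<and>
        (\<forall>s\<in>{0..l}. \<forall>t\<in>{0..l}. k (c s) (c t) \<le> \<bar>s - t\<bar>)" for n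
    using x by (intro length) (auto simp: L_def)
  then obtain l c where c: "\<And>n. 0 \<le> l n" "\<And>n. l n < L + 1 / Suc n" "\<And>n. c n 0 = x" "\<And>n. c n (l n) = y"
      "\<And>n s. s \<in> {0..l n} \<Longrightarrow> c n s \<in> W"
      "\<And>n s t. s \<in> {0..l n} \<Longrightarrow> t \<in> {0..l n} \<Longrightarrow> k (c n s) (c n t) \<le> \<bar>s - t\<bar>"
    by metis
  define F where "F n t = c n (max 0 (min t (l n)))" for n t
  have cl: "max 0 (min t (l n)) \<in> {0..l n}" for n t
    using c(1)[of n] by auto
  have F: "k (F n s) (F n t) \<le> \<bar>s - t\<bar>" for n s t
    using c(6)[OF cl cl, of n s t] unfolding F_def by linarith
  have "\<exists>r g. strict_mono (r :: nat \<Rightarrow> nat) \<and> (\<forall>t. (\<lambda>n. F (r n) t) \<longlonglongrightarrow> g t) \<and> (\<forall>t. g t \<in> W) \<and>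
    (\<forall>s t. k (g s) (g t) \<le> \<bar>s - t\<bar>) \<and> g 0 = x"
  proof (rule Lipschitz_limit[OF x(1), of F])
    show "F n t \<in> W" for n t unfolding F_def by (rule c(5)[OF cl])
    show "F n 0 = x" for n using c(1)[of n] c(3) by (simp add: F_def)
  qed (rule F)
  then obtain r g where rg: "strict_mono (r :: nat \<Rightarrow> nat)" "\<And>t. (\<lambda>n. F (r n) t) \<longlonglongrightarrow> g t" "\<And>t. g t \<in> W"
    "\<And>s t. k (g s) (g t) \<le> \<bar>s - t\<bar>" "g 0 = x"
    by blast
  have gy: "g t = y" if t: "L < t" for t
  proof -
    have "(\<lambda>n. 1 / real (Suc n)) \<longlonglongrightarrow> 0"
      using LIMSEQ_inverse_real_of_nat by (simp add: inverse_eq_divide)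
    then have "(\<lambda>n. L + 1 / real (Suc n)) \<longlonglongrightarrow> L + 0" by (intro tendsto_intros)
    then have "\<forall>\<^sub>F n in sequentially. L + 1 / real (Suc n) < t" using t by (intro order_tendstoD(2)) auto
    then have "\<forall>\<^sub>F n in sequentially. F n t = y"
    proof eventually_elim
      case (elim n)
      then have "l n < t" using c(2)[of n] by simp
      then show ?case using c(1)[of n] c(4)[of n] by (simp add: F_def)
    qed
    then have "\<forall>\<^sub>F n in sequentially. F (r n) t = y"
      by (rule eventually_subseq[OF rg(1)])
    then have "(\<lambda>n. F (r n) t) \<longlonglongrightarrow> y" by (rule tendsto_eventually)
    then show ?thesis using rg(2) LIMSEQ_unique by blast
  qed
  have "g L = y"
  proof (rule ccontr)
    assume "g L \<noteq> y"
    then have pos: "k (g L) y > 0" using x rg(3)[of L] by (metis nonneg order_le_less zero)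
    have "k (g L) (g (L + k (g L) y / 2)) \<le> k (g L) y / 2"
      using rg(4)[of L "L + k (g L) y / 2"] pos by simp
    then show False using gy[of "L + k (g L) y / 2"] pos by simp
  qed
  then have gy': "g t = y" if "L \<le> t" for t using gy that by (cases "t = L") auto
  have iso: "k (g s) (g t) = t - s" if "0 \<le> s" "s \<le> t" "t \<le> L" for s t
  proof -
    have "L \<le> k (g 0) (g s) + k (g s) (g t) + k (g t) (g L)"
      using triangle[of x "g s" y] triangle[of "g s" "g t" y] x rg(3,5) \<open>g L = y\<close> by (simp add: L_def)
    then show ?thesis
      using rg(4)[of 0 s] rg(4)[of t L] rg(4)[of s t] that by simp
  qed
  have "geodesic_segment W k x y g"
    unfolding geodesic_segment_def L_def[symmetric]
  proof (intro conjI ballI allI impI)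
    show "k (g s) (g t) = \<bar>s - t\<bar>" if "s \<in> {0..L}" "t \<in> {0..L}" for s t
      using iso[of s t] iso[of t s] that commute[of "g s" "g t"] by (cases "s \<le> t") auto
  qed (use rg gy' in auto)
  then show ?thesis using that by blast
qed

lemma compact_convergence_of_pointwise:
  assumes \<Gamma>: "\<And>n t. 0 \<le> t \<Longrightarrow> \<Gamma> n t \<in> W" "\<And>n s t. 0 \<le> s \<Longrightarrow> 0 \<le> t \<Longrightarrow> k (\<Gamma> n s) (\<Gamma> n t) \<le> \<bar>s - t\<bar>"
    and \<alpha>: "\<And>t. 0 \<le> t \<Longrightarrow> \<alpha> t \<in> W" "\<And>s t. 0 \<le> s \<Longrightarrow> 0 \<le> t \<Longrightarrow> k (\<alpha> s) (\<alpha> t) \<le> \<bar>s - t\<bar>"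
    and lim: "\<And>t. 0 \<le> t \<Longrightarrow> (\<lambda>n. \<Gamma> n t) \<longlonglongrightarrow> \<alpha> t"
  shows "compact_convergence k \<Gamma> \<alpha>"
  unfolding compact_convergence_def
proof (intro allI impI)
  fix K :: "real set" and \<epsilon> :: real assume K: "compact K \<and> K \<subseteq> {0..}" and \<epsilon>: "\<epsilon> > 0"
  have "K \<subseteq> (\<Union>t\<in>K. ball t (\<epsilon> / 3))" using \<epsilon> by auto
  then obtain D where D: "D \<subseteq> K" "finite D" "K \<subseteq> (\<Union>t\<in>D. ball t (\<epsilon> / 3))"
    using K compactE_image[of K K "\<lambda>t. ball t (\<epsilon> / 3)"] by (metis open_ball)
  have "\<forall>\<^sub>F n in sequentially. k (\<Gamma> n t) (\<alpha> t) < \<epsilon> / 3" if "t \<in> D" for t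
  proof -
    have t: "0 \<le> t" using that D K by auto
    have "(\<lambda>n. k (\<Gamma> n t) (\<alpha> t)) \<longlonglongrightarrow> k (\<alpha> t) (\<alpha> t)"
      by (rule tendsto2[OF \<alpha>(1)[OF t] \<alpha>(1)[OF t] lim[OF t] tendsto_const])
    then show ?thesis using \<alpha>(1)[OF t] \<epsilon> by (intro order_tendstoD(2)) auto
  qed
  then have "\<forall>\<^sub>F n in sequentially. \<forall>t\<in>D. k (\<Gamma> n t) (\<alpha> t) < \<epsilon> / 3"
    using D(2) by (simp add: eventually_ball_finite)
  then show "\<forall>\<^sub>F n in sequentially. \<forall>t\<in>K. k (\<Gamma> n t) (\<alpha> t) < \<epsilon>"
  proof eventually_elim
    case (elim n)
    show ?case
    proof
      fix t assume t: "t \<in> K"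
      then obtain s where s: "s \<in> D" "\<bar>s - t\<bar> < \<epsilon> / 3" using D(3) by (auto simp: dist_real_def)
      have nn: "0 \<le> s" "0 \<le> t" using s(1) D(1) K t by auto
      have "k (\<Gamma> n t) (\<alpha> t) \<le> k (\<Gamma> n t) (\<Gamma> n s) + k (\<Gamma> n s) (\<alpha> s) + k (\<alpha> s) (\<alpha> t)"
        using triangle[OF \<Gamma>(1)[OF nn(2)] \<Gamma>(1)[OF nn(1)] \<alpha>(1)[OF nn(2)], of n n]
          triangle[OF \<Gamma>(1)[OF nn(1)] \<alpha>(1)[OF nn(1)] \<alpha>(1)[OF nn(2)], of n] by linarith
      then show "k (\<Gamma> n t) (\<alpha> t) < \<epsilon>"
        using \<Gamma>(2)[OF nn(2,1), of n] \<alpha>(2)[OF nn] bspec[OF elim s(1)] s(2) by linarith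
    qed
  qed
qed

text \<open>Any two times lie within the domain of all sufficiently late segments, because the
  lengths diverge. So the isometry property survives on the whole half line.\<close>

lemma segments_subconverge:
  assumes p: "p \<in> W" and X: "\<And>n. X n \<in> W" "filterlim (\<lambda>n. k p (X n)) at_top sequentially"
    and \<Gamma>: "\<And>n. geodesic_segment W k p (X n) (\<Gamma> n)"
  obtains r \<alpha> where "strict_mono (r :: nat \<Rightarrow> nat)" "geodesic_ray W k \<alpha>" "\<alpha> 0 = p"
    "compact_convergence k (\<Gamma> \<circ> r) \<alpha>" "\<And>t. 0 \<le> t \<Longrightarrow> (\<lambda>n. \<Gamma> (r n) t) \<longlonglongrightarrow> \<alpha> t"
proof -
  note lip = geodesic_segment_Lipschitz[OF \<Gamma> X(1)]
  define F where "F n t = \<Gamma> n (max 0 t)" for n t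
  have F: "k (F n s) (F n t) \<le> \<bar>s - t\<bar>" for n s t
    using lip(2)[of "max 0 s" "max 0 t" n] by (simp add: F_def)
  have "\<exists>r g. strict_mono (r :: nat \<Rightarrow> nat) \<and> (\<forall>t. (\<lambda>n. F (r n) t) \<longlonglongrightarrow> g t) \<and> (\<forall>t. g t \<in> W) \<and>
    (\<forall>s t. k (g s) (g t) \<le> \<bar>s - t\<bar>) \<and> g 0 = p"
  proof (rule Lipschitz_limit[OF p, of F])
    show "F n t \<in> W" for n t using lip(1)[of "max 0 t" "max 0 t" n] by (simp add: F_def)
    show "F n 0 = p" for n using geodesic_segmentD(1)[OF \<Gamma>] by (simp add: F_def)
  qed (rule F)
  then obtain r g where rg: "strict_mono (r :: nat \<Rightarrow> nat)" "\<And>t. (\<lambda>n. F (r n) t) \<longlonglongrightarrow> g t" "\<And>t. g t \<in> W"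
    "\<And>s t. k (g s) (g t) \<le> \<bar>s - t\<bar>" "g 0 = p"
    by blast
  have lim: "(\<lambda>n. \<Gamma> (r n) t) \<longlonglongrightarrow> g t" if "0 \<le> t" for t
    using rg(2)[of t] that by (simp add: F_def)
  have ray: "geodesic_ray W k g"
    unfolding geodesic_ray_def
  proof (intro conjI allI impI)
    fix s t :: real assume st: "0 \<le> s" "0 \<le> t"
    have "\<forall>\<^sub>F n in sequentially. max s t \<le> k p (X (r n))"
      using filterlim_subseq_compose[OF X(2) rg(1)] unfolding filterlim_at_top by blast
    then have "\<forall>\<^sub>F n in sequentially. k (\<Gamma> (r n) s) (\<Gamma> (r n) t) = \<bar>s - t\<bar>"
      by eventually_elim (use geodesic_segmentD(4)[OF \<Gamma>] st in auto)
    then have "(\<lambda>n. k (\<Gamma> (r n) s) (\<Gamma> (r n) t)) \<longlonglongrightarrow> \<bar>s - t\<bar>" by (rule tendsto_eventually)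
    then show "k (g s) (g t) = \<bar>s - t\<bar>"
      using tendsto2[OF rg(3) rg(3) lim[OF st(1)] lim[OF st(2)]] LIMSEQ_unique by blast
  qed (use rg in auto)
  have "compact_convergence k (\<Gamma> \<circ> r) g"
    by (rule compact_convergence_of_pointwise) (use lip lim rg in auto)
  then show ?thesis using that rg ray lim by blast
qed

text \<open>The definition of convergence quantifies over all choices of segments, whereas only one
  choice is known to converge. Segments with the same ends stay within \<open>2 * \<delta>\<close>,
  so every other subsequential limit is asymptotic to \<open>\<alpha>\<close>.\<close>

lemma points_tendsto_class:
  assumes p: "p \<in> W" and X: "\<And>n. X n \<in> W" "filterlim (\<lambda>n. k p (X n)) at_top sequentially"
    and hyp: "gromov_hyperbolic W k"
    and \<Gamma>: "\<And>n. geodesic_segment W k p (X n) (\<Gamma> n)" and \<alpha>: "geodesic_ray W k \<alpha>"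
    and lim: "\<And>t. 0 \<le> t \<Longrightarrow> (\<lambda>n. \<Gamma> n t) \<longlonglongrightarrow> \<alpha> t"
  shows "points_tendsto_boundary W k X (asymptotic_rel W k `` {\<alpha>})"
  unfolding points_tendsto_boundary_def subconverges_to_class_def
proof (intro bexI[OF _ p] allI impI)
  fix \<Gamma>' and r :: "nat \<Rightarrow> nat" assume \<Gamma>': "\<forall>n. geodesic_segment W k p (X n) (\<Gamma>' n)" and r: "strict_mono r"
  obtain \<delta> where hyp': "\<And>x y z. x \<in> W \<Longrightarrow> y \<in> W \<Longrightarrow> z \<in> W \<Longrightarrow>
      gromov_product k p x z \<ge> min (gromov_product k p x y) (gromov_product k p y z) - \<delta>"
    using hyp p unfolding gromov_hyperbolic_def by blast
  have Xr: "\<And>n. X (r n) \<in> W" "filterlim (\<lambda>n. k p (X (r n))) at_top sequentially"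
    using X filterlim_subseq_compose[OF X(2) r] by auto
  obtain s \<beta> where s: "strict_mono (s :: nat \<Rightarrow> nat)" "geodesic_ray W k \<beta>" "\<beta> 0 = p"
    "compact_convergence k ((\<lambda>n. \<Gamma>' (r n)) \<circ> s) \<beta>" "\<And>t. 0 \<le> t \<Longrightarrow> (\<lambda>n. \<Gamma>' (r (s n)) t) \<longlonglongrightarrow> \<beta> t"
    using segments_subconverge[OF p Xr, of "\<lambda>n. \<Gamma>' (r n)"] \<Gamma>' by blast
  have "k (\<alpha> t) (\<beta> t) \<le> 2 * \<delta>" if t: "0 \<le> t" for t
  proof -
    have rs: "strict_mono (\<lambda>n. r (s n))" using r s(1) by (simp add: strict_mono_def)
    have mem: "\<alpha> t \<in> W" "\<beta> t \<in> W" using \<alpha> s(2) t by (auto simp: geodesic_ray_def)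
    have "(\<lambda>n. \<Gamma> (r (s n)) t) \<longlonglongrightarrow> \<alpha> t"
      using LIMSEQ_subseq_LIMSEQ[OF lim[OF t] rs] by (simp add: comp_def)
    then have "(\<lambda>n. k (\<Gamma> (r (s n)) t) (\<Gamma>' (r (s n)) t)) \<longlonglongrightarrow> k (\<alpha> t) (\<beta> t)"
      by (rule tendsto2[OF mem _ s(5)[OF t]])
    moreover have "\<forall>\<^sub>F n in sequentially. t \<le> k p (X (r (s n)))"
      using filterlim_subseq_compose[OF X(2) rs] unfolding filterlim_at_top by blast
    then have "\<forall>\<^sub>F n in sequentially. k (\<Gamma> (r (s n)) t) (\<Gamma>' (r (s n)) t) \<le> 2 * \<delta>"
      by eventually_elim (rule geodesic_segments_close[OF hyp' \<Gamma> _ X(1) t], use \<Gamma>' in auto)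
    ultimately show ?thesis by (rule tendsto_upperbound) simp
  qed
  then have "(\<alpha>, \<beta>) \<in> asymptotic_rel W k"
    using \<alpha> s(2) by (auto simp: asymptotic_rel_def intro!: bdd_aboveI[of _ "2 * \<delta>"])
  then show "\<exists>s. strict_mono s \<and> (\<exists>\<gamma>\<in>asymptotic_rel W k `` {\<alpha>}. compact_convergence k (\<Gamma>' \<circ> r \<circ> s) \<gamma>)"
    using s by (intro exI[of _ s] conjI bexI[of _ \<beta>]) (auto simp: comp_def)
qed

end

section \<open>Geodesic rays with a common landing point\<close>

text \<open>The preimage under \<open>F\<close> of a Euclidean neighbourhood of
  \<open>F (Inr \<eta>)\<close> is \<open>gromov_open\<close>, hence contains almost all
  \<open>X n\<close>. As \<open>F\<close> is the identity on \<open>W\<close>, the sequence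
  converges to \<open>F (Inr \<eta>)\<close> in the Euclidean sense as well.\<close>

lemma (in bounded_length_region) gromov_limit_eq:
  assumes F: "continuous_map (gromov_compactification W k) (top_of_set (closure W)) F" "\<And>x. x \<in> W \<Longrightarrow> F (Inl x) = x"
    and \<eta>: "\<eta> \<in> gromov_boundary W k" and X: "\<And>n. X n \<in> W" "X \<longlonglongrightarrow> \<xi>"
    and lim: "points_tendsto_boundary W k X \<eta>"
  shows "F (Inr \<eta>) = \<xi>"
proof -
  let ?G = "gromov_compactification W k"
  have top: "topspace ?G = W <+> gromov_boundary W k"
    by (rule topspace_gromov_compactification) unfold_locales
  have "X \<longlonglongrightarrow> F (Inr \<eta>)"
  proof (rule topological_tendstoI)
    fix V assume V: "open V" "F (Inr \<eta>) \<in> V"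
    define U where "U = {x \<in> topspace ?G. F x \<in> closure W \<inter> V}"
    have "openin (top_of_set (closure W)) (closure W \<inter> V)"
      using V(1) by (simp add: openin_open_Int)
    then have "openin ?G U"
      unfolding U_def by (rule openin_continuous_map_preimage[OF F(1)])
    then have "gromov_open W k U" by (simp add: openin_gromov_compactification)
    moreover have "Inr \<eta> \<in> U"
      using \<eta> V(2) F(1) by (auto simp: U_def top continuous_map_def Pi_iff)
    moreover have "range X \<subseteq> W" using X(1) by blast
    ultimately have "\<forall>\<^sub>F n in sequentially. Inl (X n) \<in> U"
      unfolding gromov_open_def using lim by blast
    then show "\<forall>\<^sub>F n in sequentially. X n \<in> V"
      by eventually_elim (use X(1) F(2) in \<open>simp add: U_def\<close>)
  qed
  then show ?thesis using X(2) LIMSEQ_unique by blast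
qed

text \<open>The ray is a limit of geodesic segments from \<open>c 0\<close> to the points
  \<open>c n\<close>. The Morse bound holds for these uniformly and passes to the limit with 1
  added; the endpoints \<open>c n\<close> tend to \<open>\<xi>\<close>, which identifies the class
  of the ray.\<close>

lemma (in bounded_length_region) quasigeodesic_near_ray:
  assumes hyp: "gromov_hyperbolic W k" and A: "0 \<le> A"
    and F: "continuous_map (gromov_compactification W k) (top_of_set (closure W)) F" "\<And>x. x \<in> W \<Longrightarrow> F (Inl x) = x"
    and c: "\<And>s. 0 \<le> s \<Longrightarrow> c s \<in> W"
      "\<And>s t. 0 \<le> s \<Longrightarrow> 0 \<le> t \<Longrightarrow> \<bar>s - t\<bar> \<le> k (c s) (c t)"
      "\<And>s t. 0 \<le> s \<Longrightarrow> 0 \<le> t \<Longrightarrow> k (c s) (c t) \<le> A * \<bar>s - t\<bar>"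
    and \<xi>: "(c \<longlongrightarrow> \<xi>) at_top" "\<xi> \<notin> W"
  obtains \<alpha> D where "geodesic_ray W k \<alpha>" "\<alpha> 0 = c 0" "F (Inr (asymptotic_rel W k `` {\<alpha>})) = \<xi>"
    "\<And>t. 0 \<le> t \<Longrightarrow> \<exists>s\<ge>0. k (\<alpha> t) (c s) \<le> D"
proof -
  define X where "X n = c (real n)" for n
  have X: "\<And>n. X n \<in> W" "X \<longlonglongrightarrow> \<xi>"
    unfolding X_def using c(1) filterlim_compose[OF \<xi>(1) filterlim_real_sequentially] by auto
  have p: "c 0 \<in> W" using c(1) by simp
  have top: "filterlim (\<lambda>n. k (c 0) (X n)) at_top sequentially"
    by (rule dist_at_top[OF p X \<xi>(2)])
  have "\<exists>g. geodesic_segment W k (c 0) (X n) g" for n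
    using geodesic_exists[OF p X(1)] by blast
  then obtain \<Gamma> where \<Gamma>: "\<And>n. geodesic_segment W k (c 0) (X n) (\<Gamma> n)" by metis
  obtain r \<alpha> where r: "strict_mono (r :: nat \<Rightarrow> nat)" "geodesic_ray W k \<alpha>" "\<alpha> 0 = c 0"
    and lim: "\<And>t. 0 \<le> t \<Longrightarrow> (\<lambda>n. \<Gamma> (r n) t) \<longlonglongrightarrow> \<alpha> t"
    using segments_subconverge[OF p X(1) top \<Gamma>] by blast
  have "points_tendsto_boundary W k (\<lambda>n. X (r n)) (asymptotic_rel W k `` {\<alpha>})"
    by (rule points_tendsto_class[OF p X(1) filterlim_subseq_compose[OF top r(1)] hyp \<Gamma> r(2) lim])
  moreover have "asymptotic_rel W k `` {\<alpha>} \<in> gromov_boundary W k"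
    unfolding gromov_boundary_def using r(2) by (auto intro: quotientI)
  moreover have "(\<lambda>n. X (r n)) \<longlonglongrightarrow> \<xi>"
    using LIMSEQ_subseq_LIMSEQ[OF X(2) r(1)] by (simp add: comp_def)
  ultimately have F\<xi>: "F (Inr (asymptotic_rel W k `` {\<alpha>})) = \<xi>"
    using gromov_limit_eq[OF F _ X(1)] by blast
  have "\<exists>D. \<forall>T g u. 0 \<le> T \<longrightarrow> geodesic_segment W k (c 0) (c T) g \<longrightarrow> 0 \<le> u \<longrightarrow>
    u \<le> k (c 0) (c T) \<longrightarrow> (\<exists>s\<in>{0..T}. k (g u) (c s) \<le> D)"
    by (rule geodesic_near_quasigeodesic[OF hyp A c])
  then obtain D where D: "\<And>T g u. 0 \<le> T \<Longrightarrow> geodesic_segment W k (c 0) (c T) g \<Longrightarrow> 0 \<le> u \<Longrightarrow>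
    u \<le> k (c 0) (c T) \<Longrightarrow> \<exists>s\<in>{0..T}. k (g u) (c s) \<le> D"
    by blast
  have "\<exists>s\<ge>0. k (\<alpha> t) (c s) \<le> D + 1" if t: "0 \<le> t" for t
  proof -
    have \<alpha>W: "\<alpha> t \<in> W" using r(2) t by (simp add: geodesic_ray_def)
    have "\<forall>\<^sub>F n in sequentially. t \<le> k (c 0) (X (r n))"
      using filterlim_subseq_compose[OF top r(1)] unfolding filterlim_at_top by blast
    moreover have "\<forall>\<^sub>F n in sequentially. k (\<alpha> t) (\<Gamma> (r n) t) < 1"
      using tendsto[OF \<alpha>W lim[OF t]] by (rule order_tendstoD(2)) simp
    ultimately have "\<forall>\<^sub>F n in sequentially. t \<le> k (c 0) (X (r n)) \<and> k (\<alpha> t) (\<Gamma> (r n) t) < 1"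
      by eventually_elim simp
    then have "\<exists>n. t \<le> k (c 0) (X (r n)) \<and> k (\<alpha> t) (\<Gamma> (r n) t) < 1"
      by (rule eventually_happens'[OF sequentially_bot])
    then obtain n where n: "t \<le> k (c 0) (X (r n))" "k (\<alpha> t) (\<Gamma> (r n) t) < 1"
      by blast
    obtain s where s: "s \<in> {0..real (r n)}" "k (\<Gamma> (r n) t) (c s) \<le> D"
      using D[of "real (r n)" "\<Gamma> (r n)" t] \<Gamma>[of "r n"] n(1) t by (auto simp: X_def)
    have "\<Gamma> (r n) t \<in> W" "c s \<in> W"
      using geodesic_segmentD(3)[OF \<Gamma> t n(1)] c(1) s(1) by auto
    then have "k (\<alpha> t) (c s) \<le> D + 1"
      using triangle[OF \<alpha>W, of "\<Gamma> (r n) t" "c s"] n(2) s(2) by simp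
    then show ?thesis using s(1) by auto
  qed
  then show ?thesis by (rule that[OF r(2,3) F\<xi>])
qed

text \<open>The converse of being near the ray. The parameters \<open>\<sigma> n\<close> of points
  of \<open>c\<close> near \<open>\<alpha> n\<close> start below \<open>D\<close>, advance by at
  most \<open>2 * D + 1\<close> because \<open>c\<close> does not contract, and are unbounded
  because \<open>c\<close> is Lipschitz. So every \<open>t\<close> is within
  \<open>2 * D + 1\<close> of one of them.\<close>

lemma (in Metric_space) quasigeodesic_covered_by_ray:
  assumes \<alpha>: "geodesic_ray M d \<alpha>" "\<alpha> 0 = c 0" and A: "0 < A"
    and c: "\<And>s. 0 \<le> s \<Longrightarrow> c s \<in> M"
      "\<And>s t. 0 \<le> s \<Longrightarrow> 0 \<le> t \<Longrightarrow> \<bar>s - t\<bar> \<le> d (c s) (c t)"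
      "\<And>s t. 0 \<le> s \<Longrightarrow> 0 \<le> t \<Longrightarrow> d (c s) (c t) \<le> A * \<bar>s - t\<bar>"
    and near: "\<And>t. 0 \<le> t \<Longrightarrow> \<exists>s\<ge>0. d (\<alpha> t) (c s) \<le> D"
    and t: "0 \<le> t"
  shows "\<exists>u\<ge>0. d (c t) (\<alpha> u) \<le> A * (2 * D + 1) + D"
proof -
  have \<alpha>M: "\<alpha> u \<in> M" if "0 \<le> u" for u using \<alpha>(1) that by (simp add: geodesic_ray_def)
  have "\<exists>s\<ge>0. d (\<alpha> (real n)) (c s) \<le> D" for n using near by simp
  then obtain \<sigma> where \<sigma>: "\<And>n. 0 \<le> \<sigma> n" "\<And>n. d (\<alpha> (real n)) (c (\<sigma> n)) \<le> D" by metis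
  have D: "0 \<le> D" using \<sigma>(2)[of 0] nonneg order_trans by blast
  have close: "d (c t) (\<alpha> (real n)) \<le> A * (2 * D + 1) + D" if "\<bar>t - \<sigma> n\<bar> \<le> 2 * D + 1" for n
  proof -
    have "d (c t) (\<alpha> n) \<le> d (c t) (c (\<sigma> n)) + d (c (\<sigma> n)) (\<alpha> n)"
      using triangle c(1) \<alpha>M t \<sigma>(1) by simp
    also have "\<dots> \<le> A * \<bar>t - \<sigma> n\<bar> + D"
      using c(3)[OF t \<sigma>(1)[of n]] \<sigma>(2)[of n] commute[of "c (\<sigma> n)"] by simp
    also have "\<dots> \<le> A * (2 * D + 1) + D"
      using A that by (intro add_right_mono mult_left_mono) auto
    finally show ?thesis .
  qed
  have step: "\<bar>\<sigma> n - \<sigma> (Suc n)\<bar> \<le> 2 * D + 1" for n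
  proof -
    have "d (\<alpha> n) (\<alpha> (Suc n)) = 1" using \<alpha>(1) unfolding geodesic_ray_def by simp
    moreover have "d (c (\<sigma> n)) (c (\<sigma> (Suc n))) \<le> d (c (\<sigma> n)) (\<alpha> n) + d (\<alpha> n) (\<alpha> (Suc n)) + d (\<alpha> (Suc n)) (c (\<sigma> (Suc n)))"
      using triangle[of "c (\<sigma> n)" "\<alpha> n" "c (\<sigma> (Suc n))"] triangle[of "\<alpha> n" "\<alpha> (Suc n)" "c (\<sigma> (Suc n))"]
        c(1) \<alpha>M \<sigma>(1) by simp
    ultimately show ?thesis
      using c(2)[OF \<sigma>(1) \<sigma>(1), of n "Suc n"] \<sigma>(2)[of n] \<sigma>(2)[of "Suc n"] commute[of "c (\<sigma> n)" "\<alpha> n"] by linarith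
  qed
  have d\<alpha>0: "d (\<alpha> n) (\<alpha> 0) = real n" for n :: nat using \<alpha>(1) unfolding geodesic_ray_def by simp
  have ex: "\<exists>n. t \<le> \<sigma> n"
  proof -
    obtain n :: nat where n: "A * t + D \<le> n" using real_arch_simple by blast
    have "real n \<le> d (\<alpha> n) (c (\<sigma> n)) + d (c (\<sigma> n)) (c 0)"
      using triangle[of "\<alpha> n" "c (\<sigma> n)" "c 0"] c(1) \<alpha>M \<sigma>(1) d\<alpha>0[of n] \<alpha>(2) by simp
    also have "\<dots> \<le> D + A * \<sigma> n"
      using \<sigma>(2)[of n] c(3)[OF \<sigma>(1), of 0 n] \<sigma>(1)[of n] by simp
    finally have "A * t \<le> A * \<sigma> n" using n by simp
    then show ?thesis using A by auto
  qed
  define m where "m = (LEAST n. t \<le> \<sigma> n)"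
  have m: "t \<le> \<sigma> m" unfolding m_def using ex by (metis (mono_tags) LeastI)
  have "\<bar>t - \<sigma> m\<bar> \<le> 2 * D + 1"
  proof (cases m)
    case 0
    have "\<sigma> 0 \<le> d (c (\<sigma> 0)) (c 0)" using c(2)[OF \<sigma>(1), of 0 0] \<sigma>(1)[of 0] by simp
    also have "\<dots> \<le> D" using \<sigma>(2)[of 0] \<alpha>(2) commute[of "c 0"] by simp
    finally show ?thesis using 0 m t D by simp
  next
    case (Suc l)
    then have "\<sigma> l < t" using not_less_Least[of l "\<lambda>n. t \<le> \<sigma> n"] by (simp add: m_def)
    then show ?thesis using step[of l] m Suc by simp
  qed
  then show ?thesis using close[of m] by (intro exI[of _ "real m"]) simp
qed

lemma (in bounded_length_region) quasigeodesics_with_common_limit: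
  assumes hyp: "gromov_hyperbolic W k" and A: "0 < A"
    and F: "homeomorphic_map (gromov_compactification W k) (top_of_set (closure W)) F" "\<And>x. x \<in> W \<Longrightarrow> F (Inl x) = x"
    and c: "\<And>s. 0 \<le> s \<Longrightarrow> c s \<in> W"
      "\<And>s t. 0 \<le> s \<Longrightarrow> 0 \<le> t \<Longrightarrow> \<bar>s - t\<bar> \<le> k (c s) (c t)"
      "\<And>s t. 0 \<le> s \<Longrightarrow> 0 \<le> t \<Longrightarrow> k (c s) (c t) \<le> A * \<bar>s - t\<bar>"
    and c': "\<And>s. 0 \<le> s \<Longrightarrow> c' s \<in> W"
      "\<And>s t. 0 \<le> s \<Longrightarrow> 0 \<le> t \<Longrightarrow> \<bar>s - t\<bar> \<le> k (c' s) (c' t)"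
      "\<And>s t. 0 \<le> s \<Longrightarrow> 0 \<le> t \<Longrightarrow> k (c' s) (c' t) \<le> A * \<bar>s - t\<bar>"
    and \<xi>: "(c \<longlongrightarrow> \<xi>) at_top" "(c' \<longlongrightarrow> \<xi>) at_top" "\<xi> \<notin> W"
  shows "\<exists>K. \<forall>t\<ge>0. \<exists>s\<ge>0. k (c t) (c' s) \<le> K"
proof -
  have cont: "continuous_map (gromov_compactification W k) (top_of_set (closure W)) F"
    using F(1) by (rule homeomorphic_imp_continuous_map)
  obtain \<alpha> D where \<alpha>: "geodesic_ray W k \<alpha>" "\<alpha> 0 = c 0" "F (Inr (asymptotic_rel W k `` {\<alpha>})) = \<xi>"
    "\<And>t. 0 \<le> t \<Longrightarrow> \<exists>s\<ge>0. k (\<alpha> t) (c s) \<le> D"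
    using quasigeodesic_near_ray[OF hyp less_imp_le[OF A] cont F(2) c \<xi>(1,3)] by blast
  obtain \<beta> E where \<beta>: "geodesic_ray W k \<beta>" "\<beta> 0 = c' 0" "F (Inr (asymptotic_rel W k `` {\<beta>})) = \<xi>"
    "\<And>t. 0 \<le> t \<Longrightarrow> \<exists>s\<ge>0. k (\<beta> t) (c' s) \<le> E"
    using quasigeodesic_near_ray[OF hyp less_imp_le[OF A] cont F(2) c' \<xi>(2,3)] by blast
  have top: "topspace (gromov_compactification W k) = W <+> gromov_boundary W k"
    by (rule topspace_gromov_compactification) unfold_locales
  have mem: "Inr (asymptotic_rel W k `` {\<alpha>}) \<in> topspace (gromov_compactification W k)"
    "Inr (asymptotic_rel W k `` {\<beta>}) \<in> topspace (gromov_compactification W k)"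
    unfolding top gromov_boundary_def using \<alpha>(1) \<beta>(1) by (auto intro!: InrI quotientI)
  have "asymptotic_rel W k `` {\<alpha>} = asymptotic_rel W k `` {\<beta>}"
    using homeomorphic_imp_injective_map[OF F(1)] mem \<alpha>(3) \<beta>(3) unfolding inj_on_def by (metis sum.inject(2))
  moreover have "equiv {\<gamma>. geodesic_ray W k \<gamma>} (asymptotic_rel W k)"
    by (rule equiv_asymptotic_rel) unfold_locales
  ultimately have "(\<alpha>, \<beta>) \<in> asymptotic_rel W k"
    using eq_equiv_class \<beta>(1) by fastforce
  then obtain L where L: "\<And>t. 0 \<le> t \<Longrightarrow> k (\<alpha> t) (\<beta> t) \<le> L"
    by (auto simp: asymptotic_rel_def bdd_above_def)
  have "\<exists>s\<ge>0. k (c t) (c' s) \<le> (A * (2 * D + 1) + D) + L + E" if t: "0 \<le> t" for t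
  proof -
    obtain u where u: "u \<ge> 0" "k (c t) (\<alpha> u) \<le> A * (2 * D + 1) + D"
      using quasigeodesic_covered_by_ray[OF \<alpha>(1,2) A c \<alpha>(4) t] by blast
    obtain s where s: "s \<ge> 0" "k (\<beta> u) (c' s) \<le> E" using \<beta>(4)[OF u(1)] by blast
    have "c t \<in> W" "\<alpha> u \<in> W" "\<beta> u \<in> W" "c' s \<in> W"
      using c(1) c'(1) \<alpha>(1) \<beta>(1) t u s by (auto simp: geodesic_ray_def)
    then have "k (c t) (c' s) \<le> k (c t) (\<alpha> u) + k (\<alpha> u) (\<beta> u) + k (\<beta> u) (c' s)"
      using triangle[of "c t" "\<alpha> u" "c' s"] triangle[of "\<alpha> u" "\<beta> u" "c' s"] by linarith
    then show ?thesis using u s L[OF u(1)] by (intro exI[of _ s]) auto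
  qed
  then show ?thesis by blast
qed

text \<open>The localization of the Kobayashi distance compares points at small distance only;
  subdividing a curve into short pieces extends the upper bound to all its pairs of points.\<close>

lemma (in Metric_space) Lipschitz_of_local:
  assumes c: "\<And>s. 0 \<le> s \<Longrightarrow> c s \<in> M" and \<eta>: "0 < \<eta>"
    and loc: "\<And>s t. 0 \<le> s \<Longrightarrow> s \<le> t \<Longrightarrow> t - s < \<eta> \<Longrightarrow> d (c s) (c t) \<le> A * (t - s)"
    and st: "0 \<le> s" "0 \<le> t"
  shows "d (c s) (c t) \<le> A * \<bar>s - t\<bar>"
proof -
  have main: "d (c s) (c t) \<le> A * (t - s)" if st: "0 \<le> s" "s \<le> t" for s t
  proof -
    obtain n :: nat where n: "(t - s) / \<eta> < n" using reals_Archimedean2 by blast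
    have "n > 0" using n st \<eta> by (cases n) (auto simp: divide_less_0_iff)
    define h where "h = (t - s) / n"
    have h: "0 \<le> h" "h < \<eta>" using n st \<eta> \<open>n > 0\<close> by (auto simp: h_def field_simps)
    have "d (c s) (c (s + real m * h)) \<le> A * (real m * h)" for m
    proof (induction m)
      case (Suc m)
      have nn: "0 \<le> s + real m * h" "0 \<le> s + real (Suc m) * h" using st h by auto
      have "d (c s) (c (s + real (Suc m) * h)) \<le> d (c s) (c (s + real m * h)) + d (c (s + real m * h)) (c (s + real (Suc m) * h))"
        by (rule triangle[OF c[OF st(1)] c[OF nn(1)] c[OF nn(2)]])
      also have "\<dots> \<le> A * (real m * h) + A * h"
        using loc[of "s + real m * h" "s + real (Suc m) * h"] nn h Suc by (simp add: algebra_simps)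
      finally show ?case by (simp add: algebra_simps)
    qed (use c st in auto)
    from this[of n] show ?thesis using \<open>n > 0\<close> by (simp add: h_def)
  qed
  show ?thesis
    using main[of s t] main[of t s] st commute[of "c s" "c t"] by (cases "s \<le> t") simp_all
qed

lemma bounded_length_region_kobayashi:
  fixes W :: "(complex ^ 'n) set"
  assumes dom: "complex_domain W" and bdd: "bounded W" and compl: "complete_kobayashi_hyperbolic W"
  obtains C where "bounded_length_region W (kobayashi_dist W) C"
proof -
  have hyp: "kobayashi_hyperbolic W" and op: "open W"
    using compl dom by (auto simp: complete_kobayashi_hyperbolic_def complex_domain_def)
  interpret Metric_space W "kobayashi_dist W"
    using hyp by (simp add: kobayashi_hyperbolic_def)
  obtain C where C: "C > 0" "\<And>x y. x \<in> W \<Longrightarrow> y \<in> W \<Longrightarrow> dist x y \<le> C * kobayashi_dist W x y"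
    using dist_le_kobayashi_dist[OF dom bdd] by metis
  have "bounded_length_region W (kobayashi_dist W) C"
  proof unfold_locales
    fix x y e assume xy: "x \<in> W" "y \<in> W" "kobayashi_dist W x y < e"
    obtain c L where "continuous_on {0..L} c" "c 0 = x" "c L = y" "\<And>s. s \<in> {0..L} \<Longrightarrow> c s \<in> W"
      "\<And>s t. s \<in> {0..L} \<Longrightarrow> t \<in> {0..L} \<Longrightarrow> kobayashi_dist W (c s) (c t) \<le> \<bar>s - t\<bar>"
      "kobayashi_dist W x y \<le> L" "0 \<le> L" "L < e"
      by (rule kobayashi_near_path[OF dom hyp xy]) blast
    then show "\<exists>L c. 0 \<le> L \<and> L < e \<and> c 0 = x \<and> c L = y \<and> (\<forall>s\<in>{0..L}. c s \<in> W) \<and>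
        (\<forall>s\<in>{0..L}. \<forall>t\<in>{0..L}. kobayashi_dist W (c s) (c t) \<le> \<bar>s - t\<bar>)"
      by blast
  qed (use C op bdd compl kobayashi_dist_tendsto[OF op hyp] in \<open>auto simp: complete_kobayashi_hyperbolic_def\<close>)
  then show ?thesis by (rule that)
qed

lemma geodesic_rays_bounded_distance:
  fixes \<Omega> :: "(complex ^ 'n) set"
  assumes loc: "local_gromov_model_domain \<Omega>" and emb: "hyperbolically_embedded \<Omega>" and \<xi>: "\<xi> \<in> frontier \<Omega>"
    and \<gamma>: "geodesic_ray \<Omega> (kobayashi_dist \<Omega>) \<gamma>" "(\<gamma> \<longlongrightarrow> \<xi>) at_top"
    and \<sigma>: "geodesic_ray \<Omega> (kobayashi_dist \<Omega>) \<sigma>" "(\<sigma> \<longlongrightarrow> \<xi>) at_top"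
  shows "\<exists>K. \<forall>t\<ge>0. kobayashi_dist \<Omega> (\<gamma> t) (\<sigma> t) \<le> K"
proof -
  have dom: "complex_domain \<Omega>" and hyp: "kobayashi_hyperbolic \<Omega>"
    using loc by (auto simp: local_gromov_model_domain_def)
  have op: "open \<Omega>" using dom by (simp add: complex_domain_def)
  interpret Metric_space \<Omega> "kobayashi_dist \<Omega>"
    using hyp by (simp add: kobayashi_hyperbolic_def)
  obtain U where U: "open U" "bounded U" "\<xi> \<in> U" "gromov_model (U \<inter> \<Omega>)"
    using loc \<xi> unfolding local_gromov_model_domain_def by blast
  define W where "W = U \<inter> \<Omega>"
  have compl: "complete_kobayashi_hyperbolic W" and ghyp: "gromov_hyperbolic W (kobayashi_dist W)"
    and hypW: "kobayashi_hyperbolic W" and conn: "connected W"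
    using U(4) by (auto simp: gromov_model_def W_def complete_kobayashi_hyperbolic_def)
  obtain F where F: "homeomorphic_map (gromov_compactification W (kobayashi_dist W)) (top_of_set (closure W)) F"
      "\<And>x. x \<in> W \<Longrightarrow> F (Inl x) = x"
    using U(4) unfolding gromov_model_def W_def by blast
  have \<xi>W: "\<xi> \<notin> W" using \<xi> op by (simp add: W_def frontier_def interior_open)
  have "\<xi> \<in> closure \<Omega>" using \<xi> by (simp add: frontier_def)
  then have "W \<noteq> {}" using U(1,3) open_Int_closure_eq_empty[of U \<Omega>] by (auto simp: W_def)
  then have domW: "complex_domain W"
    using conn op U(1) by (auto simp: complex_domain_def W_def)
  have bddW: "bounded W" using U(2) bounded_subset by (auto simp: W_def)
  obtain C where "bounded_length_region W (kobayashi_dist W) C"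
    using bounded_length_region_kobayashi[OF domW bddW compl] .
  then interpret W: bounded_length_region W "kobayashi_dist W" C .
  obtain A \<delta> \<eta> where A: "A > 0" "\<delta> > 0" "\<eta> > 0" and near:
    "\<And>x y. x \<in> \<Omega> \<Longrightarrow> dist \<xi> x < \<delta> \<Longrightarrow> y \<in> \<Omega> \<Longrightarrow> kobayashi_dist \<Omega> x y < \<eta> \<Longrightarrow>
       x \<in> U \<and> y \<in> U \<and> kobayashi_dist (U \<inter> \<Omega>) x y \<le> A * kobayashi_dist \<Omega> x y"
    using kobayashi_localization[OF dom hyp emb \<xi> U(1,3) hypW[unfolded W_def]] by blast
  have "\<forall>\<^sub>F t in at_top. dist \<xi> (\<gamma> t) < \<delta> \<and> dist \<xi> (\<sigma> t) < \<delta>"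
    using tendstoD[OF \<gamma>(2) A(2)] tendstoD[OF \<sigma>(2) A(2)] by eventually_elim (simp add: dist_commute)
  then obtain T' where T': "\<And>t. T' \<le> t \<Longrightarrow> dist \<xi> (\<gamma> t) < \<delta> \<and> dist \<xi> (\<sigma> t) < \<delta>"
    unfolding eventually_at_top_linorder by blast
  define T where "T = max 0 T'"
  \<comment> \<open>The lower bound is the monotonicity of the Kobayashi distance under
    \<open>W \<subseteq> \<Omega>\<close>. The upper bound is the local comparison, made global by
    \<open>Lipschitz_of_local\<close>.\<close>
  have quasi: "(\<forall>s\<ge>0. \<rho> (T + s) \<in> W) \<and> (\<forall>s\<ge>0. \<forall>t\<ge>0. \<bar>s - t\<bar> \<le> kobayashi_dist W (\<rho> (T + s)) (\<rho> (T + t))) \<and>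
      (\<forall>s\<ge>0. \<forall>t\<ge>0. kobayashi_dist W (\<rho> (T + s)) (\<rho> (T + t)) \<le> A * \<bar>s - t\<bar>) \<and> ((\<lambda>t. \<rho> (T + t)) \<longlongrightarrow> \<xi>) at_top"
    if \<rho>: "geodesic_ray \<Omega> (kobayashi_dist \<Omega>) \<rho>" "(\<rho> \<longlongrightarrow> \<xi>) at_top" "\<And>t. T \<le> t \<Longrightarrow> dist \<xi> (\<rho> t) < \<delta>" for \<rho>
  proof -
    have T0: "0 \<le> T" by (simp add: T_def)
    have ray: "\<rho> (T + s) \<in> \<Omega>" "kobayashi_dist \<Omega> (\<rho> (T + s)) (\<rho> (T + t)) = \<bar>s - t\<bar>" if "0 \<le> s" "0 \<le> t" for s t
      using \<rho>(1) that T0 unfolding geodesic_ray_def by auto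
    have loc': "\<rho> (T + s) \<in> W \<and> kobayashi_dist W (\<rho> (T + s)) (\<rho> (T + t)) \<le> A * (t - s)"
      if "0 \<le> s" "s \<le> t" "t - s < \<eta>" for s t
      using near[of "\<rho> (T + s)" "\<rho> (T + t)"] ray(1)[of s s] ray(1)[of t t] ray(2)[of s t] \<rho>(3)[of "T + s"] that
      by (auto simp: W_def)
    have mem: "\<rho> (T + s) \<in> W" if "0 \<le> s" for s using loc'[of s s] that A by simp
    have up: "kobayashi_dist W (\<rho> (T + s)) (\<rho> (T + t)) \<le> A * \<bar>s - t\<bar>" if "0 \<le> s" "0 \<le> t" for s t
      by (rule W.Lipschitz_of_local[where c = "\<lambda>s. \<rho> (T + s)", OF mem A(3) _ that]) (use loc' in auto)
    have low: "\<bar>s - t\<bar> \<le> kobayashi_dist W (\<rho> (T + s)) (\<rho> (T + t))" if "0 \<le> s" "0 \<le> t" for s t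
      using kobayashi_dist_mono[OF domW _ hyp mem mem, of s t] ray(2)[OF that] that by (simp add: W_def)
    have "((\<lambda>t. \<rho> (T + t)) \<longlongrightarrow> \<xi>) at_top"
      by (rule filterlim_compose[OF \<rho>(2)]) (rule filterlim_tendsto_add_at_top[OF tendsto_const filterlim_ident])
    then show ?thesis using mem up low by blast
  qed
  note q\<gamma> = quasi[OF \<gamma>] and q\<sigma> = quasi[OF \<sigma>]
  have TT: "\<And>t. T \<le> t \<Longrightarrow> dist \<xi> (\<gamma> t) < \<delta>" "\<And>t. T \<le> t \<Longrightarrow> dist \<xi> (\<sigma> t) < \<delta>"
    using T' by (auto simp: T_def)
  note q\<gamma> = q\<gamma>[OF TT(1)] and q\<sigma> = q\<sigma>[OF TT(2)]
  have "\<exists>K. \<forall>t\<ge>0. \<exists>s\<ge>0. kobayashi_dist W (\<gamma> (T + t)) (\<sigma> (T + s)) \<le> K"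
    by (rule W.quasigeodesics_with_common_limit[OF ghyp A(1) F, of "\<lambda>t. \<gamma> (T + t)" "\<lambda>t. \<sigma> (T + t)" \<xi>])
      (use q\<gamma> q\<sigma> \<xi>W in simp_all)
  then obtain K where K: "\<And>t. 0 \<le> t \<Longrightarrow> \<exists>s\<ge>0. kobayashi_dist W (\<gamma> (T + t)) (\<sigma> (T + s)) \<le> K"
    by blast
  have T0: "0 \<le> T" by (simp add: T_def)
  define e where "e = kobayashi_dist \<Omega> (\<gamma> 0) (\<sigma> 0)"
  have \<gamma>\<Omega>: "\<gamma> t \<in> \<Omega>" and \<sigma>\<Omega>: "\<sigma> t \<in> \<Omega>" if "0 \<le> t" for t
    using \<gamma>(1) \<sigma>(1) that by (auto simp: geodesic_ray_def)
  have d\<gamma>: "kobayashi_dist \<Omega> (\<gamma> s) (\<gamma> t) = \<bar>s - t\<bar>" and d\<sigma>: "kobayashi_dist \<Omega> (\<sigma> s) (\<sigma> t) = \<bar>s - t\<bar>"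
    if "0 \<le> s" "0 \<le> t" for s t
    using \<gamma>(1) \<sigma>(1) that by (auto simp: geodesic_ray_def)
  have K0: "0 \<le> K" using K[of 0] W.nonneg order_trans by blast
  \<comment> \<open>The point \<open>\<sigma> v\<close> near \<open>\<gamma> t\<close> may have a
    different time, but measuring both from the starting points of the rays gives
    \<open>\<bar>v - t\<bar> \<le> K + e\<close>. Times before \<open>T\<close> are covered by
    \<open>2 * T + e\<close>.\<close>
  have "kobayashi_dist \<Omega> (\<gamma> t) (\<sigma> t) \<le> 2 * K + 2 * T + e" if t: "0 \<le> t" for t
  proof (cases "T \<le> t")
    case True
    obtain s where s: "s \<ge> 0" "kobayashi_dist W (\<gamma> (T + (t - T))) (\<sigma> (T + s)) \<le> K"
      using K[of "t - T"] True by auto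
    define v where "v = T + s"
    have v: "0 \<le> v" using s T0 by (simp add: v_def)
    have "\<gamma> t \<in> W" "\<sigma> v \<in> W" using q\<gamma> q\<sigma> s True by (auto simp: v_def dest!: spec[of _ "t - T"])
    then have dK: "kobayashi_dist \<Omega> (\<gamma> t) (\<sigma> v) \<le> K"
      using kobayashi_dist_mono[OF domW _ hyp, of "\<gamma> t" "\<sigma> v"] s(2) by (simp add: W_def v_def)
    have "v \<le> K + t + e"
      using triangle[of "\<sigma> v" "\<gamma> t" "\<sigma> 0"] triangle[of "\<gamma> t" "\<gamma> 0" "\<sigma> 0"] \<gamma>\<Omega> \<sigma>\<Omega> t v
        d\<sigma>[of v 0] d\<gamma>[of t 0] dK commute[of "\<sigma> v" "\<gamma> t"] by (simp add: e_def)
    moreover have "t \<le> K + v + e"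
      using triangle[of "\<gamma> t" "\<sigma> v" "\<gamma> 0"] triangle[of "\<sigma> v" "\<sigma> 0" "\<gamma> 0"] \<gamma>\<Omega> \<sigma>\<Omega> t v
        d\<sigma>[of v 0] d\<gamma>[of t 0] dK commute[of "\<sigma> 0" "\<gamma> 0"] by (simp add: e_def)
    ultimately have "\<bar>v - t\<bar> \<le> K + e" by simp
    then show ?thesis
      using triangle[of "\<gamma> t" "\<sigma> v" "\<sigma> t"] \<gamma>\<Omega> \<sigma>\<Omega> t v d\<sigma>[OF v t] dK T0 by simp
  next
    case False
    then show ?thesis
      using triangle[of "\<gamma> t" "\<gamma> 0" "\<sigma> t"] triangle[of "\<gamma> 0" "\<sigma> 0" "\<sigma> t"] \<gamma>\<Omega> \<sigma>\<Omega> t d\<gamma>[of t 0] d\<sigma>[of 0 t] K0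
      by (simp add: e_def)
  qed
  then show ?thesis by blast
qed

section \<open>Rado's theorem\<close>

lemma open_nonzero_set:
  assumes "continuous_on (cball c \<rho>) (g :: complex \<Rightarrow> complex)"
  shows "open {z \<in> ball c \<rho>. g z \<noteq> 0}"
proof -
  have "continuous_on (ball c \<rho>) g"
    using assms continuous_on_subset ball_subset_cball by blast
  then have "open (ball c \<rho> \<inter> g -` (- {0}))"
    by (intro continuous_open_preimage) auto
  moreover have "ball c \<rho> \<inter> g -` (- {0}) = {z \<in> ball c \<rho>. g z \<noteq> 0}"
    by auto
  ultimately show ?thesis by simp
qed

text \<open>The maximum principle for \<open>g * q ^ n\<close>, which vanishes on the zeros of \<open>g\<close>, with \<open>n \<rightarrow> \<infinity>\<close>.\<close>

lemma maximum_modulus_off_zeros: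
  fixes g q :: "complex \<Rightarrow> complex" and c :: complex and \<rho> :: real
  defines "S \<equiv> {z \<in> ball c \<rho>. g z \<noteq> 0}"
  assumes g: "continuous_on (cball c \<rho>) g" "g holomorphic_on S"
    and q: "continuous_on (closure S) q" "q holomorphic_on S"
    and M: "0 \<le> M" "\<And>z. z \<in> closure S \<Longrightarrow> z \<in> sphere c \<rho> \<Longrightarrow> cmod (q z) \<le> M"
    and \<alpha>: "\<alpha> \<in> S"
  shows "cmod (q \<alpha>) \<le> M"
proof (rule ccontr)
  assume "\<not> cmod (q \<alpha>) \<le> M"
  \<comment> \<open>Comparison with \<open>s\<close>, which is positive, makes the ratio meaningful
    even when \<open>M = 0\<close>.\<close>
  then obtain s where s: "M < s" "s < cmod (q \<alpha>)"
    using dense not_le by blast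
  have op: "open S"
    unfolding S_def by (rule open_nonzero_set[OF g(1)])
  have "S \<subseteq> cball c \<rho>" by (auto simp: S_def)
  then have clS: "closure S \<subseteq> cball c \<rho>"
    by (simp add: closure_minimal)
  have "compact (g ` cball c \<rho>)"
    using g(1) by (intro compact_continuous_image) auto
  then obtain N where N: "N > 0" "\<And>z. z \<in> cball c \<rho> \<Longrightarrow> cmod (g z) \<le> N"
    by (metis bounded_pos compact_imp_bounded imageI)
  have bound: "cmod (g \<alpha> * q \<alpha> ^ n) \<le> N * M ^ n" for n
  proof (rule maximum_modulus_frontier[of "\<lambda>z. g z * q z ^ n" S])
    show "(\<lambda>z. g z * q z ^ n) holomorphic_on interior S"
      using g q op by (auto simp: interior_open intro!: holomorphic_intros)
    show "continuous_on (closure S) (\<lambda>z. g z * q z ^ n)"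
      using q(1) continuous_on_subset[OF g(1) clS] by (intro continuous_intros)
    show "bounded S"
      by (rule bounded_subset[OF bounded_ball[of c \<rho>]]) (auto simp: S_def)
    fix z assume z: "z \<in> frontier S"
    then have z': "z \<in> closure S" "z \<notin> S"
      using op by (auto simp: frontier_def interior_open)
    then consider "z \<in> sphere c \<rho>" | "g z = 0"
      using clS by (auto simp: S_def)
    then show "cmod (g z * q z ^ n) \<le> N * M ^ n"
    proof cases
      case 1
      then show ?thesis
        using N z' clS M by (auto simp: norm_mult norm_power intro!: mult_mono power_mono)
    next
      case 2
      then show ?thesis using N M by simp
    qed
  qed (use \<alpha> in auto)
  have g\<alpha>: "cmod (g \<alpha>) > 0"
    using \<alpha> by (simp add: S_def)
  have "s > 0" using s M by linarith
  then have "1 < cmod (q \<alpha>) / s" using s by simp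
  then obtain n where n: "N / cmod (g \<alpha>) < (cmod (q \<alpha>) / s) ^ n"
    using real_arch_pow by blast
  have "cmod (g \<alpha>) * cmod (q \<alpha>) ^ n \<le> N * M ^ n"
    using bound[of n] by (simp add: norm_mult norm_power)
  also have "\<dots> \<le> N * s ^ n"
    using N s M by (intro mult_left_mono power_mono) auto
  finally have "(cmod (q \<alpha>) / s) ^ n \<le> N / cmod (g \<alpha>)"
    using g\<alpha> \<open>s > 0\<close> by (simp add: power_divide field_simps)
  then show False using n by simp
qed

text \<open>For \<open>\<beta>\<close> in the ball outside \<open>closure S\<close>, the maximum
  principle for \<open>1 / (z - \<beta>)\<close> shows that no point of \<open>S\<close> is nearer
  to \<open>\<beta>\<close> than the circle is. Close to a relative boundary point of
  \<open>closure S\<close> this is impossible, so \<open>closure S\<close> is both open and closed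
  in the ball.\<close>

lemma nonzero_set_dense:
  fixes g :: "complex \<Rightarrow> complex" and c :: complex and \<rho> :: real
  defines "S \<equiv> {z \<in> ball c \<rho>. g z \<noteq> 0}"
  assumes g: "continuous_on (cball c \<rho>) g" "g holomorphic_on S" and ne: "S \<noteq> {}"
  shows "ball c \<rho> \<subseteq> closure S"
proof -
  have far: "\<rho> - dist c \<beta> \<le> dist \<alpha> \<beta>" if \<beta>: "\<beta> \<in> ball c \<rho>" "\<beta> \<notin> closure S" and \<alpha>: "\<alpha> \<in> S" for \<alpha> \<beta>
  proof -
    have pos: "0 < \<rho> - dist c \<beta>" using \<beta> by simp
    have "\<alpha> \<noteq> \<beta>" using \<alpha> \<beta> closure_subset by blast
    have "cmod (1 / (\<alpha> - \<beta>)) \<le> 1 / (\<rho> - dist c \<beta>)"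
    proof (rule maximum_modulus_off_zeros[of c \<rho> g "\<lambda>z. 1 / (z - \<beta>)", folded S_def, OF g])
      show "continuous_on (closure S) (\<lambda>z. 1 / (z - \<beta>))"
        using \<beta> by (intro continuous_intros) auto
      show "(\<lambda>z. 1 / (z - \<beta>)) holomorphic_on S"
        using \<beta> closure_subset by (intro holomorphic_intros) auto
      show "cmod (1 / (z - \<beta>)) \<le> 1 / (\<rho> - dist c \<beta>)" if "z \<in> sphere c \<rho>" for z
      proof -
        have "\<rho> - dist c \<beta> \<le> cmod (z - \<beta>)"
          using that dist_triangle[of c z \<beta>] by (simp add: dist_norm norm_minus_commute)
        then show ?thesis
          using pos by (simp add: norm_divide frac_le)
      qed
    qed (use pos \<alpha> in auto)
    then show ?thesis
      using pos \<open>\<alpha> \<noteq> \<beta>\<close> by (simp add: norm_divide dist_norm field_simps)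
  qed
  have int: "z \<in> interior (closure S)" if z: "z \<in> ball c \<rho>" "z \<in> closure S" for z
  proof -
    \<comment> \<open>With half the distance from \<open>z\<close> to the circle, a point
      \<open>w\<close> of \<open>ball z r\<close> is more than \<open>r\<close> away from the
      circle. If \<open>w\<close> were outside \<open>closure S\<close>, a point of \<open>S\<close>
      near \<open>z\<close> would nevertheless be closer than \<open>r\<close> to it.\<close>
    define r where "r = (\<rho> - dist c z) / 2"
    have r: "r > 0" using z by (simp add: r_def)
    have "ball z r \<subseteq> closure S"
    proof (rule ccontr)
      assume "\<not> ball z r \<subseteq> closure S"
      then obtain w where w: "w \<in> ball z r" "w \<notin> closure S" by blast
      have cw: "dist c w \<le> dist c z + dist z w" by (rule dist_triangle)
      have w': "w \<in> ball c \<rho>" using w r cw by (simp add: r_def field_simps)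
      have "0 < r - dist z w" using w by simp
      then obtain \<alpha> where \<alpha>: "\<alpha> \<in> S" "dist \<alpha> z < r - dist z w"
        using z(2) unfolding closure_approachable by blast
      have "\<rho> - dist c w \<le> dist \<alpha> w" by (rule far[OF w' w(2) \<alpha>(1)])
      moreover have "dist \<alpha> w \<le> dist \<alpha> z + dist z w" by (rule dist_triangle)
      ultimately show False using \<alpha>(2) w cw by (simp add: r_def field_simps)
    qed
    then show ?thesis using r by (meson centre_in_ball interior_maximal open_ball subsetD)
  qed
  have "(ball c \<rho> - closure S) \<inter> ball c \<rho> = {} \<or> interior (closure S) \<inter> ball c \<rho> = {}"
  proof (rule connectedD[OF connected_ball])
    show "(ball c \<rho> - closure S) \<inter> interior (closure S) \<inter> ball c \<rho> = {}"
      using interior_subset by blast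
  qed (use int in auto)
  moreover obtain \<alpha> where "\<alpha> \<in> S" "\<alpha> \<in> ball c \<rho>"
    using ne by (auto simp: S_def)
  ultimately show ?thesis
    using int closure_subset by blast
qed

text \<open>On the unit circle \<open>cnj z\<close> is the inverse of \<open>z\<close>, so a real
  polynomial becomes a Laurent polynomial; the factor \<open>z ^ N\<close> clears its negative
  powers.\<close>

lemma real_polynomial_function_on_circle:
  fixes p :: "complex \<Rightarrow> real"
  assumes "real_polynomial_function p"
  shows "\<exists>N R. \<forall>z. cmod z = 1 \<longrightarrow> of_real (p z) * z ^ N = poly R z"
  using assms
proof induction
  case (linear f)
  interpret bounded_linear f by fact
  define a b where "a = complex_of_real (f 1)" and "b = complex_of_real (f \<i>)"
  have "of_real (f z) * z ^ 1 = poly [:(a + \<i> * b) / 2, 0, (a - \<i> * b) / 2:] z" if "cmod z = 1" for z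
  proof -
    have "f z = f (Re z *\<^sub>R 1 + Im z *\<^sub>R \<i>)"
      by (rule arg_cong[of _ _ f]) (simp add: complex_eq_iff)
    then have fz: "complex_of_real (f z) = Re z * a + Im z * b"
      by (simp add: add scale a_def b_def)
    have zz: "z * cnj z = 1"
      using that by (simp add: complex_norm_square[symmetric])
    have "complex_of_real (f z) = (a - \<i> * b) / 2 * z + (a + \<i> * b) / 2 * cnj z"
      unfolding fz by (simp add: complex_eq_iff a_def b_def field_simps)
    then have "of_real (f z) * z = (a - \<i> * b) / 2 * z * z + (a + \<i> * b) / 2 * (z * cnj z)"
      by (simp add: algebra_simps)
    then show ?thesis
      unfolding zz by (simp add: algebra_simps)
  qed
  then show ?case by blast
next
  case (const c)
  have "of_real c * z ^ 0 = poly [:of_real c:] z" for z :: complex by simp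
  then show ?case by blast
next
  case (add f g)
  then obtain N1 R1 N2 R2 where
    R1: "\<And>z. cmod z = 1 \<Longrightarrow> of_real (f z) * z ^ N1 = poly R1 z" and
    R2: "\<And>z. cmod z = 1 \<Longrightarrow> of_real (g z) * z ^ N2 = poly R2 z"
    by blast
  have "of_real (f z + g z) * z ^ (N1 + N2) = poly (R1 * monom 1 N2 + R2 * monom 1 N1) z" if "cmod z = 1" for z
    using R1[OF that, symmetric] R2[OF that, symmetric] by (simp add: poly_monom power_add algebra_simps)
  then show ?case by blast
next
  case (mult f g)
  then obtain N1 R1 N2 R2 where
    R1: "\<And>z. cmod z = 1 \<Longrightarrow> of_real (f z) * z ^ N1 = poly R1 z" and
    R2: "\<And>z. cmod z = 1 \<Longrightarrow> of_real (g z) * z ^ N2 = poly R2 z"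
    by blast
  have "of_real (f z * g z) * z ^ (N1 + N2) = poly (R1 * R2) z" if "cmod z = 1" for z
    using R1[OF that, symmetric] R2[OF that, symmetric] by (simp add: power_add algebra_simps)
  then show ?case by blast
qed

text \<open>An approximate solution of the Dirichlet problem: Stone-Weierstrass replaces the
  boundary values by a polynomial, and the real part of a Laurent polynomial is on the circle the
  real part of an ordinary one.\<close>

lemma circle_real_part_approximation:
  fixes f :: "complex \<Rightarrow> real"
  assumes "continuous_on (sphere 0 1) f" "e > 0"
  obtains P where "P holomorphic_on UNIV" "\<And>z. z \<in> sphere 0 1 \<Longrightarrow> \<bar>f z - Re (P z)\<bar> < e"
proof -
  obtain p where p: "real_polynomial_function p" "\<And>z. z \<in> sphere 0 1 \<Longrightarrow> \<bar>f z - p z\<bar> < e"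
    using Stone_Weierstrass_real_polynomial_function[OF compact_sphere assms] by blast
  obtain N R where R: "\<And>z. cmod z = 1 \<Longrightarrow> of_real (p z) * z ^ N = poly R z"
    using real_polynomial_function_on_circle[OF p(1)] by blast
  \<comment> \<open>On the circle a negative power of \<open>z\<close> is a power of
    \<open>cnj z\<close>. Conjugating such a term, coefficient included, makes it holomorphic and
    keeps its real part.\<close>
  define P where "P z = (\<Sum>k\<le>degree R. if N \<le> k then coeff R k * z ^ (k - N) else cnj (coeff R k) * z ^ (N - k))" for z
  have "P holomorphic_on UNIV"
    unfolding P_def
  proof (rule holomorphic_on_sum)
    fix k
    show "(\<lambda>z. if N \<le> k then coeff R k * z ^ (k - N) else cnj (coeff R k) * z ^ (N - k)) holomorphic_on UNIV"
      by (cases "N \<le> k") (auto intro!: holomorphic_intros)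
  qed
  moreover have "p z = Re (P z)" if z: "cmod z = 1" for z
  proof -
    have zz: "z * cnj z = 1"
      using z by (simp add: complex_norm_square[symmetric])
    have "complex_of_real (p z) = of_real (p z) * (z * cnj z) ^ N"
      unfolding zz by simp
    also have "\<dots> = poly R z * cnj z ^ N"
      using R[OF z] by (simp add: power_mult_distrib mult.assoc)
    also have "\<dots> = (\<Sum>k\<le>degree R. coeff R k * z ^ k * cnj z ^ N)"
      by (simp add: poly_altdef sum_distrib_right)
    finally have "p z = (\<Sum>k\<le>degree R. Re (coeff R k * z ^ k * cnj z ^ N))"
      by (metis Re_complex_of_real Re_sum)
    also have "\<dots> = (\<Sum>k\<le>degree R. Re (if N \<le> k then coeff R k * z ^ (k - N) else cnj (coeff R k) * z ^ (N - k)))"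
    proof (rule sum.cong[OF refl])
      fix k
      show "Re (coeff R k * z ^ k * cnj z ^ N) =
          Re (if N \<le> k then coeff R k * z ^ (k - N) else cnj (coeff R k) * z ^ (N - k))"
      proof (cases "N \<le> k")
        case True
        then have "z ^ k * cnj z ^ N = z ^ (k - N) * (z * cnj z) ^ N"
          by (simp add: power_mult_distrib mult.assoc[symmetric] power_add[symmetric])
        then show ?thesis using True zz by (simp add: mult.assoc)
      next
        case False
        then have "cnj z ^ N = cnj z ^ k * cnj z ^ (N - k)"
          by (simp add: power_add[symmetric])
        then have "z ^ k * cnj z ^ N = (z * cnj z) ^ k * cnj z ^ (N - k)"
          by (simp add: power_mult_distrib mult.assoc)
        then have "coeff R k * z ^ k * cnj z ^ N = cnj (cnj (coeff R k) * z ^ (N - k))"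
          unfolding zz by (simp add: mult.assoc)
        then have "Re (coeff R k * z ^ k * cnj z ^ N) = Re (cnj (coeff R k) * z ^ (N - k))"
          by (simp only: cnj.simps)
        then show ?thesis using False by simp
      qed
    qed
    finally show ?thesis
      by (simp add: P_def)
  qed
  ultimately show ?thesis
    using that[of P] p(2) by auto
qed

lemma sphere_real_part_approximation:
  fixes f :: "complex \<Rightarrow> real"
  assumes \<rho>: "\<rho> > 0" and f: "continuous_on (sphere c \<rho>) f" and e: "e > 0"
  obtains P where "P holomorphic_on UNIV" "\<And>z. z \<in> sphere c \<rho> \<Longrightarrow> \<bar>f z - Re (P z)\<bar> < e"
proof -
  have img: "(\<lambda>z. c + of_real \<rho> * z) ` sphere 0 1 \<subseteq> sphere c \<rho>"
    using \<rho> by (auto simp: dist_norm norm_mult)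
  have "continuous_on (sphere 0 1) (\<lambda>z. f (c + of_real \<rho> * z))"
    by (rule continuous_on_compose2[OF f _ img]) (intro continuous_intros)
  then obtain P where P: "P holomorphic_on UNIV"
      "\<And>z. z \<in> sphere 0 1 \<Longrightarrow> \<bar>f (c + of_real \<rho> * z) - Re (P z)\<bar> < e"
    using circle_real_part_approximation e by blast
  have "(\<lambda>z. (z - c) / of_real \<rho>) holomorphic_on UNIV"
    using \<rho> by (intro holomorphic_intros) auto
  then have "(\<lambda>z. P ((z - c) / of_real \<rho>)) holomorphic_on UNIV"
    using holomorphic_on_compose_gen[of "\<lambda>z. (z - c) / of_real \<rho>" UNIV P UNIV] P(1)
    by (simp add: comp_def)
  moreover have "\<bar>f z - Re (P ((z - c) / of_real \<rho>))\<bar> < e" if "z \<in> sphere c \<rho>" for z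
  proof -
    have "(z - c) / of_real \<rho> \<in> sphere 0 1"
      using that \<rho> by (simp add: norm_divide dist_norm norm_minus_commute)
    from P(2)[OF this] show ?thesis using \<rho> by simp
  qed
  ultimately show ?thesis using that by blast
qed

text \<open>The maximum principle for \<open>exp\<close> of \<open>h - P n\<close> and of its
  negative carries the approximation of the real part from the circle to \<open>S\<close>, and
  density carries it to the ball. The imaginary parts of the \<open>P n\<close> are not controlled,
  so the normal family consists of the functions \<open>exp (P n)\<close>; the limit is free of
  zeros and \<open>F\<close> is a logarithm of it.\<close>

lemma real_part_holomorphic_off_zeros:
  fixes g h :: "complex \<Rightarrow> complex" and c :: complex and \<rho> :: real
  defines "S \<equiv> {z \<in> ball c \<rho>. g z \<noteq> 0}"
  assumes g: "continuous_on (cball c \<rho>) g" "g holomorphic_on S" and ne: "S \<noteq> {}"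
    and h: "continuous_on (cball c \<rho>) h" "h holomorphic_on S"
  obtains F where "F holomorphic_on ball c \<rho>" "\<And>z. z \<in> ball c \<rho> \<Longrightarrow> Re (F z) = Re (h z)"
proof -
  have \<rho>: "\<rho> > 0"
    using ne by (auto simp: S_def dest: order.strict_trans1[OF zero_le_dist])
  have clS: "closure S \<subseteq> cball c \<rho>"
    by (rule closure_minimal) (auto simp: S_def)
  have dense: "ball c \<rho> \<subseteq> closure S"
    using nonzero_set_dense[of c \<rho> g, folded S_def] g ne by blast
  have "continuous_on (sphere c \<rho>) (\<lambda>z. Re (h z))"
    by (intro continuous_intros continuous_on_subset[OF h(1)]) auto
  then have "\<exists>P. P holomorphic_on UNIV \<and> (\<forall>z\<in>sphere c \<rho>. \<bar>Re (h z) - Re (P z)\<bar> < 1 / Suc n)" for n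
    using sphere_real_part_approximation[OF \<rho>, where f = "\<lambda>z. Re (h z)" and e = "1 / Suc n"] by (metis of_nat_0_less_iff zero_less_Suc zero_less_divide_1_iff)
  then obtain P where P: "\<And>n. P n holomorphic_on UNIV"
      "\<And>n z. z \<in> sphere c \<rho> \<Longrightarrow> \<bar>Re (h z) - Re (P n z)\<bar> < 1 / Suc n"
    by metis
  have Pcont: "continuous_on T (P n)" for n T
    using P(1) holomorphic_on_imp_continuous_on continuous_on_subset by blast
  have onesided: "k * (Re (h z) - Re (P n z)) \<le> 1 / Suc n" if z: "z \<in> S" and k: "\<bar>k\<bar> = 1" for z n k
  proof -
    have "cmod (exp (of_real k * (h z - P n z))) \<le> exp (1 / Suc n)"
    proof (rule maximum_modulus_off_zeros[of c \<rho> g "\<lambda>z. exp (of_real k * (h z - P n z))", folded S_def, OF g])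
      show "continuous_on (closure S) (\<lambda>z. exp (of_real k * (h z - P n z)))"
        by (intro continuous_intros Pcont continuous_on_subset[OF h(1) clS])
      show "(\<lambda>z. exp (of_real k * (h z - P n z))) holomorphic_on S"
        by (intro holomorphic_intros h(2) holomorphic_on_subset[OF P(1)]) auto
      fix w assume "w \<in> sphere c \<rho>"
      then have "k * (Re (h w) - Re (P n w)) \<le> 1 / Suc n"
        using P(2)[of w n] k by (smt (verit) mult_cancel_right1 mult_minus_left)
      then show "cmod (exp (of_real k * (h w - P n w))) \<le> exp (1 / Suc n)"
        by simp
    qed (use z in auto)
    then show ?thesis by simp
  qed
  have close: "\<bar>Re (h z) - Re (P n z)\<bar> \<le> 1 / Suc n" if z: "z \<in> closure S" for z n
  proof (rule continuous_le_on_closure[OF _ z])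
    show "continuous_on (closure S) (\<lambda>z. \<bar>Re (h z) - Re (P n z)\<bar>)"
      by (intro continuous_intros Pcont continuous_on_subset[OF h(1) clS])
    show "\<bar>Re (h z) - Re (P n z)\<bar> \<le> 1 / Suc n" if "z \<in> S" for z
      using onesided[OF that, of 1 n] onesided[OF that, of "-1" n] by simp
  qed
  have conv: "(\<lambda>n. Re (P n z)) \<longlonglongrightarrow> Re (h z)" if z: "z \<in> ball c \<rho>" for z
  proof -
    have "(\<lambda>n. Re (P n z) - Re (h z)) \<longlonglongrightarrow> 0"
    proof (rule Lim_null_comparison)
      show "\<forall>\<^sub>F n in sequentially. norm (Re (P n z) - Re (h z)) \<le> 1 / Suc n"
        using close z dense by (intro always_eventually) (simp add: abs_minus_commute subset_iff)
      show "(\<lambda>n. 1 / real (Suc n)) \<longlonglongrightarrow> 0"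
        using LIMSEQ_inverse_real_of_nat by (simp add: inverse_eq_divide)
    qed
    then show ?thesis by (simp add: LIM_zero_iff)
  qed
  have "compact (h ` cball c \<rho>)"
    using h(1) by (intro compact_continuous_image) auto
  then obtain B where B: "\<And>z. z \<in> cball c \<rho> \<Longrightarrow> cmod (h z) \<le> B"
    by (metis bounded_pos compact_imp_bounded imageI)
  define \<H> where "\<H> = {f. f holomorphic_on ball c \<rho> \<and> (\<forall>z\<in>ball c \<rho>. cmod (f z) \<le> exp (B + 1))}"
  have bd: "cmod (exp (P n z)) \<le> exp (B + 1)" if z: "z \<in> ball c \<rho>" for n z
  proof -
    have "Re (P n z) \<le> Re (h z) + 1 / Suc n"
      using close[of z n] z dense by (simp add: subset_iff abs_le_iff)
    also have "\<dots> \<le> B + 1"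
      using B[of z] z complex_Re_le_cmod[of "h z"] by (intro add_mono) (auto simp: divide_simps)
    finally show ?thesis by simp
  qed
  obtain E r where E: "E holomorphic_on ball c \<rho>" "strict_mono (r :: nat \<Rightarrow> nat)"
      "\<And>z. z \<in> ball c \<rho> \<Longrightarrow> (\<lambda>n. exp (P (r n) z)) \<longlonglongrightarrow> E z"
  proof (rule Montel[of "ball c \<rho>" \<H> "\<lambda>n z. exp (P n z)"])
    show "\<exists>B. \<forall>h\<in>\<H>. \<forall>z\<in>K. cmod (h z) \<le> B" if "K \<subseteq> ball c \<rho>" for K
      using that by (intro exI[of _ "exp (B + 1)"]) (auto simp: \<H>_def)
    show "range (\<lambda>n z. exp (P n z)) \<subseteq> \<H>"
      using bd by (auto simp: \<H>_def intro!: holomorphic_intros holomorphic_on_subset[OF P(1)])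
  qed (auto simp: \<H>_def)
  have normE: "cmod (E z) = exp (Re (h z))" if z: "z \<in> ball c \<rho>" for z
  proof (rule LIMSEQ_unique)
    show "(\<lambda>n. cmod (exp (P (r n) z))) \<longlonglongrightarrow> cmod (E z)"
      by (intro tendsto_norm E z)
    have "(\<lambda>n. Re (P (r n) z)) \<longlonglongrightarrow> Re (h z)"
      using LIMSEQ_subseq_LIMSEQ[OF conv[OF z] E(2)] by (simp add: comp_def)
    then show "(\<lambda>n. cmod (exp (P (r n) z))) \<longlonglongrightarrow> exp (Re (h z))"
      by (simp add: tendsto_exp)
  qed
  have "\<And>z. z \<in> ball c \<rho> \<Longrightarrow> E z \<noteq> 0"
    using normE by (metis exp_not_eq_zero norm_zero)
  then obtain F where F: "F holomorphic_on ball c \<rho>" "\<And>z. z \<in> ball c \<rho> \<Longrightarrow> E z = exp (F z)"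
    using contractible_imp_holomorphic_log[OF E(1)] convex_imp_contractible[OF convex_ball] by metis
  have "Re (F z) = Re (h z)" if "z \<in> ball c \<rho>" for z
    using normE[OF that] F(2)[OF that] by simp
  then show ?thesis using that F(1) by blast
qed

lemma deriv_eq_0_if_Re_eq_0:
  assumes f: "f holomorphic_on S" "open S" and Re: "\<And>z. z \<in> S \<Longrightarrow> Re (f z) = 0" and z: "z \<in> S"
  shows "deriv f z = 0"
proof -
  obtain r where r: "r > 0" "ball z r \<subseteq> S"
    using f(2) z openE by blast
  have "f constant_on ball z r"
  proof (rule ccontr)
    assume "\<not> f constant_on ball z r"
    then have "open (f ` ball z r)"
      using f(1) r(2) holomorphic_on_subset by (intro open_mapping_thm[of f "ball z r"]) auto
    moreover have "f z \<in> f ` ball z r" using r by simp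
    ultimately obtain e where e: "e > 0" "ball (f z) e \<subseteq> f ` ball z r"
      using openE by blast
    have "f z + of_real (e / 2) \<in> ball (f z) e"
      using e by (simp add: dist_norm)
    then obtain w where "w \<in> ball z r" "f w = f z + of_real (e / 2)"
      using e by (metis imageE subsetD)
    then show False
      using Re[of w] Re[OF z] r e by auto
  qed
  then obtain k where "\<And>w. w \<in> ball z r \<Longrightarrow> f w = k"
    by (auto simp: constant_on_def)
  then have "deriv f z = deriv (\<lambda>_. k) z"
    using r by (intro deriv_cong_ev eventually_nhds_in_open[of "ball z r", THEN eventually_mono]) auto
  then show ?thesis by simp
qed

text \<open>This is Rado's theorem. On \<open>S\<close> the functions \<open>F - h\<close> and
  \<open>G + \<i> * h\<close> have vanishing real part, hence vanishing derivative, but their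
  constants may differ between components of \<open>S\<close>. The combination \<open>D\<close> is
  holomorphic on the whole ball with derivative 0 on a dense set, so it is one constant, and this
  recovers the imaginary part of \<open>h\<close>.\<close>

lemma holomorphic_on_ball_if_off_zeros:
  fixes g h :: "complex \<Rightarrow> complex" and c :: complex and \<rho> :: real
  defines "S \<equiv> {z \<in> ball c \<rho>. g z \<noteq> 0}"
  assumes g: "continuous_on (cball c \<rho>) g" "g holomorphic_on S" and ne: "S \<noteq> {}"
    and h: "continuous_on (cball c \<rho>) h" "h holomorphic_on S"
  shows "h holomorphic_on ball c \<rho>"
proof -
  have op: "open S" unfolding S_def by (rule open_nonzero_set[OF g(1)])
  have sub: "S \<subseteq> ball c \<rho>" by (auto simp: S_def)
  have dense: "ball c \<rho> \<subseteq> closure S"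
    using nonzero_set_dense[of c \<rho> g, folded S_def] g ne by blast
  obtain F where F: "F holomorphic_on ball c \<rho>" "\<And>z. z \<in> ball c \<rho> \<Longrightarrow> Re (F z) = Re (h z)"
    using real_part_holomorphic_off_zeros[of c \<rho> g h, folded S_def, OF g ne h] by metis
  have "continuous_on (cball c \<rho>) (\<lambda>z. - \<i> * h z)" "(\<lambda>z. - \<i> * h z) holomorphic_on S"
    using h by (auto intro!: continuous_intros holomorphic_intros)
  then obtain G where G: "G holomorphic_on ball c \<rho>" "\<And>z. z \<in> ball c \<rho> \<Longrightarrow> Re (G z) = Im (h z)"
    using real_part_holomorphic_off_zeros[of c \<rho> g "\<lambda>z. - \<i> * h z", folded S_def, OF g ne] by auto
  define D where "D z = F z - \<i> * G z" for z
  have D: "D holomorphic_on ball c \<rho>"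
    unfolding D_def by (intro holomorphic_intros F G)
  have S_diff: "h field_differentiable at z" "F field_differentiable at z" "G field_differentiable at z" if "z \<in> S" for z
    using that op sub h(2) F(1) G(1)
    by (auto intro: holomorphic_on_imp_differentiable_at)
  have derivD: "deriv D z = 0" if z: "z \<in> S" for z
  proof -
    have "deriv (\<lambda>w. F w - h w) z = 0"
      using sub F h(2) z by (intro deriv_eq_0_if_Re_eq_0[OF _ op]) (auto intro!: holomorphic_intros elim: holomorphic_on_subset)
    then have 1: "deriv F z = deriv h z"
      using S_diff[OF z] by (simp add: deriv_diff)
    have "deriv (\<lambda>w. G w + \<i> * h w) z = 0"
      using sub G h(2) z by (intro deriv_eq_0_if_Re_eq_0[OF _ op]) (auto intro!: holomorphic_intros elim: holomorphic_on_subset)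
    then have 2: "deriv G z + \<i> * deriv h z = 0"
      using S_diff[OF z] by (simp add: deriv_add deriv_cmult field_differentiable_mult)
    have "deriv D z = deriv F z - \<i> * deriv G z"
      unfolding D_def using S_diff[OF z] by (simp add: deriv_diff deriv_cmult field_differentiable_mult)
    also have "\<dots> = deriv h z - \<i> * (- \<i> * deriv h z)"
      using 1 2 by (metis add_eq_0_iff2 mult_minus_left)
    finally show ?thesis by simp
  qed
  have "deriv D z = 0" if z: "z \<in> ball c \<rho>" for z
  proof -
    have "continuous_on (ball c \<rho>) (deriv D)"
      using D by (intro holomorphic_on_imp_continuous_on holomorphic_deriv) auto
    then have "isCont (deriv D) z"
      using z by (simp add: continuous_on_eq_continuous_at)
    have "z \<in> closure S"
      using dense z by blast
    then obtain w where w: "\<And>n. w n \<in> S" "w \<longlonglongrightarrow> z"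
      unfolding closure_sequential by blast
    have "(\<lambda>n. deriv D (w n)) \<longlonglongrightarrow> deriv D z"
      using \<open>isCont (deriv D) z\<close> w(2) isCont_tendsto_compose by blast
    moreover have "(\<lambda>n. deriv D (w n)) = (\<lambda>n. 0)"
      using derivD w(1) by auto
    ultimately show ?thesis by (metis LIMSEQ_const_iff)
  qed
  then have "\<exists>k. \<forall>z\<in>ball c \<rho>. D z = k"
    using D by (intro has_field_derivative_zero_constant[OF convex_ball])
      (metis at_within_open holomorphic_derivI open_ball)
  then obtain k where k: "\<And>z. z \<in> ball c \<rho> \<Longrightarrow> D z = k" by blast
  have "h z = F z - \<i> * of_real (Im k)" if z: "z \<in> ball c \<rho>" for z
  proof -
    have "Im (F z) - Re (G z) = Im k"
      using k[OF z] by (auto simp: D_def)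
    then show ?thesis
      using F(2)[OF z] G(2)[OF z] by (simp add: complex_eq_iff)
  qed
  then have "F z - \<i> * of_real (Im k) = h z" if "z \<in> ball c \<rho>" for z
    using that by simp
  moreover have "(\<lambda>z. F z - \<i> * of_real (Im k)) holomorphic_on ball c \<rho>"
    by (intro holomorphic_intros F(1))
  ultimately show ?thesis
    using holomorphic_transform by blast
qed

section \<open>Inverses of injective holomorphic maps\<close>

lemma bounded_linear_smult_left: "bounded_linear (\<lambda>c :: complex. c *s (w :: complex ^ 'n))"
  by (rule bounded_linear_intro[where K = "norm w"])
    (simp_all add: vec_eq_iff algebra_simps norm_vector_smult_complex)

lemma holomorphic_vec_onD:
  assumes "holomorphic_vec_on \<phi> \<Omega>" "open \<Omega>" "z \<in> \<Omega>"
  shows "(\<phi> has_derivative frechet_derivative \<phi> (at z)) (at z)"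
    and "frechet_derivative \<phi> (at z) (c *s v) = c *s frechet_derivative \<phi> (at z) v"
proof -
  obtain D where D: "(\<phi> has_derivative D) (at z)" "\<And>c v. D (c *s v) = c *s D v"
    using assms unfolding holomorphic_vec_on_def by (metis at_within_open)
  then have "D = frechet_derivative \<phi> (at z)" by (simp add: frechet_derivative_at)
  then show "(\<phi> has_derivative frechet_derivative \<phi> (at z)) (at z)"
    and "frechet_derivative \<phi> (at z) (c *s v) = c *s frechet_derivative \<phi> (at z) v"
    using D by auto
qed

lemma holomorphic_vec_on_continuous_on:
  assumes "holomorphic_vec_on \<phi> \<Omega>"
  shows "continuous_on \<Omega> \<phi>"
  using assms has_derivative_continuous unfolding holomorphic_vec_on_def continuous_on_eq_continuous_within by blast

lemma has_derivative_curve: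
  fixes f :: "complex \<Rightarrow> complex ^ 'n"
  assumes "\<And>i. ((\<lambda>l. f l $ i) has_field_derivative d $ i) (at l)"
  shows "(f has_derivative (\<lambda>h. h *s d)) (at l)"
proof -
  have "((\<lambda>l. \<Sum>i\<in>UNIV. (f l $ i) *s axis i 1) has_derivative (\<lambda>h. \<Sum>i\<in>UNIV. (d $ i * h) *s axis i 1)) (at l)"
    by (intro has_derivative_sum bounded_linear.has_derivative[OF bounded_linear_smult_left])
      (use assms in \<open>simp add: has_field_derivative_def\<close>)
  moreover have "(\<lambda>l. \<Sum>i\<in>UNIV. (f l $ i) *s axis i 1) = f"
    by (simp add: basis_expansion)
  moreover have "(\<Sum>i\<in>UNIV. (d $ i * h) *s axis i 1) = h *s d" for h
    using basis_expansion[of "h *s d"] by (simp add: mult.commute)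
  ultimately show ?thesis by simp
qed

lemma holomorphic_curve_has_derivative:
  fixes f :: "complex \<Rightarrow> complex ^ 'n"
  assumes "open S" "l \<in> S" "\<And>i. (\<lambda>l. f l $ i) holomorphic_on S"
  shows "(f has_derivative (\<lambda>h. h *s (\<chi> i. deriv (\<lambda>l. f l $ i) l))) (at l)"
  by (rule has_derivative_curve) (use holomorphic_derivI[OF assms(3,1,2)] in simp)

lemma continuous_on_holomorphic_curve:
  fixes f :: "complex \<Rightarrow> complex ^ 'n"
  assumes "\<And>i. (\<lambda>l. f l $ i) holomorphic_on S"
  shows "continuous_on S f"
proof -
  have "continuous_on S (\<lambda>l. \<chi> i. f l $ i)"
    using assms holomorphic_on_imp_continuous_on by (intro continuous_on_vec_lambda) blast
  then show ?thesis by simp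
qed

lemma holomorphic_curve_of_has_derivative:
  fixes f :: "complex \<Rightarrow> complex ^ 'n"
  assumes "open S" "\<And>l. l \<in> S \<Longrightarrow> \<exists>d. (f has_derivative (\<lambda>h. h *s d)) (at l)"
  shows "(\<lambda>l. f l $ i) holomorphic_on S"
proof -
  have "\<exists>e. ((\<lambda>l. f l $ i) has_field_derivative e) (at l)" if l: "l \<in> S" for l
  proof -
    obtain d where "(f has_derivative (\<lambda>h. h *s d)) (at l)" using assms(2)[OF l] by blast
    then have "((\<lambda>l. f l $ i) has_derivative (\<lambda>h. (h *s d) $ i)) (at l)"
      by (rule bounded_linear.has_derivative[OF bounded_linear_vec_nth])
    moreover have "(\<lambda>h. (h *s d) $ i) = (*) (d $ i)" by (auto simp: mult.commute)
    ultimately show ?thesis unfolding has_field_derivative_def by metis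
  qed
  then show ?thesis using assms(1) holomorphic_on_open by blast
qed

lemma holomorphic_vec_on_compose_curve:
  fixes f :: "complex \<Rightarrow> complex ^ 'n" and \<phi> :: "complex ^ 'n \<Rightarrow> complex ^ 'm"
  assumes \<phi>: "holomorphic_vec_on \<phi> \<Omega>" "open \<Omega>" and S: "open S" "f ` S \<subseteq> \<Omega>"
    and f: "\<And>i. (\<lambda>l. f l $ i) holomorphic_on S"
  shows "(\<lambda>l. \<phi> (f l) $ i) holomorphic_on S"
proof (rule holomorphic_curve_of_has_derivative[OF S(1)])
  fix l assume l: "l \<in> S"
  define d where "d = (\<chi> i. deriv (\<lambda>l. f l $ i) l)"
  have fd: "(f has_derivative (\<lambda>h. h *s d)) (at l)"
    unfolding d_def by (rule holomorphic_curve_has_derivative[OF S(1) l f])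
  have fl: "f l \<in> \<Omega>" using S(2) l by blast
  have "((\<lambda>l. \<phi> (f l)) has_derivative (\<lambda>h. frechet_derivative \<phi> (at (f l)) (h *s d))) (at l)"
    using diff_chain_at[OF fd holomorphic_vec_onD(1)[OF \<phi> fl]] by (simp add: comp_def)
  then show "\<exists>d. ((\<lambda>l. \<phi> (f l)) has_derivative (\<lambda>h. h *s d)) (at l)"
    unfolding holomorphic_vec_onD(2)[OF \<phi> fl] by blast
qed

text \<open>Cauchy's inequality for the second derivative on discs of radius \<open>r / 3\<close>
  about points of \<open>ball 0 (r / 2)\<close> gives 2 times 9, that is 18. The bound depends on
  \<open>f\<close> only through \<open>M\<close>, which yields uniform convergence of difference
  quotients.\<close>

lemma holomorphic_difference_quotient_bound:
  assumes f: "f holomorphic_on ball 0 r" and M: "\<And>z. z \<in> ball 0 r \<Longrightarrow> cmod (f z) \<le> M"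
    and r: "0 < r" and h: "cmod h < r / 2" "h \<noteq> 0"
  shows "cmod ((f h - f 0) / h - deriv f 0) \<le> 18 * M / r\<^sup>2 * cmod h"
proof -
  define S where "S = ball (0::complex) (r / 2)"
  have B: "cmod ((deriv ^^ 2) f z) \<le> 18 * M / r\<^sup>2" if z: "z \<in> S" for z
  proof -
    have sub: "cball z (r / 3) \<subseteq> ball 0 r"
    proof
      fix w assume "w \<in> cball z (r / 3)"
      then show "w \<in> ball 0 r"
        using z norm_triangle_sub[of w z] r by (simp add: S_def dist_norm norm_minus_commute)
    qed
    have "cmod ((deriv ^^ 2) f z) \<le> fact 2 * M / (r / 3) ^ 2"
    proof (rule Cauchy_inequality)
      show "f holomorphic_on ball z (r / 3)"
        using f sub ball_subset_cball holomorphic_on_subset by (metis order_trans)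
      show "continuous_on (cball z (r / 3)) f"
        using f sub holomorphic_on_imp_continuous_on continuous_on_subset by blast
      show "cmod (f x) \<le> M" if "cmod (z - x) = r / 3" for x
        using that sub by (intro M) (auto simp: subset_iff dist_norm)
    qed (use r in simp)
    then show ?thesis by (simp add: power_divide field_simps)
  qed
  have "cmod ((deriv ^^ 0) f h - (\<Sum>i\<le>1. (deriv ^^ i) f 0 * (h - 0) ^ i / fact i)) \<le>
      18 * M / r\<^sup>2 * cmod (h - 0) ^ Suc 1 / fact 1"
  proof (rule complex_Taylor[of S 1 "\<lambda>i. (deriv ^^ i) f"])
    fix i x assume x: "x \<in> S"
    then have xr: "x \<in> ball 0 r" using r by (simp add: S_def)
    have "(deriv ^^ i) f holomorphic_on ball 0 r" using f by (intro holomorphic_higher_deriv) auto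
    then have "((deriv ^^ i) f has_field_derivative deriv ((deriv ^^ i) f) x) (at x)"
      using xr by (intro holomorphic_derivI) auto
    then show "((deriv ^^ i) f has_field_derivative (deriv ^^ Suc i) f x) (at x within S)"
      by (simp add: has_field_derivative_at_within)
  next
    show "convex S" by (simp add: S_def)
  qed (use B h r in \<open>auto simp: S_def numeral_2_eq_2\<close>)
  then have *: "cmod (f h - f 0 - deriv f 0 * h) \<le> 18 * M / r\<^sup>2 * (cmod h)\<^sup>2"
    by (simp add: algebra_simps power2_eq_square)
  have "(f h - f 0) / h - deriv f 0 = (f h - f 0 - deriv f 0 * h) / h"
    using h by (simp add: field_simps)
  then have "cmod ((f h - f 0) / h - deriv f 0) = cmod (f h - f 0 - deriv f 0 * h) / cmod h"
    by (simp add: norm_divide)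
  also have "\<dots> \<le> 18 * M / r\<^sup>2 * (cmod h)\<^sup>2 / cmod h"
    using * by (intro divide_right_mono) auto
  also have "\<dots> = 18 * M / r\<^sup>2 * cmod h"
    using h by (simp add: power2_eq_square)
  finally show ?thesis .
qed

section \<open>Regularity of the partial derivatives\<close>

context
  fixes \<phi> :: "complex ^ 'n \<Rightarrow> complex ^ 'm" and \<Omega> :: "(complex ^ 'n) set" and M :: real
  assumes holo: "holomorphic_vec_on \<phi> \<Omega>" and opn: "open \<Omega>" and bound: "\<And>z. z \<in> \<Omega> \<Longrightarrow> norm (\<phi> z) \<le> M"
begin

lemma partial_difference_quotient_bound:
  assumes r: "0 < r" "ball z r \<subseteq> \<Omega>" and v: "norm v \<le> 1" and h: "cmod h < r / 2" "h \<noteq> 0"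
  shows "cmod ((\<phi> (z + h *s v) $ i - \<phi> z $ i) / h - frechet_derivative \<phi> (at z) v $ i) \<le> 18 * M / r\<^sup>2 * cmod h"
proof -
  have z: "z \<in> \<Omega>" using r by auto
  define f where "f \<zeta> = \<phi> (z + \<zeta> *s v) $ i" for \<zeta>
  have mem: "z + \<zeta> *s v \<in> \<Omega>" if "\<zeta> \<in> ball 0 r" for \<zeta>
  proof -
    have "norm (\<zeta> *s v) < r"
      using that v by (simp add: norm_vector_smult_complex) (meson le_less_trans mult_left_le norm_ge_zero)
    then show ?thesis using r(2) by (auto simp: dist_norm)
  qed
  have f: "f holomorphic_on ball 0 r"
    unfolding f_def by (rule holomorphic_vec_on_compose_curve[OF holo opn]) (use mem in \<open>auto intro!: holomorphic_intros\<close>)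
  have "((\<lambda>\<zeta>. z + \<zeta> *s v) has_derivative (\<lambda>h. h *s v)) (at 0)"
    using bounded_linear_imp_has_derivative[OF bounded_linear_smult_left] by (auto intro!: derivative_eq_intros)
  then have "((\<lambda>\<zeta>. \<phi> (z + \<zeta> *s v)) has_derivative (\<lambda>h. frechet_derivative \<phi> (at z) (h *s v))) (at 0)"
    using diff_chain_at[of "\<lambda>\<zeta>. z + \<zeta> *s v" "\<lambda>h. h *s v" 0 \<phi>] holomorphic_vec_onD(1)[OF holo opn z]
    by (simp add: comp_def)
  then have "(f has_derivative (\<lambda>h. frechet_derivative \<phi> (at z) (h *s v) $ i)) (at 0)"
    unfolding f_def by (rule bounded_linear.has_derivative[OF bounded_linear_vec_nth])
  moreover have "(\<lambda>h. frechet_derivative \<phi> (at z) (h *s v) $ i) = (*) (frechet_derivative \<phi> (at z) v $ i)"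
    by (auto simp: holomorphic_vec_onD(2)[OF holo opn z] mult.commute)
  ultimately have "(f has_field_derivative frechet_derivative \<phi> (at z) v $ i) (at 0)"
    by (simp add: has_field_derivative_def)
  then have df: "deriv f 0 = frechet_derivative \<phi> (at z) v $ i" by (rule DERIV_imp_deriv)
  have "cmod (f \<zeta>) \<le> M" if "\<zeta> \<in> ball 0 r" for \<zeta>
    using bound[OF mem[OF that]] Finite_Cartesian_Product.norm_nth_le[of "\<phi> (z + \<zeta> *s v)" i]
    by (simp add: f_def)
  from holomorphic_difference_quotient_bound[OF f this r(1) h] show ?thesis
    unfolding df by (simp add: f_def)
qed

text \<open>Difference quotients of \<open>\<phi>\<close> are continuous, and holomorphic along
  holomorphic curves; uniform convergence passes both properties to the partial derivatives. The
  increments stay below \<open>r / 2\<close>, as the estimate requires.\<close>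

lemma uniform_limit_partial_difference_quotient:
  assumes r: "0 < r" "\<And>x. x \<in> T \<Longrightarrow> ball (c x) r \<subseteq> \<Omega>" and v: "norm v \<le> 1"
  shows "uniform_limit T (\<lambda>n x. (\<phi> (c x + of_real (r / (3 * real (Suc n))) *s v) $ i - \<phi> (c x) $ i) / of_real (r / (3 * real (Suc n))))
    (\<lambda>x. frechet_derivative \<phi> (at (c x)) v $ i) sequentially"
proof (rule uniform_limitI)
  fix e :: real assume e: "e > 0"
  have "(\<lambda>n. 18 * M / r\<^sup>2 * (r / 3 * (1 / real (Suc n)))) \<longlonglongrightarrow> 18 * M / r\<^sup>2 * (r / 3 * 0)"
    using LIMSEQ_inverse_real_of_nat by (intro tendsto_intros) (simp add: inverse_eq_divide)
  then have "\<forall>\<^sub>F n in sequentially. 18 * M / r\<^sup>2 * (r / 3 * (1 / real (Suc n))) < e"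
    using e by (intro order_tendstoD(2)) auto
  then show "\<forall>\<^sub>F n in sequentially. \<forall>x\<in>T. dist ((\<phi> (c x + of_real (r / (3 * real (Suc n))) *s v) $ i - \<phi> (c x) $ i) / of_real (r / (3 * real (Suc n))))
      (frechet_derivative \<phi> (at (c x)) v $ i) < e"
  proof eventually_elim
    case (elim n)
    show ?case
    proof
      fix x assume x: "x \<in> T"
      define h where "h = r / (3 * real (Suc n))"
      have h0: "0 < h" using r by (simp add: h_def)
      have "h \<le> r / 3" unfolding h_def using r by (intro divide_left_mono) auto
      then have h: "cmod (complex_of_real h) < r / 2" "complex_of_real h \<noteq> 0" using h0 r by auto
      have "cmod (complex_of_real h) = r / 3 * (1 / real (Suc n))"
        by (simp only: norm_of_real abs_of_pos[OF h0]) (simp add: h_def)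
      then have "18 * M / r\<^sup>2 * cmod (complex_of_real h) < e" using elim by (simp only:)
      then show "dist ((\<phi> (c x + of_real (r / (3 * real (Suc n))) *s v) $ i - \<phi> (c x) $ i) / of_real (r / (3 * real (Suc n))))
          (frechet_derivative \<phi> (at (c x)) v $ i) < e"
        using partial_difference_quotient_bound[OF r(1) r(2)[OF x] v h, of i]
        unfolding h_def[symmetric] dist_norm by linarith
    qed
  qed
qed

lemma continuous_on_partial:
  assumes v: "norm v \<le> 1"
  shows "continuous_on \<Omega> (\<lambda>z. frechet_derivative \<phi> (at z) v $ i)"
proof -
  have "continuous (at z) (\<lambda>z. frechet_derivative \<phi> (at z) v $ i)" if z: "z \<in> \<Omega>" for z
  proof -
    obtain r where r: "r > 0" "ball z (2 * r) \<subseteq> \<Omega>"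
      using opn z openE by (metis mult.commute nonzero_mult_div_cancel_right zero_less_divide_iff zero_less_numeral zero_neq_numeral times_divide_eq_right)
    have sub: "ball x r \<subseteq> \<Omega>" if "x \<in> ball z r" for x
      using that r by (intro order.trans[OF _ r(2)]) (auto simp: ball_subset_ball_iff dist_commute)
    have "continuous_on (ball z r) (\<lambda>z. frechet_derivative \<phi> (at z) v $ i)"
    proof (rule uniform_limit_theorem[OF _ uniform_limit_partial_difference_quotient[of r "ball z r" "\<lambda>x. x"]])
      show "\<forall>\<^sub>F n in sequentially. continuous_on (ball z r)
          (\<lambda>x. (\<phi> (x + of_real (r / (3 * real (Suc n))) *s v) $ i - \<phi> x $ i) / of_real (r / (3 * real (Suc n))))"
      proof (intro always_eventually allI)
        fix n
        define h where "h = r / (3 * real (Suc n))"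
        have "h \<le> r / 3" unfolding h_def using r by (intro divide_left_mono) auto
        moreover have "0 < h" using r by (simp add: h_def)
        ultimately have "norm (complex_of_real h *s v) < r"
          using v r by (simp add: norm_vector_smult_complex) (smt (verit) mult_left_le)
        then have img: "(\<lambda>x. x + of_real h *s v) ` ball z r \<subseteq> \<Omega>"
          using sub by (force simp: dist_norm)
        have 1: "continuous_on (ball z r) (\<lambda>x. \<phi> (x + of_real h *s v))"
          by (rule continuous_on_compose2[OF holomorphic_vec_on_continuous_on[OF holo] _ img]) (intro continuous_intros)
        have "ball z r \<subseteq> \<Omega>" using sub r(1) by simp
        then have 2: "continuous_on (ball z r) \<phi>"
          using holomorphic_vec_on_continuous_on[OF holo] continuous_on_subset by blast
        have "continuous_on (ball z r) (\<lambda>x. (\<phi> (x + of_real h *s v) $ i - \<phi> x $ i) / of_real h)"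
          using \<open>0 < h\<close> by (intro continuous_intros bounded_linear.continuous_on[OF bounded_linear_vec_nth] 1 2) auto
        then show "continuous_on (ball z r)
          (\<lambda>x. (\<phi> (x + of_real (r / (3 * real (Suc n))) *s v) $ i - \<phi> x $ i) / of_real (r / (3 * real (Suc n))))"
          by (simp only: h_def)
      qed
    qed (use r sub v in auto)
    then show ?thesis using r(1) by (simp add: continuous_on_eq_continuous_at)
  qed
  then show ?thesis by (simp add: continuous_at_imp_continuous_on)
qed

lemma holomorphic_on_partial_curve:
  fixes c :: "complex \<Rightarrow> complex ^ 'n"
  assumes v: "norm v \<le> 1" and S: "open S" "c ` S \<subseteq> \<Omega>" and c: "\<And>j. (\<lambda>l. c l $ j) holomorphic_on S"
  shows "(\<lambda>l. frechet_derivative \<phi> (at (c l)) v $ i) holomorphic_on S"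
proof -
  have "\<exists>s>0. ball l s \<subseteq> S \<and> (\<lambda>l. frechet_derivative \<phi> (at (c l)) v $ i) holomorphic_on ball l s" if l: "l \<in> S" for l
  proof -
    have "c l \<in> \<Omega>" using S l by blast
    then obtain r' where r': "r' > 0" "ball (c l) r' \<subseteq> \<Omega>" using opn openE by blast
    define r where "r = r' / 2"
    have r: "r > 0" "ball (c l) (2 * r) \<subseteq> \<Omega>" using r' by (auto simp: r_def)
    have contc: "continuous_on S c" by (rule continuous_on_holomorphic_curve[OF c])
    then have "open (S \<inter> c -` ball (c l) r)" using S(1) by (intro continuous_open_preimage) auto
    moreover have "l \<in> S \<inter> c -` ball (c l) r" using l r by simp
    ultimately obtain s where s: "s > 0" "ball l s \<subseteq> S \<inter> c -` ball (c l) r" using openE by blast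
    have sub: "ball (c x) r \<subseteq> \<Omega>" if "x \<in> ball l s" for x
    proof -
      have "c x \<in> ball (c l) r" using s that by blast
      then show ?thesis using r by (intro order.trans[OF _ r(2)]) (auto simp: ball_subset_ball_iff dist_commute)
    qed
    have "(\<lambda>l. frechet_derivative \<phi> (at (c l)) v $ i) holomorphic_on ball l s"
    proof (rule holomorphic_uniform_sequence[OF open_ball])
      fix n
      define h where "h = r / (3 * real (Suc n))"
      have "h \<le> r / 3" unfolding h_def using r by (intro divide_left_mono) auto
      moreover have h0: "0 < h" using r by (simp add: h_def)
      ultimately have "norm (complex_of_real h *s v) < r"
        using v r by (simp add: norm_vector_smult_complex) (smt (verit) mult_left_le)
      then have img: "(\<lambda>x. c x + of_real h *s v) ` ball l s \<subseteq> \<Omega>"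
        using sub by (force simp: dist_norm)
      have ch: "(\<lambda>l. c l $ j) holomorphic_on ball l s" for j
        using c s holomorphic_on_subset by (metis Int_lower1 order_trans)
      have 1: "(\<lambda>x. \<phi> (c x + of_real h *s v) $ i) holomorphic_on ball l s"
        by (rule holomorphic_vec_on_compose_curve[OF holo opn open_ball img]) (auto intro!: holomorphic_intros ch)
      have 2: "(\<lambda>x. \<phi> (c x) $ i) holomorphic_on ball l s"
        by (rule holomorphic_vec_on_compose_curve[OF holo opn open_ball _ ch]) (use s S in auto)
      show "(\<lambda>x. (\<phi> (c x + of_real (r / (3 * real (Suc n))) *s v) $ i - \<phi> (c x) $ i) / of_real (r / (3 * real (Suc n)))) holomorphic_on ball l s"
        unfolding h_def[symmetric] using h0 by (intro holomorphic_intros 1 2) auto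
    next
      fix x assume x: "x \<in> ball l s"
      then obtain d where d: "d > 0" "cball x d \<subseteq> ball l s" using open_contains_cball open_ball by blast
      then show "\<exists>d>0. cball x d \<subseteq> ball l s \<and> uniform_limit (cball x d)
          (\<lambda>n x. (\<phi> (c x + of_real (r / (3 * real (Suc n))) *s v) $ i - \<phi> (c x) $ i) / of_real (r / (3 * real (Suc n))))
          (\<lambda>l. frechet_derivative \<phi> (at (c l)) v $ i) sequentially"
        using sub by (intro exI[of _ d] conjI uniform_limit_partial_difference_quotient r v) blast+
    qed
    then show ?thesis using s by blast
  qed
  then have "(\<lambda>l. frechet_derivative \<phi> (at (c l)) v $ i) field_differentiable (at l)" if "l \<in> S" for l
    using that holomorphic_on_imp_differentiable_at by (metis centre_in_ball open_ball)
  then show ?thesis using S(1) field_differentiable_at_within by (auto simp: holomorphic_on_def)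
qed

end

text \<open>The matrix is taken over the complex numbers because its determinant varies
  holomorphically; the determinant of the underlying real map is the squared modulus of it.\<close>

definition complex_jacobian_matrix :: "(complex ^ 'n \<Rightarrow> complex ^ 'n) \<Rightarrow> complex ^ 'n \<Rightarrow> complex ^ 'n ^ 'n" where
  "complex_jacobian_matrix \<phi> z = (\<chi> i j. frechet_derivative \<phi> (at z) (axis j 1) $ i)"

lemma complex_jacobian_matrix_works:
  assumes "holomorphic_vec_on \<phi> \<Omega>" "open \<Omega>" "z \<in> \<Omega>"
  shows "frechet_derivative \<phi> (at z) v = complex_jacobian_matrix \<phi> z *v v"
proof -
  let ?D = "frechet_derivative \<phi> (at z)"
  have lin: "linear ?D"
    using holomorphic_vec_onD(1)[OF assms] has_derivative_linear by blast
  have "?D v = ?D (\<Sum>j\<in>UNIV. (v $ j) *s axis j 1)"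
    by (simp add: basis_expansion)
  also have "\<dots> = (\<Sum>j\<in>UNIV. ?D ((v $ j) *s axis j 1))"
    by (rule linear_sum[OF lin])
  also have "\<dots> = (\<Sum>j\<in>UNIV. (v $ j) *s ?D (axis j 1))"
    by (simp add: holomorphic_vec_onD(2)[OF assms])
  also have "\<dots> = complex_jacobian_matrix \<phi> z *v v"
    by (simp add: vec_eq_iff complex_jacobian_matrix_def matrix_vector_mult_def mult.commute)
  finally show ?thesis .
qed

lemma norm_axis_1_le: "norm (axis j 1 :: complex ^ 'n) \<le> 1"
  by (rule order_trans[OF norm_le_sum_components]) (simp add: axis_def if_distrib cong: if_cong)

text \<open>The theorem \<open>baby_Sard\<close> is stated for real coordinate spaces over a well-ordered index type, which
  \<open>'n bit0\<close> provides in the right dimension.\<close>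

lemma negligible_singular_image:
  fixes \<phi> :: "complex ^ 'n \<Rightarrow> complex ^ 'n"
  assumes der: "\<And>z. z \<in> N \<Longrightarrow> (\<phi> has_derivative \<phi>' z) (at z)" and sing: "\<And>z. z \<in> N \<Longrightarrow> \<exists>v. v \<noteq> 0 \<and> \<phi>' z v = 0"
  shows "interior (\<phi> ` N) = {}"
proof -
  have "DIM(complex ^ 'n) = DIM(real ^ 'n bit0)"
    by simp
  then obtain L :: "complex ^ 'n \<Rightarrow> real ^ 'n bit0" and L' where
    L: "linear L" "linear L'" "\<And>x. L' (L x) = x" "\<And>y. L (L' y) = y"
    using isomorphisms_UNIV_UNIV by metis
  have bl: "bounded_linear L" "bounded_linear L'"
    using L linear_conv_bounded_linear by blast+
  define f where "f = L \<circ> \<phi> \<circ> L'"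
  define f' where "f' y = L \<circ> \<phi>' (L' y) \<circ> L'" for y
  have derf: "(f has_derivative f' y) (at y within L ` N)" if "y \<in> L ` N" for y
  proof -
    have y: "L' y \<in> N" using that L by auto
    have "(\<phi> \<circ> L' has_derivative \<phi>' (L' y) \<circ> L') (at y)"
      by (rule diff_chain_at[OF bounded_linear_imp_has_derivative[OF bl(2)] der[OF y]])
    then have "(L \<circ> (\<phi> \<circ> L') has_derivative L \<circ> (\<phi>' (L' y) \<circ> L')) (at y)"
      by (rule diff_chain_at[OF _ bounded_linear_imp_has_derivative[OF bl(1)]])
    then show ?thesis
      unfolding f_def f'_def by (simp add: comp_assoc has_derivative_at_withinI)
  qed
  have "negligible (f ` (L ` N))"
  proof (rule baby_Sard[OF _ derf])
    fix y assume y: "y \<in> L ` N"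
    then have "L' y \<in> N" using L by auto
    then obtain v where v: "v \<noteq> 0" "\<phi>' (L' y) v = 0" using sing by blast
    have lin: "linear (f' y)" using derf[OF y] has_derivative_linear by blast
    have M: "matrix (f' y) *v x = f' y x" for x
      using fun_cong[OF matrix_vector_mul(2)[OF lin], of x] by simp
    have "f' y (L v) = 0" using v L by (simp add: f'_def linear_0)
    then have "matrix (f' y) *v (L v) = matrix (f' y) *v 0"
      unfolding M by (simp add: linear_0[OF lin])
    moreover have "L v \<noteq> 0" using v(1) L by (metis linear_0)
    ultimately have "\<not> inj ((*v) (matrix (f' y)))" unfolding inj_def by blast
    then show "rank (matrix (f' y)) < CARD('n bit0)" by (rule less_rank_noninjective[THEN iffD2])
  qed simp_all
  then have neg: "negligible (L ` (\<phi> ` N))"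
    using L by (simp add: f_def image_comp comp_def)
  show ?thesis
  proof (rule ccontr)
    assume ne: "interior (\<phi> ` N) \<noteq> {}"
    have "L ` interior (\<phi> ` N) = L' -` interior (\<phi> ` N)"
      using L by (auto simp: image_iff) metis
    moreover have "open (L' -` interior (\<phi> ` N))"
      using bl(2) by (intro open_vimage linear_continuous_on) auto
    ultimately have "open (L ` interior (\<phi> ` N))" by simp
    moreover have "negligible (L ` interior (\<phi> ` N))"
      by (rule negligible_subset[OF neg]) (simp add: image_mono interior_subset)
    ultimately show False using open_not_negligible ne by blast
  qed
qed

text \<open>The bound \<open>M\<close> feeds the Cauchy estimates behind the regularity of the
  Jacobian; for the rescaling maps into the unit ball it is 1.\<close>

locale injective_holomorphic =
  fixes \<phi> :: "complex ^ 'n \<Rightarrow> complex ^ 'n" and \<Omega> :: "(complex ^ 'n) set" and M :: real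
  assumes holo: "holomorphic_vec_on \<phi> \<Omega>" and opn: "open \<Omega>" and inj: "inj_on \<phi> \<Omega>"
    and bound: "\<And>z. z \<in> \<Omega> \<Longrightarrow> norm (\<phi> z) \<le> M"
begin

abbreviation "\<psi> \<equiv> inv_into \<Omega> \<phi>"
abbreviation "J z \<equiv> det (complex_jacobian_matrix \<phi> z)"

lemma open_image: "open (\<phi> ` \<Omega>)"
  by (rule invariance_of_domain[OF holomorphic_vec_on_continuous_on[OF holo] opn inj])

lemma continuous_inverse: "continuous_on (\<phi> ` \<Omega>) \<psi>"
  by (rule continuous_on_inverse_open[OF opn holomorphic_vec_on_continuous_on[OF holo]]) (simp_all add: inj)

lemma continuous_jacobian: "continuous_on \<Omega> (\<lambda>z. J z)"
  unfolding det_def complex_jacobian_matrix_def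
  by (auto intro!: continuous_intros continuous_on_partial[OF holo opn bound norm_axis_1_le])

lemma holomorphic_jacobian_curve:
  fixes c :: "complex \<Rightarrow> complex ^ 'n"
  assumes "open S" "c ` S \<subseteq> \<Omega>" "\<And>j. (\<lambda>l. c l $ j) holomorphic_on S"
  shows "(\<lambda>l. J (c l)) holomorphic_on S"
  unfolding det_def complex_jacobian_matrix_def
  by (auto intro!: holomorphic_intros holomorphic_on_partial_curve[OF holo opn bound norm_axis_1_le assms])

text \<open>Invariance of domain already provides continuity of \<open>\<psi>\<close>, so
  invertibility of the derivative of \<open>\<phi>\<close> suffices. Expressing the derivative by a
  complex matrix makes it complex linear.\<close>

lemma inverse_has_derivative:
  assumes w: "w \<in> \<phi> ` \<Omega>" and nz: "J (\<psi> w) \<noteq> 0"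
  obtains B where "(\<psi> has_derivative (\<lambda>v. B *v v)) (at w)"
proof -
  have \<psi>w: "\<psi> w \<in> \<Omega>" using w by (rule inv_into_into)
  let ?A = "complex_jacobian_matrix \<phi> (\<psi> w)"
  obtain B where B: "B ** ?A = mat 1"
    using nz invertible_det_nz[of ?A] unfolding invertible_def by blast
  have "(\<psi> has_derivative (\<lambda>v. B *v v)) (at w)"
  proof (rule has_derivative_inverse_basic[where f = \<phi> and g = \<psi> and y = w and T = "\<phi> ` \<Omega>"])
    show "(\<phi> has_derivative frechet_derivative \<phi> (at (\<psi> w))) (at (\<psi> w))"
      by (rule holomorphic_vec_onD(1)[OF holo opn \<psi>w])
    show "bounded_linear (\<lambda>v. B *v v)"
      by (rule linear_conv_bounded_linear[THEN iffD1])
        (auto intro!: linearI simp: vec_eq_iff matrix_vector_mult_def algebra_simps sum.distrib scaleR_sum_right)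
    show "(\<lambda>v. B *v v) \<circ> frechet_derivative \<phi> (at (\<psi> w)) = id"
      using B by (auto simp: complex_jacobian_matrix_works[OF holo opn \<psi>w] matrix_vector_mul_assoc fun_eq_iff)
    show "continuous (at w) \<psi>"
      using continuous_on_eq_continuous_at[OF open_image] continuous_inverse w by blast
  qed (use open_image w in \<open>simp_all add: f_inv_into_f\<close>)
  then show ?thesis using that by blast
qed

lemma interior_critical_values: "interior (\<phi> ` {z \<in> \<Omega>. J z = 0}) = {}"
proof (rule negligible_singular_image)
  fix z assume z: "z \<in> {z \<in> \<Omega>. J z = 0}"
  then have z': "z \<in> \<Omega>" "J z = 0" by auto
  show "(\<phi> has_derivative frechet_derivative \<phi> (at z)) (at z)"
    by (rule holomorphic_vec_onD(1)[OF holo opn z'(1)])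
  have "\<not> invertible (complex_jacobian_matrix \<phi> z)"
    using z'(2) invertible_det_nz by blast
  then have "\<not> (\<exists>B. B ** complex_jacobian_matrix \<phi> z = mat 1)"
    using invertible_left_inverse by blast
  then have "\<exists>v. v \<noteq> 0 \<and> complex_jacobian_matrix \<phi> z *v v = 0"
    unfolding matrix_left_invertible_ker by blast
  then show "\<exists>v. v \<noteq> 0 \<and> frechet_derivative \<phi> (at z) v = 0"
    by (simp add: complex_jacobian_matrix_works[OF holo opn z'(1)])
qed

text \<open>The function \<open>g\<close> involves \<open>\<psi>\<close> and is therefore known to
  be holomorphic only where it does not vanish, while being continuous everywhere. This is precisely
  the situation of Rado's theorem.\<close>

lemma inverse_holomorphic_on_generic_line:
  assumes sub: "\<And>l. l \<in> cball c \<rho> \<Longrightarrow> p + l *s v \<in> \<phi> ` \<Omega>"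
    and \<alpha>: "\<alpha> \<in> ball c \<rho>" "J (\<psi> (p + \<alpha> *s v)) \<noteq> 0"
  shows "(\<lambda>l. \<psi> (p + l *s v) $ i) holomorphic_on ball c \<rho>"
proof -
  define g where "g l = J (\<psi> (p + l *s v))" for l
  define S where "S = {l \<in> ball c \<rho>. g l \<noteq> 0}"
  have contF: "continuous_on T (\<lambda>l. p + l *s v)" for T
    using linear_continuous_on[OF bounded_linear_smult_left] by (intro continuous_intros)
  have cont: "continuous_on (cball c \<rho>) (\<lambda>l. \<psi> (p + l *s v))"
    by (rule continuous_on_compose2[OF continuous_inverse contF]) (use sub in auto)
  have contg: "continuous_on (cball c \<rho>) g"
    unfolding g_def by (rule continuous_on_compose2[OF continuous_jacobian cont])
      (use sub in \<open>auto intro!: inv_into_into\<close>)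
  have opS: "open S" unfolding S_def by (rule open_nonzero_set[OF contg])
  have holS: "(\<lambda>l. \<psi> (p + l *s v) $ j) holomorphic_on S" for j
  proof (rule holomorphic_curve_of_has_derivative[OF opS])
    fix l assume l: "l \<in> S"
    then have "p + l *s v \<in> \<phi> ` \<Omega>" "J (\<psi> (p + l *s v)) \<noteq> 0"
      using sub[of l] by (auto simp: S_def g_def)
    then obtain B where "(\<psi> has_derivative (\<lambda>v. B *v v)) (at (p + l *s v))"
      using inverse_has_derivative by blast
    moreover have "((\<lambda>l. p + l *s v) has_derivative (\<lambda>h. h *s v)) (at l)"
      using bounded_linear_imp_has_derivative[OF bounded_linear_smult_left] by (auto intro!: derivative_eq_intros)
    ultimately have "((\<lambda>l. \<psi> (p + l *s v)) has_derivative (\<lambda>h. B *v (h *s v))) (at l)"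
      using diff_chain_at[of "\<lambda>l. p + l *s v" "\<lambda>h. h *s v" l \<psi>] by (simp add: comp_def)
    then show "\<exists>d. ((\<lambda>l. \<psi> (p + l *s v)) has_derivative (\<lambda>h. h *s d)) (at l)"
      by (auto simp: vector_scalar_commute)
  qed
  have "g holomorphic_on S"
    unfolding g_def by (rule holomorphic_jacobian_curve[OF opS _ holS])
      (use sub in \<open>auto simp: S_def intro!: inv_into_into\<close>)
  moreover have "continuous_on (cball c \<rho>) (\<lambda>l. \<psi> (p + l *s v) $ i)"
    by (rule bounded_linear.continuous_on[OF bounded_linear_vec_nth cont])
  moreover have "S \<noteq> {}" using \<alpha> by (auto simp: S_def g_def)
  ultimately show ?thesis
    using holomorphic_on_ball_if_off_zeros[OF contg, of "\<lambda>l. \<psi> (p + l *s v) $ i"] holS[of i]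
    unfolding S_def by blast
qed

text \<open>A line inside the set of critical values is a limit of parallel lines that leave it.\<close>

lemma inverse_holomorphic_on_line:
  assumes \<rho>: "\<rho> > 0" and sub: "\<And>l. l \<in> cball c \<rho> \<Longrightarrow> p + l *s v \<in> \<phi> ` \<Omega>"
  shows "(\<lambda>l. \<psi> (p + l *s v) $ i) holomorphic_on ball c \<rho>"
proof -
  have contF: "continuous_on T (\<lambda>l. p + l *s v)" for T
    using linear_continuous_on[OF bounded_linear_smult_left] by (intro continuous_intros)
  define K0 where "K0 = (\<lambda>l. p + l *s v) ` cball c \<rho>"
  have cK0: "compact K0" unfolding K0_def by (rule compact_continuous_image[OF contF]) simp
  have "K0 \<subseteq> \<phi> ` \<Omega>" using sub by (auto simp: K0_def)
  then obtain e where e: "e > 0" "(\<Union>x\<in>K0. cball x e) \<subseteq> \<phi> ` \<Omega>"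
    using compact_subset_open_imp_cball_epsilon_subset[OF cK0 open_image] by metis
  define K where "K = {x + y | x y. x \<in> K0 \<and> y \<in> cball 0 e}"
  have "compact K" unfolding K_def by (rule compact_sums[OF cK0 compact_cball])
  have K\<phi>: "K \<subseteq> \<phi> ` \<Omega>"
  proof
    fix w assume "w \<in> K"
    then obtain x y where xy: "w = x + y" "x \<in> K0" "norm y \<le> e" by (auto simp: K_def)
    then have "w \<in> cball x e" by (simp add: dist_norm)
    then show "w \<in> \<phi> ` \<Omega>" using e(2) xy(2) by blast
  qed
  have "uniformly_continuous_on K \<psi>"
    using compact_uniformly_continuous[OF continuous_on_subset[OF continuous_inverse K\<phi>] \<open>compact K\<close>] .
  have "\<exists>y. norm y < min e (1 / Suc n) \<and> J (\<psi> (p + c *s v + y)) \<noteq> 0" for n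
  proof -
    define q where "q = p + c *s v"
    define s where "s = min e (1 / Suc n)"
    have s: "s > 0" using e by (simp add: s_def)
    \<comment> \<open>By Sard's theorem the critical values have empty interior, so an arbitrarily
      small translation \<open>y\<close> brings the centre of the disc to a regular value.\<close>
    have "\<not> ball q s \<subseteq> \<phi> ` {z \<in> \<Omega>. J z = 0}"
      using interior_critical_values s interior_maximal[OF _ open_ball, of q s] by (metis centre_in_ball empty_iff subsetD)
    then obtain w where w: "w \<in> ball q s" "w \<notin> \<phi> ` {z \<in> \<Omega>. J z = 0}" by blast
    have "q \<in> K0" using \<rho> by (auto simp: K0_def q_def)
    moreover have "w \<in> cball q e" using w(1) by (simp add: s_def)
    ultimately have "w \<in> \<phi> ` \<Omega>" using e(2) by blast
    then have "J (\<psi> w) \<noteq> 0" using w(2) by (metis (mono_tags, lifting) f_inv_into_f image_eqI inv_into_into mem_Collect_eq)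
    then show ?thesis using w(1) by (intro exI[of _ "w - q"]) (auto simp: q_def s_def dist_norm norm_minus_commute)
  qed
  then obtain y where y: "\<And>n. norm (y n) < min e (1 / real (Suc n))" "\<And>n. J (\<psi> (p + c *s v + y n)) \<noteq> 0"
    by metis
  have inK: "p + y n + l *s v \<in> K" "p + l *s v \<in> K" if "l \<in> cball c \<rho>" for n l
  proof -
    have l: "p + l *s v \<in> K0" using that by (auto simp: K0_def)
    have "y n \<in> cball 0 e" using y(1)[of n] by simp
    then show "p + y n + l *s v \<in> K" using l unfolding K_def
      by (intro CollectI exI[of _ "p + l *s v"] exI[of _ "y n"]) (simp add: algebra_simps)
    show "p + l *s v \<in> K" using l e(1) unfolding K_def
      by (intro CollectI exI[of _ "p + l *s v"] exI[of _ "0"]) simp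
  qed
  have hol: "(\<lambda>l. \<psi> (p + y n + l *s v) $ i) holomorphic_on ball c \<rho>" for n
  proof (rule inverse_holomorphic_on_generic_line[of c \<rho> "p + y n" v c])
    show "J (\<psi> (p + y n + c *s v)) \<noteq> 0" using y(2)[of n] by (simp add: algebra_simps)
  qed (use inK K\<phi> \<rho> in auto)
  have unif: "uniform_limit (cball c \<rho>) (\<lambda>n l. \<psi> (p + y n + l *s v) $ i) (\<lambda>l. \<psi> (p + l *s v) $ i) sequentially"
  proof (rule uniform_limitI)
    fix \<epsilon> :: real assume "\<epsilon> > 0"
    then obtain d where d: "d > 0" "\<And>x x'. x \<in> K \<Longrightarrow> x' \<in> K \<Longrightarrow> dist x' x < d \<Longrightarrow> dist (\<psi> x') (\<psi> x) < \<epsilon>"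
      using \<open>uniformly_continuous_on K \<psi>\<close> unfolding uniformly_continuous_on_def by metis
    have "(\<lambda>n. 1 / real (Suc n)) \<longlonglongrightarrow> 0"
      using LIMSEQ_inverse_real_of_nat by (simp add: inverse_eq_divide)
    then have "\<forall>\<^sub>F n in sequentially. 1 / real (Suc n) < d" using d(1) by (rule order_tendstoD(2))
    then show "\<forall>\<^sub>F n in sequentially. \<forall>l\<in>cball c \<rho>. dist (\<psi> (p + y n + l *s v) $ i) (\<psi> (p + l *s v) $ i) < \<epsilon>"
    proof eventually_elim
      case (elim n)
      show ?case
      proof
        fix l assume l: "l \<in> cball c \<rho>"
        have "dist (p + y n + l *s v) (p + l *s v) < d"
          using y(1)[of n] elim by (simp add: dist_norm)
        then have "dist (\<psi> (p + y n + l *s v)) (\<psi> (p + l *s v)) < \<epsilon>"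
          using d(2) inK[OF l] by blast
        then show "dist (\<psi> (p + y n + l *s v) $ i) (\<psi> (p + l *s v) $ i) < \<epsilon>"
          using dist_vec_nth_le order_le_less_trans by blast
      qed
    qed
  qed
  show ?thesis
  proof (rule holomorphic_uniform_sequence[OF open_ball hol])
    fix x assume "x \<in> ball c \<rho>"
    then obtain d where d: "d > 0" "cball x d \<subseteq> ball c \<rho>" using open_contains_cball open_ball by blast
    then have "cball x d \<subseteq> cball c \<rho>" using ball_subset_cball by blast
    then show "\<exists>d>0. cball x d \<subseteq> ball c \<rho> \<and> uniform_limit (cball x d) (\<lambda>n l. \<psi> (p + y n + l *s v) $ i) (\<lambda>l. \<psi> (p + l *s v) $ i) sequentially"
      using d uniform_limit_on_subset[OF unif] by blast
  qed
qed

lemma inverse_disc_map_into: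
  assumes sub: "\<And>l. l \<in> ball 0 1 \<Longrightarrow> p + l *s v \<in> \<phi> ` \<Omega>"
  shows "disc_map_into \<Omega> (\<lambda>l. \<psi> (p + l *s v))"
  unfolding disc_map_into_def
proof (intro conjI allI)
  fix i
  have "(\<lambda>l. \<psi> (p + l *s v) $ i) field_differentiable (at l)" if l: "l \<in> ball 0 1" for l
  proof -
    obtain \<rho> where \<rho>: "\<rho> > 0" "cball l \<rho> \<subseteq> ball 0 1"
      using open_contains_cball[THEN iffD1, OF open_ball, rule_format, OF l] by blast
    have "(\<lambda>l. \<psi> (p + l *s v) $ i) holomorphic_on ball l \<rho>"
    proof (rule inverse_holomorphic_on_line[OF \<rho>(1)])
      show "p + w *s v \<in> \<phi> ` \<Omega>" if "w \<in> cball l \<rho>" for w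
        using sub \<rho>(2) that by blast
    qed
    then show ?thesis
      by (rule holomorphic_on_imp_differentiable_at) (use \<rho>(1) in auto)
  qed
  then show "(\<lambda>l. \<psi> (p + l *s v) $ i) holomorphic_on ball 0 1"
    by (auto simp: holomorphic_on_def field_differentiable_at_within)
qed (use sub in \<open>auto intro!: inv_into_into\<close>)

end

section \<open>The Kobayashi distance of the ball\<close>

definition hprod :: "complex ^ 'n \<Rightarrow> complex ^ 'n \<Rightarrow> complex" where
  "hprod x y = (\<Sum>i\<in>UNIV. x $ i * cnj (y $ i))"

lemma hprod_simps [simp]:
  "hprod (x + y) z = hprod x z + hprod y z" "hprod (x - y) z = hprod x z - hprod y z"
  "hprod x (y + z) = hprod x y + hprod x z" "hprod x (y - z) = hprod x y - hprod x z"
  "hprod (c *s x) y = c * hprod x y" "hprod x (c *s y) = cnj c * hprod x y"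
  "hprod 0 y = 0" "hprod x 0 = 0" "hprod (- x) y = - hprod x y" "hprod x (- y) = - hprod x y"
  by (simp_all add: hprod_def algebra_simps sum.distrib sum_subtractf sum_distrib_left sum_negf)

lemma hprod_scaleR [simp]: "hprod (r *\<^sub>R x) y = of_real r * hprod x y" "hprod x (r *\<^sub>R y) = of_real r * hprod x y"
  unfolding hprod_def sum_distrib_left by (auto intro!: sum.cong simp: scaleR_conv_of_real[where 'a = complex])

lemma hprod_commute: "hprod x y = cnj (hprod y x)"
  by (simp add: hprod_def mult.commute)

lemma hprod_self: "hprod x x = of_real ((norm x)\<^sup>2)"
proof -
  have "(norm x)\<^sup>2 = (\<Sum>i\<in>UNIV. (cmod (x $ i))\<^sup>2)"
    by (simp add: norm_vec_def L2_set_def sum_nonneg)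
  then show ?thesis
    by (simp add: hprod_def complex_norm_square[symmetric])
qed

lemma norm_hprod_le: "cmod (hprod x y) \<le> norm x * norm y"
proof -
  have "cmod (hprod x y) \<le> (\<Sum>i\<in>UNIV. \<bar>cmod (x $ i)\<bar> * \<bar>cmod (y $ i)\<bar>)"
    unfolding hprod_def by (rule order_trans[OF norm_sum]) (simp add: norm_mult)
  also have "\<dots> \<le> norm x * norm y"
    unfolding norm_vec_def by (rule L2_set_mult_ineq)
  finally show ?thesis .
qed

lemma norm_add_squared_hprod: "(norm (x + y))\<^sup>2 = (norm x)\<^sup>2 + (norm y)\<^sup>2 + 2 * Re (hprod x y)"
proof -
  have "complex_of_real ((norm (x + y))\<^sup>2) = of_real ((norm x)\<^sup>2) + hprod x y + cnj (hprod x y) + of_real ((norm y)\<^sup>2)"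
    unfolding hprod_self[symmetric] hprod_commute[of y x, symmetric] by simp
  from arg_cong[OF this, of Re] show ?thesis by simp
qed

lemma norm_diff_squared_hprod: "(norm (x - y))\<^sup>2 = (norm x)\<^sup>2 + (norm y)\<^sup>2 - 2 * Re (hprod x y)"
  using norm_add_squared_hprod[of x "- y"] by simp

lemma tendsto_hprod [tendsto_intros]:
  assumes "(f \<longlongrightarrow> a) F" "(g \<longlongrightarrow> b) F"
  shows "((\<lambda>x. hprod (f x) (g x)) \<longlongrightarrow> hprod a b) F"
  unfolding hprod_def by (intro tendsto_intros tendsto_vec_nth assms)

lemma norm_hprod_less_1: "norm x < 1 \<Longrightarrow> norm y \<le> 1 \<Longrightarrow> cmod (hprod x y) < 1"
  using norm_hprod_le[of x y] mult_left_le[of "norm y" "norm x"] by simp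

lemma one_minus_hprod_nonzero: "norm x < 1 \<Longrightarrow> norm y \<le> 1 \<Longrightarrow> 1 - hprod x y \<noteq> 0"
  using norm_hprod_less_1[of x y] by auto

text \<open>The squared hyperbolic cosine of the invariant distance of the ball, normalised so that
  the distance from 0 to \<open>x\<close> is \<open>artanh (norm x)\<close>.\<close>

definition ball_cosh2 :: "complex ^ 'n \<Rightarrow> complex ^ 'n \<Rightarrow> real" where
  "ball_cosh2 x y = (cmod (1 - hprod x y))\<^sup>2 / ((1 - (norm x)\<^sup>2) * (1 - (norm y)\<^sup>2))"

lemma norm_squared_less_1: "norm x < 1 \<Longrightarrow> (norm x)\<^sup>2 < 1"
  by (simp add: power_less_one_iff)

lemma ball_cosh2_self: "norm x < 1 \<Longrightarrow> ball_cosh2 x x = 1"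
proof -
  assume x: "norm x < 1"
  have "1 - hprod x x = of_real (1 - (norm x)\<^sup>2)" by (simp add: hprod_self)
  then have "cmod (1 - hprod x x) = 1 - (norm x)\<^sup>2"
    using norm_squared_less_1[OF x] by (simp only: norm_of_real)
  then show ?thesis
    using norm_squared_less_1[OF x] by (simp add: ball_cosh2_def power2_eq_square)
qed

lemma tendsto_ball_cosh2:
  assumes "(f \<longlongrightarrow> a) F" "(g \<longlongrightarrow> b) F" "norm a < 1" "norm b < 1"
  shows "((\<lambda>x. ball_cosh2 (f x) (g x)) \<longlongrightarrow> ball_cosh2 a b) F"
  unfolding ball_cosh2_def using norm_squared_less_1[OF assms(3)] norm_squared_less_1[OF assms(4)]
  by (intro tendsto_intros assms(1,2)) auto

text \<open>The automorphism of the ball that exchanges \<open>a\<close> and \<open>0\<close>.\<close>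

definition ball_automorphism :: "complex ^ 'n \<Rightarrow> complex ^ 'n \<Rightarrow> complex ^ 'n" where
  "ball_automorphism a z = (1 / (1 - hprod z a)) *s
     (a - of_real (sqrt (1 - (norm a)\<^sup>2)) *s z - (hprod z a / of_real (1 + sqrt (1 - (norm a)\<^sup>2))) *s a)"

text \<open>The usual formula contains the projection to the line of \<open>a\<close>, with
  coefficient \<open>(1 - s) / (norm a)^2\<close>. As \<open>(norm a)^2 = (1 - s) * (1 + s)\<close>,
  this equals \<open>1 / (1 + s)\<close>, which also makes sense for \<open>a = 0\<close>. The same
  factorisation collapses the expansion of \<open>(norm u)^2\<close>.\<close>

lemma ball_automorphism_norm:
  assumes a: "norm a < 1" and z: "norm z < 1"
  shows "1 - (norm (ball_automorphism a z))\<^sup>2 = 1 / ball_cosh2 a z"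
proof -
  define s where "s = sqrt (1 - (norm a)\<^sup>2)"
  define t where "t = 1 / (1 + s)"
  have s: "0 \<le> s" "s\<^sup>2 = 1 - (norm a)\<^sup>2"
    using norm_squared_less_1[OF a] by (auto simp: s_def)
  have t: "t * (1 + s) = 1" using s by (simp add: t_def)
  define \<alpha> where "\<alpha> = hprod z a"
  define c where "c = 1 - \<alpha> * of_real t"
  define u where "u = a - of_real s *s z - (\<alpha> / of_real (1 + s)) *s a"
  have u: "u = c *s a - of_real s *s z"
    by (simp add: u_def c_def t_def vec_eq_iff algebra_simps)
  have A: "(norm a)\<^sup>2 = (1 - s) * (1 + s)" using s by (simp add: algebra_simps power2_eq_square)
  then have At: "(norm a)\<^sup>2 * t = 1 - s" using t by (metis mult.assoc mult.commute mult_1)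
  have re: "Re (hprod (c *s a) (of_real s *s z)) = s * (Re \<alpha> - (cmod \<alpha>)\<^sup>2 * t)"
  proof -
    have "hprod a z = cnj \<alpha>" by (simp add: \<alpha>_def hprod_commute[of a z])
    then have "hprod (c *s a) (of_real s *s z) = of_real s * (cnj \<alpha> - of_real t * (\<alpha> * cnj \<alpha>))"
      by (simp add: c_def algebra_simps)
    also have "\<dots> = of_real s * (cnj \<alpha> - of_real (t * (cmod \<alpha>)\<^sup>2))"
      by (simp add: complex_norm_square[symmetric])
    finally have eq: "hprod (c *s a) (of_real s *s z) = of_real s * (cnj \<alpha> - of_real (t * (cmod \<alpha>)\<^sup>2))" .
    show ?thesis unfolding eq by (simp add: mult.commute)
  qed
  have cc: "(cmod c)\<^sup>2 = 1 - 2 * Re \<alpha> * t + (cmod \<alpha>)\<^sup>2 * t\<^sup>2"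
    unfolding c_def cmod_power2 by (simp add: power2_eq_square algebra_simps)
  have "(norm u)\<^sup>2 = (cmod c)\<^sup>2 * (norm a)\<^sup>2 + s\<^sup>2 * (norm z)\<^sup>2 - 2 * (s * (Re \<alpha> - (cmod \<alpha>)\<^sup>2 * t))"
    unfolding u norm_diff_squared_hprod re by (simp add: norm_vector_smult_complex power_mult_distrib)
  also have "(cmod c)\<^sup>2 * (norm a)\<^sup>2 = (norm a)\<^sup>2 - 2 * Re \<alpha> * ((norm a)\<^sup>2 * t) + (cmod \<alpha>)\<^sup>2 * t * ((norm a)\<^sup>2 * t)"
    unfolding cc by (simp add: algebra_simps power2_eq_square)
  also have "\<dots> = 1 - s\<^sup>2 - 2 * Re \<alpha> * (1 - s) + (cmod \<alpha>)\<^sup>2 * t * (1 - s)"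
    unfolding At using s by simp
  finally have nu: "(norm u)\<^sup>2 = 1 - s\<^sup>2 - 2 * Re \<alpha> + (cmod \<alpha>)\<^sup>2 * (t * (1 + s)) + s\<^sup>2 * (norm z)\<^sup>2"
    by (simp add: algebra_simps)
  have "(cmod (1 - \<alpha>))\<^sup>2 = 1 - 2 * Re \<alpha> + (cmod \<alpha>)\<^sup>2"
    unfolding cmod_power2 by (simp add: power2_eq_square algebra_simps)
  then have key: "(cmod (1 - \<alpha>))\<^sup>2 - (norm u)\<^sup>2 = (1 - (norm a)\<^sup>2) * (1 - (norm z)\<^sup>2)"
    unfolding nu t s(2)[symmetric] by (simp add: algebra_simps)
  have nz: "cmod (1 - \<alpha>) \<noteq> 0" using one_minus_hprod_nonzero[OF z, of a] a by (simp add: \<alpha>_def)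
  have "ball_automorphism a z = (1 / (1 - \<alpha>)) *s u"
    by (simp add: ball_automorphism_def u_def s_def \<alpha>_def)
  then have "(norm (ball_automorphism a z))\<^sup>2 = (norm u)\<^sup>2 / (cmod (1 - \<alpha>))\<^sup>2"
    by (simp add: norm_vector_smult_complex norm_divide power_divide)
  then have "1 - (norm (ball_automorphism a z))\<^sup>2 = (1 - (norm a)\<^sup>2) * (1 - (norm z)\<^sup>2) / (cmod (1 - \<alpha>))\<^sup>2"
    using key nz by (simp add: diff_divide_eq_iff)
  moreover have "cmod (1 - hprod a z) = cmod (1 - hprod z a)"
    by (metis complex_cnj_diff complex_cnj_one complex_mod_cnj hprod_commute)
  ultimately show ?thesis
    unfolding ball_cosh2_def by (simp add: \<alpha>_def)
qed

lemma ball_cosh2_pos: "norm x < 1 \<Longrightarrow> norm y < 1 \<Longrightarrow> 0 < ball_cosh2 x y"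
  using one_minus_hprod_nonzero[of x y] norm_squared_less_1[of x] norm_squared_less_1[of y]
  by (auto simp: ball_cosh2_def intro!: divide_pos_pos)

lemma ball_automorphism_less_1:
  assumes "norm a < 1" "norm z < 1"
  shows "norm (ball_automorphism a z) < 1"
proof -
  have "0 < 1 - (norm (ball_automorphism a z))\<^sup>2"
    using ball_automorphism_norm[OF assms] ball_cosh2_pos[OF assms] by simp
  then show ?thesis by (simp add: power_less_one_iff)
qed

lemma holomorphic_hprod_left:
  fixes f :: "complex \<Rightarrow> complex ^ 'n"
  assumes "\<And>i. (\<lambda>l. f l $ i) holomorphic_on S"
  shows "(\<lambda>l. hprod (f l) a) holomorphic_on S"
  unfolding hprod_def by (intro holomorphic_intros assms)

text \<open>Projecting to the direction \<open>e\<close> of the image of \<open>f y\<close> yields a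
  holomorphic self-map \<open>g\<close> of the disc that preserves the norm at \<open>y\<close> and
  does not increase it at \<open>x\<close>. The claim thus follows from its one-dimensional version
  and Schwarz-Pick.\<close>

lemma artanh_ball_automorphism_disc:
  fixes f :: "complex \<Rightarrow> complex ^ 'n"
  assumes a: "norm a < 1" and f: "disc_map_into (ball 0 1) f" and xy: "x \<in> ball 0 1" "y \<in> ball 0 1"
  shows "artanh (norm (ball_automorphism a (f y))) \<le> artanh (norm (ball_automorphism a (f x))) + poincare_dist x y"
proof -
  have fb: "norm (f l) < 1" if "l \<in> ball 0 1" for l using disc_map_into_mem[OF f that] by simp
  define v where "v = ball_automorphism a (f y)"
  define e where "e = sgn v"
  have e: "norm e \<le> 1" by (simp add: e_def norm_sgn)
  define g where "g l = hprod (ball_automorphism a (f l)) e" for l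
  have gle: "cmod (g l) \<le> norm (ball_automorphism a (f l))" for l
    unfolding g_def using norm_hprod_le[of "ball_automorphism a (f l)" e]
      mult_left_le[OF e norm_ge_zero, of "ball_automorphism a (f l)"] by linarith
  have img: "g ` ball 0 1 \<subseteq> ball 0 1"
  proof
    fix w assume "w \<in> g ` ball 0 1"
    then obtain l where l: "l \<in> ball 0 1" "w = g l" by blast
    then show "w \<in> ball 0 1"
      using le_less_trans[OF gle ball_automorphism_less_1[OF a fb[OF l(1)]]] by simp
  qed
  have comp: "(\<lambda>l. f l $ i) holomorphic_on ball 0 1" for i using f by (simp add: disc_map_into_def)
  have nz: "1 - hprod (f l) a \<noteq> 0" if "l \<in> ball 0 1" for l
    using one_minus_hprod_nonzero[OF fb[OF that], of a] a by simp
  have "(\<lambda>l. ball_automorphism a (f l) $ i) holomorphic_on ball 0 1" for i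
    unfolding ball_automorphism_def using nz
    by (auto intro!: holomorphic_intros holomorphic_hprod_left comp) 
  then have hol: "g holomorphic_on ball 0 1"
    unfolding g_def by (rule holomorphic_hprod_left)
  have gy: "cmod (g y) = norm v"
  proof -
    have "g y = of_real (norm v)"
      unfolding g_def v_def[symmetric] e_def by (cases "v = 0") (simp_all add: sgn_div_norm hprod_self power2_eq_square)
    then show ?thesis by simp
  qed
  have "artanh (norm v) \<le> artanh (cmod (g x)) + poincare_dist (g x) (g y)"
  proof -
    have "g x \<in> ball 0 1" "g y \<in> ball 0 1" using img xy by blast+
    from artanh_norm_le_poincare[OF this] show ?thesis by (simp only: gy)
  qed
  also have "artanh (cmod (g x)) \<le> artanh (norm (ball_automorphism a (f x)))"
    using gle[of x] ball_automorphism_less_1[OF a fb[OF xy(1)]] by (subst artanh_real_le_iff) (auto intro: le_less_trans)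
  also have "poincare_dist (g x) (g y) \<le> poincare_dist x y"
    by (rule poincare_dist_contract[OF hol img xy])
  finally show ?thesis by (simp add: v_def)
qed

text \<open>The distance in the ball from \<open>\<phi> x\<close> to \<open>\<phi> z\<close>, as a
  function of \<open>z\<close>, grows along discs by at most the Poincare distance, so
  \<open>kobayashi_dist_lower_bound\<close> applies to it.\<close>

lemma ball_cosh2_le_kobayashi:
  assumes dom: "complex_domain \<Omega>" and \<phi>: "holomorphic_vec_on \<phi> \<Omega>" "\<phi> ` \<Omega> \<subseteq> ball 0 1" and xy: "x \<in> \<Omega>" "y \<in> \<Omega>"
  shows "ball_cosh2 (\<phi> x) (\<phi> y) \<le> (cosh (kobayashi_dist \<Omega> x y))\<^sup>2"
proof -
  have op: "open \<Omega>" using dom by (simp add: complex_domain_def)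
  have nb: "norm (\<phi> z) < 1" if "z \<in> \<Omega>" for z using \<phi>(2) that by auto
  define \<rho> where "\<rho> z = artanh (norm (ball_automorphism (\<phi> x) (\<phi> z)))" for z
  have "\<rho> y \<le> \<rho> x + kobayashi_dist \<Omega> x y"
  proof (rule kobayashi_dist_lower_bound[OF dom xy])
    fix f and a b :: complex assume f: "disc_map_into \<Omega> f" "a \<in> ball 0 1" "b \<in> ball 0 1"
    have "disc_map_into (ball 0 1) (\<lambda>l. \<phi> (f l))"
      unfolding disc_map_into_def
    proof (intro conjI allI)
      show "(\<lambda>l. \<phi> (f l) $ i) holomorphic_on ball 0 1" for i
        by (rule holomorphic_vec_on_compose_curve[OF \<phi>(1) op]) (use f(1) in \<open>simp_all add: disc_map_into_def\<close>)
      show "(\<lambda>l. \<phi> (f l)) ` ball 0 1 \<subseteq> ball 0 1"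
        using f(1) \<phi>(2) unfolding disc_map_into_def by blast
    qed
    then show "\<rho> (f b) \<le> \<rho> (f a) + poincare_dist a b"
      unfolding \<rho>_def by (rule artanh_ball_automorphism_disc[OF nb[OF xy(1)] _ f(2,3)])
  qed
  moreover have "(norm (ball_automorphism (\<phi> x) (\<phi> x)))\<^sup>2 = 0"
    using ball_automorphism_norm[OF nb[OF xy(1)] nb[OF xy(1)]] ball_cosh2_self[OF nb[OF xy(1)]] by simp
  then have "\<rho> x = 0" by (simp add: \<rho>_def)
  moreover have lt: "norm (ball_automorphism (\<phi> x) (\<phi> y)) < 1"
    by (rule ball_automorphism_less_1[OF nb[OF xy(1)] nb[OF xy(2)]])
  then have "0 \<le> \<rho> y" unfolding \<rho>_def by (intro artanh_real_nonneg) auto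
  ultimately have "cosh (\<rho> y) \<le> cosh (kobayashi_dist \<Omega> x y)"
    by (subst cosh_real_nonneg_le_iff) auto
  then have "(cosh (\<rho> y))\<^sup>2 \<le> (cosh (kobayashi_dist \<Omega> x y))\<^sup>2"
    by (intro power_mono) auto
  moreover have "(cosh (\<rho> y))\<^sup>2 = ball_cosh2 (\<phi> x) (\<phi> y)"
    unfolding \<rho>_def using lt
    by (subst cosh_artanh_squared) (auto simp: ball_automorphism_norm[OF nb[OF xy(1)] nb[OF xy(2)]])
  ultimately show ?thesis by simp
qed

text \<open>The complex line through \<open>X\<close> and \<open>Y\<close> meets the unit ball in a
  round disc, centred at the foot \<open>p\<close> of the perpendicular from 0 and of radius
  \<open>\<rho>\<close>. Scaled by \<open>r\<close> and pulled back by \<open>\<psi>\<close> it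
  becomes a disc in \<open>\<Omega>\<close> through \<open>x\<close> and \<open>y\<close>, and the
  Poincare distance of its parameters \<open>a\<close>, \<open>b\<close> is the distance of
  \<open>X\<close> and \<open>Y\<close> in the ball.\<close>

lemma (in injective_holomorphic) kobayashi_le_ball_cosh2:
  assumes hyp: "kobayashi_hyperbolic \<Omega>" and r: "0 < r" "ball 0 r \<subseteq> \<phi> ` \<Omega>" and xy: "x \<in> \<Omega>" "y \<in> \<Omega>"
    and in_r: "norm (\<phi> x) < r" "norm (\<phi> y) < r"
  shows "(cosh (kobayashi_dist \<Omega> x y))\<^sup>2 \<le> ball_cosh2 ((1 / r) *\<^sub>R \<phi> x) ((1 / r) *\<^sub>R \<phi> y)"
proof -
  interpret Metric_space \<Omega> "kobayashi_dist \<Omega>"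
    using hyp by (simp add: kobayashi_hyperbolic_def)
  define X Y where "X = (1 / r) *\<^sub>R \<phi> x" and "Y = (1 / r) *\<^sub>R \<phi> y"
  have X1: "norm X < 1" "norm Y < 1" using in_r r by (simp_all add: X_def Y_def)
  show ?thesis
  proof (cases "x = y")
    case True
    then show ?thesis using ball_cosh2_self[OF X1(1)] xy by (simp add: X_def)
  next
    case False
    then have "\<phi> x \<noteq> \<phi> y" using inj xy by (auto dest: inj_onD)
    then have XY: "X \<noteq> Y" using r by (simp add: X_def Y_def)
    define v where "v = sgn (Y - X)"
    have v: "norm v = 1" using XY by (simp add: v_def norm_sgn)
    have vv: "hprod v v = 1" using v by (simp add: hprod_self)
    have YX: "Y = X + norm (Y - X) *\<^sub>R v" using XY[symmetric] by (simp add: v_def sgn_div_norm)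
    define A B where "A = hprod X v" and "B = hprod Y v"
    define p where "p = X - A *s v"
    have pv: "hprod p v = 0" "hprod v p = 0"
      using vv hprod_commute[of v p] by (simp_all add: p_def A_def)
    have Xp: "X = p + A *s v" by (simp add: p_def)
    have "B = A + of_real (norm (Y - X))"
      unfolding B_def A_def by (subst YX) (simp add: vv)
    then have Yp: "Y = p + B *s v"
      using YX by (simp add: p_def vec_eq_iff algebra_simps scaleR_conv_of_real[where 'a = complex])
    have norm_line: "(norm (p + l *s v))\<^sup>2 = (norm p)\<^sup>2 + (cmod l)\<^sup>2" for l
      using pv v by (simp add: norm_add_squared_hprod norm_vector_smult_complex)
    have "(norm p)\<^sup>2 + (cmod A)\<^sup>2 < 1" "(norm p)\<^sup>2 + (cmod B)\<^sup>2 < 1"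
      using norm_line[of A] norm_line[of B] norm_squared_less_1[OF X1(1)] norm_squared_less_1[OF X1(2)] Xp Yp by auto
    define \<rho> where "\<rho> = sqrt (1 - (norm p)\<^sup>2)"
    have p1: "(norm p)\<^sup>2 < 1" using \<open>(norm p)\<^sup>2 + (cmod A)\<^sup>2 < 1\<close> zero_le_power2[of "cmod A"] by linarith
    then have \<rho>: "\<rho> > 0" "\<rho>\<^sup>2 = 1 - (norm p)\<^sup>2" by (auto simp: \<rho>_def)
    define a b where "a = A / of_real \<rho>" and "b = B / of_real \<rho>"
    have Aa: "A = of_real \<rho> * a" "B = of_real \<rho> * b" using \<rho> by (simp_all add: a_def b_def)
    have "(cmod a)\<^sup>2 < 1" "(cmod b)\<^sup>2 < 1"
      using \<open>(norm p)\<^sup>2 + (cmod A)\<^sup>2 < 1\<close> \<open>(norm p)\<^sup>2 + (cmod B)\<^sup>2 < 1\<close> \<rho> p1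
      by (simp_all add: a_def b_def norm_divide power_divide pos_divide_less_eq)
    then have ab: "a \<in> ball 0 1" "b \<in> ball 0 1" by (simp_all add: power_less_one_iff)
    have disc: "disc_map_into \<Omega> (\<lambda>l. \<psi> (r *\<^sub>R p + l *s ((r * \<rho>) *\<^sub>R v)))"
    proof (rule inverse_disc_map_into)
      fix l :: complex assume l: "l \<in> ball 0 1"
      have eq: "r *\<^sub>R p + l *s ((r * \<rho>) *\<^sub>R v) = r *\<^sub>R (p + (of_real \<rho> * l) *s v)"
        by (simp add: vec_eq_iff algebra_simps scaleR_conv_of_real[where 'a = complex])
      have "(cmod l)\<^sup>2 < 1" using l by (simp add: power_less_one_iff)
      then have "\<rho>\<^sup>2 * (cmod l)\<^sup>2 < \<rho>\<^sup>2 * 1"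
        using \<rho>(1) by (intro mult_strict_left_mono) auto
      moreover have "(norm (p + (of_real \<rho> * l) *s v))\<^sup>2 = (norm p)\<^sup>2 + \<rho>\<^sup>2 * (cmod l)\<^sup>2"
        unfolding norm_line by (simp add: norm_mult power_mult_distrib)
      ultimately have "(norm (p + (of_real \<rho> * l) *s v))\<^sup>2 < 1"
        using \<rho>(2) by linarith
      then have "norm (p + (of_real \<rho> * l) *s v) < 1" by (simp add: power_less_one_iff)
      then have "r *\<^sub>R p + l *s ((r * \<rho>) *\<^sub>R v) \<in> ball 0 r"
        unfolding eq using r by simp
      then show "r *\<^sub>R p + l *s ((r * \<rho>) *\<^sub>R v) \<in> \<phi> ` \<Omega>" using r(2) by blast
    qed
    have "r *\<^sub>R p + a *s ((r * \<rho>) *\<^sub>R v) = r *\<^sub>R X" "r *\<^sub>R p + b *s ((r * \<rho>) *\<^sub>R v) = r *\<^sub>R Y"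
      unfolding Xp Yp Aa by (simp_all add: vec_eq_iff algebra_simps scaleR_conv_of_real[where 'a = complex])
    then have "\<psi> (r *\<^sub>R p + a *s ((r * \<rho>) *\<^sub>R v)) = x" "\<psi> (r *\<^sub>R p + b *s ((r * \<rho>) *\<^sub>R v)) = y"
      using r(1) xy by (simp_all add: X_def Y_def inv_into_f_f[OF inj])
    then have "kobayashi_dist \<Omega> x y \<le> poincare_dist a b"
      using kobayashi_dist_disc[OF disc ab] by simp
    then have "cosh (kobayashi_dist \<Omega> x y) \<le> cosh (poincare_dist a b)"
      using poincare_dist_nonneg[OF ab] by (subst cosh_real_nonneg_le_iff) auto
    then have "(cosh (kobayashi_dist \<Omega> x y))\<^sup>2 \<le> (cosh (poincare_dist a b))\<^sup>2"
      by (intro power_mono) auto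
    also have "(cosh (poincare_dist a b))\<^sup>2 = (cmod (1 - cnj a * b))\<^sup>2 / ((1 - (cmod a)\<^sup>2) * (1 - (cmod b)\<^sup>2))"
      unfolding poincare_dist_Moebius using Moebius_ball(1)[OF ab] ab
      by (subst cosh_artanh_squared) (auto simp: Moebius_one_minus_norm_squared)
    also have "\<dots> = ball_cosh2 X Y"
    proof -
      have "1 - hprod X Y = 1 - hprod p p - A * cnj B"
        unfolding Xp Yp using pv vv by simp
      also have "\<dots> = of_real (\<rho>\<^sup>2) * (1 - a * cnj b)"
      proof -
        have "1 - hprod p p = of_real (\<rho>\<^sup>2)" unfolding hprod_self \<rho>(2) by simp
        moreover have "A * cnj B = of_real (\<rho>\<^sup>2) * (a * cnj b)" unfolding Aa by (simp add: power2_eq_square)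
        ultimately show ?thesis by (simp only: right_diff_distrib mult_1_right)
      qed
      finally have 1: "cmod (1 - hprod X Y) = \<rho>\<^sup>2 * cmod (1 - a * cnj b)"
        by (simp add: norm_mult norm_power)
      have 2: "cmod (1 - a * cnj b) = cmod (1 - cnj a * b)"
        by (metis complex_cnj_cnj complex_cnj_diff complex_cnj_mult complex_cnj_one complex_mod_cnj)
      have 3: "1 - (norm X)\<^sup>2 = \<rho>\<^sup>2 * (1 - (cmod a)\<^sup>2)" "1 - (norm Y)\<^sup>2 = \<rho>\<^sup>2 * (1 - (cmod b)\<^sup>2)"
        unfolding Xp Yp norm_line Aa using \<rho> by (simp_all add: norm_mult power_mult_distrib algebra_simps)
      have cancel: "(R * c)\<^sup>2 / ((R * s) * (R * t)) = c\<^sup>2 / (s * t)" if "R \<noteq> 0" for R c s t :: real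
        using that by (simp add: power2_eq_square)
      show ?thesis
        unfolding ball_cosh2_def 1 2 3 by (rule cancel[symmetric]) (use \<rho>(1) in simp)
    qed
    finally show ?thesis by (simp add: X_def Y_def)
  qed
qed

section \<open>Geodesic lines of the ball\<close>

lemma ball_cosh2_0: "ball_cosh2 0 x = 1 / (1 - (norm x)\<^sup>2)"
  by (simp add: ball_cosh2_def)

lemma one_minus_tanh_squared: "1 - (tanh u)\<^sup>2 = 1 / (cosh u)\<^sup>2" for u :: real
proof -
  have "1 - (tanh u)\<^sup>2 = ((cosh u)\<^sup>2 - (sinh u)\<^sup>2) / (cosh u)\<^sup>2"
    by (simp add: tanh_def power_divide diff_divide_distrib)
  then show ?thesis
    using cosh_square_eq[of u] by simp
qed

lemma norm_eq_tanh_if_ball_cosh2: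
  assumes x: "norm x < 1" and eq: "ball_cosh2 0 x = (cosh u)\<^sup>2"
  shows "norm x = \<bar>tanh u\<bar>"
proof -
  have "1 - (norm x)\<^sup>2 > 0" using norm_squared_less_1[OF x] by simp
  then have "(cosh u)\<^sup>2 * (1 - (norm x)\<^sup>2) = 1"
    using eq by (simp add: ball_cosh2_0 field_simps)
  moreover have "(cosh u)\<^sup>2 * (1 - (tanh u)\<^sup>2) = 1"
    by (simp add: one_minus_tanh_squared)
  ultimately have "(cosh u)\<^sup>2 * (1 - (norm x)\<^sup>2) = (cosh u)\<^sup>2 * (1 - (tanh u)\<^sup>2)" by simp
  then have "(norm x)\<^sup>2 = (tanh u)\<^sup>2" by simp
  then show ?thesis by (metis abs_norm_cancel power2_eq_iff abs_minus_cancel)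
qed

text \<open>Distances from 0 determine the norms. For points on opposite sides of 0 the triangle
  inequality is an equality, which forces equality in Cauchy-Schwarz: the two points are negatively
  proportional. Hence the line is a diameter.\<close>

lemma geodesic_line_through_0:
  fixes \<gamma> :: "real \<Rightarrow> complex ^ 'n"
  assumes ball: "\<And>u. norm (\<gamma> u) < 1" and iso: "\<And>u v. ball_cosh2 (\<gamma> u) (\<gamma> v) = (cosh (u - v))\<^sup>2" and \<gamma>0: "\<gamma> 0 = 0"
  obtains e where "norm e = 1" "(\<gamma> \<longlongrightarrow> e) at_top" "(\<gamma> \<longlongrightarrow> - e) at_bot"
proof -
  have norm\<gamma>: "norm (\<gamma> u) = \<bar>tanh u\<bar>" for u
    using norm_eq_tanh_if_ball_cosh2[OF ball, of u "- u"] iso[of 0 u] \<gamma>0 by simp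
  have opp: "(tanh t) *\<^sub>R \<gamma> u + (tanh u) *\<^sub>R \<gamma> (- t) = 0" if ut: "0 < u" "0 < t" for u t
  proof -
    define m where "m = tanh u * tanh t"
    define z where "z = hprod (\<gamma> u) (\<gamma> (- t))"
    have th: "0 < tanh u" "0 < tanh t" using ut by simp_all
    then have m: "0 < m" by (simp add: m_def)
    have c: "1 - (norm (\<gamma> u))\<^sup>2 = 1 / (cosh u)\<^sup>2" "1 - (norm (\<gamma> (- t)))\<^sup>2 = 1 / (cosh t)\<^sup>2"
      by (simp_all add: norm\<gamma> one_minus_tanh_squared)
    have "(cmod (1 - z))\<^sup>2 * ((cosh u)\<^sup>2 * (cosh t)\<^sup>2) = (cosh (u + t))\<^sup>2"
      using iso[of u "- t"] unfolding ball_cosh2_def c z_def[symmetric] by simp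
    also have "cosh (u + t) = cosh u * cosh t * (1 + m)"
      by (simp add: cosh_add m_def tanh_def field_simps)
    finally have "(cmod (1 - z))\<^sup>2 = (1 + m)\<^sup>2"
      by (simp add: power_mult_distrib)
    moreover have "(cmod (1 - z))\<^sup>2 = 1 - 2 * Re z + (cmod z)\<^sup>2"
      unfolding cmod_power2 by (simp add: power2_eq_square algebra_simps)
    moreover have zm: "cmod z \<le> m"
      using norm_hprod_le[of "\<gamma> u" "\<gamma> (- t)"] th by (simp add: z_def m_def norm\<gamma>)
    then have "(cmod z)\<^sup>2 \<le> m\<^sup>2" by (intro power_mono) auto
    ultimately have "Re z \<le> - m" by (simp add: power2_eq_square algebra_simps)
    then have "Re z = - m" using zm abs_Re_le_cmod[of z] by linarith
    then have "(norm ((tanh t) *\<^sub>R \<gamma> u + (tanh u) *\<^sub>R \<gamma> (- t)))\<^sup>2 = 0"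
      unfolding norm_add_squared_hprod using th
      by (simp add: norm\<gamma> z_def[symmetric] m_def power_mult_distrib power2_eq_square algebra_simps)
    then show ?thesis by simp
  qed
  define e where "e = (- 1 / tanh 1) *\<^sub>R \<gamma> (- 1)"
  have t1: "0 < tanh (1::real)" by simp
  have pos: "\<gamma> u = tanh u *\<^sub>R e" if "0 < u" for u
  proof -
    have "tanh 1 *\<^sub>R \<gamma> u = - (tanh u *\<^sub>R \<gamma> (- 1))"
      using opp[of u 1] that by (simp add: add_eq_0_iff)
    then have "(1 / tanh 1) *\<^sub>R (tanh 1 *\<^sub>R \<gamma> u) = (1 / tanh 1) *\<^sub>R (- (tanh u *\<^sub>R \<gamma> (- 1)))" by simp
    then show ?thesis using t1 by (simp add: e_def)
  qed
  have neg: "\<gamma> u = tanh u *\<^sub>R e" if "u < 0" for u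
  proof -
    have "tanh 1 *\<^sub>R \<gamma> u = - (tanh (- u) *\<^sub>R \<gamma> 1)"
      using opp[of 1 "- u"] that by (simp add: add_eq_0_iff2)
    also have "\<dots> = tanh 1 *\<^sub>R (tanh u *\<^sub>R e)" using pos[of 1] by simp
    finally have "tanh 1 *\<^sub>R \<gamma> u = tanh 1 *\<^sub>R (tanh u *\<^sub>R e)" .
    then show ?thesis unfolding scaleR_cancel_left using t1 by auto
  qed
  have "norm e = 1" using norm\<gamma>[of "- 1"] t1 by (simp add: e_def)
  moreover have "(\<gamma> \<longlongrightarrow> 1 *\<^sub>R e) at_top"
  proof (rule Lim_transform_eventually)
    show "((\<lambda>u. tanh u *\<^sub>R e) \<longlongrightarrow> 1 *\<^sub>R e) at_top" by (intro tendsto_intros tanh_real_at_top)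
    show "\<forall>\<^sub>F u in at_top. tanh u *\<^sub>R e = \<gamma> u"
      using eventually_gt_at_top[of "0::real"] by eventually_elim (simp add: pos)
  qed
  moreover have "(\<gamma> \<longlongrightarrow> (- 1) *\<^sub>R e) at_bot"
  proof (rule Lim_transform_eventually)
    show "((\<lambda>u. tanh u *\<^sub>R e) \<longlongrightarrow> (- 1) *\<^sub>R e) at_bot" by (intro tendsto_intros tanh_real_at_bot)
    show "\<forall>\<^sub>F u in at_bot. tanh u *\<^sub>R e = \<gamma> u"
      using eventually_gt_at_bot[of "0::real"] by eventually_elim (simp add: neg)
  qed
  ultimately show ?thesis using that[of e] by simp
qed

text \<open>As \<open>norm (\<gamma> u)\<close> tends to 1, the denominator of
  \<open>ball_cosh2\<close> vanishes, so a bounded quotient forces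
  \<open>hprod (\<gamma> u) (\<sigma> u)\<close> to tend to 1. This real part controls the Euclidean
  distance.\<close>

lemma bounded_ball_cosh2_same_limit:
  fixes \<gamma> \<sigma> :: "'a \<Rightarrow> complex ^ 'n"
  assumes ball: "\<And>u. norm (\<gamma> u) < 1" "\<And>u. norm (\<sigma> u) < 1" and bd: "\<And>u. ball_cosh2 (\<gamma> u) (\<sigma> u) \<le> C"
    and e: "norm e = 1" "(\<gamma> \<longlongrightarrow> e) F"
  shows "(\<sigma> \<longlongrightarrow> e) F"
proof -
  have n1: "((\<lambda>u. (norm (\<gamma> u))\<^sup>2) \<longlongrightarrow> 1) F"
    using tendsto_power[OF tendsto_norm[OF e(2)], of 2] e(1) by simp
  have "((\<lambda>u. (cmod (1 - hprod (\<gamma> u) (\<sigma> u)))\<^sup>2) \<longlongrightarrow> 0) F"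
  proof (rule Lim_null_comparison)
    show "((\<lambda>u. C * (1 - (norm (\<gamma> u))\<^sup>2)) \<longlongrightarrow> 0) F"
      using tendsto_mult_left[OF tendsto_diff[OF tendsto_const n1], of C 1] by simp
    have "norm ((cmod (1 - hprod (\<gamma> u) (\<sigma> u)))\<^sup>2) \<le> C * (1 - (norm (\<gamma> u))\<^sup>2)" for u
    proof -
      have p: "0 < 1 - (norm (\<gamma> u))\<^sup>2" "0 < 1 - (norm (\<sigma> u))\<^sup>2" "1 - (norm (\<sigma> u))\<^sup>2 \<le> 1"
        using norm_squared_less_1[OF ball(1)] norm_squared_less_1[OF ball(2)] by simp_all
      have C: "0 \<le> C" using bd[of u] ball_cosh2_pos[OF ball, of u u] by linarith
      have "(cmod (1 - hprod (\<gamma> u) (\<sigma> u)))\<^sup>2 \<le> C * ((1 - (norm (\<gamma> u))\<^sup>2) * (1 - (norm (\<sigma> u))\<^sup>2))"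
        using bd[of u] p unfolding ball_cosh2_def by (subst (asm) pos_divide_le_eq) auto
      also have "\<dots> \<le> C * ((1 - (norm (\<gamma> u))\<^sup>2) * 1)"
        using p C by (intro mult_left_mono) auto
      finally show ?thesis by simp
    qed
    then show "\<forall>\<^sub>F u in F. norm ((cmod (1 - hprod (\<gamma> u) (\<sigma> u)))\<^sup>2) \<le> C * (1 - (norm (\<gamma> u))\<^sup>2)"
      by (intro always_eventually) blast
  qed
  then have "((\<lambda>u. sqrt ((cmod (1 - hprod (\<gamma> u) (\<sigma> u)))\<^sup>2)) \<longlongrightarrow> sqrt 0) F"
    by (rule tendsto_real_sqrt)
  then have "((\<lambda>u. 1 - hprod (\<gamma> u) (\<sigma> u)) \<longlongrightarrow> 0) F"
    by (simp add: tendsto_norm_zero_iff)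
  then have re: "((\<lambda>u. Re (1 - hprod (\<gamma> u) (\<sigma> u))) \<longlongrightarrow> Re 0) F" by (rule tendsto_Re)
  have "((\<lambda>u. (norm (\<gamma> u - \<sigma> u))\<^sup>2) \<longlongrightarrow> 0) F"
  proof (rule Lim_null_comparison)
    show "((\<lambda>u. 2 * Re (1 - hprod (\<gamma> u) (\<sigma> u))) \<longlongrightarrow> 0) F"
      using tendsto_mult_left[OF re, of 2] by simp
    show "\<forall>\<^sub>F u in F. norm ((norm (\<gamma> u - \<sigma> u))\<^sup>2) \<le> 2 * Re (1 - hprod (\<gamma> u) (\<sigma> u))"
    proof (intro always_eventually allI)
      fix u
      show "norm ((norm (\<gamma> u - \<sigma> u))\<^sup>2) \<le> 2 * Re (1 - hprod (\<gamma> u) (\<sigma> u))"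
        using norm_diff_squared_hprod[of "\<gamma> u" "\<sigma> u"] norm_squared_less_1[OF ball(1)[of u]] norm_squared_less_1[OF ball(2)[of u]]
        unfolding real_norm_def abs_of_nonneg[OF zero_le_power2] by simp
    qed
  qed
  then have "((\<lambda>u. sqrt ((norm (\<gamma> u - \<sigma> u))\<^sup>2)) \<longlongrightarrow> sqrt 0) F"
    by (rule tendsto_real_sqrt)
  then have "((\<lambda>u. \<gamma> u - \<sigma> u) \<longlongrightarrow> 0) F"
    by (simp add: tendsto_norm_zero_iff)
  from tendsto_diff[OF e(2) this] show ?thesis by simp
qed

lemma cosh_shift_ratio_at_top: "((\<lambda>t::real. (cosh (v - t))\<^sup>2 / (cosh t)\<^sup>2) \<longlongrightarrow> exp (- 2 * v)) at_top"
proof -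
  have "((\<lambda>t. (cosh v - sinh v * tanh t)\<^sup>2) \<longlongrightarrow> (cosh v - sinh v * 1)\<^sup>2) at_top"
    by (intro tendsto_intros tanh_real_at_top)
  moreover have "(cosh v - sinh v * tanh t)\<^sup>2 = (cosh (v - t))\<^sup>2 / (cosh t)\<^sup>2" for t
    by (simp add: cosh_diff tanh_def power_divide[symmetric] diff_divide_distrib)
  moreover have "(cosh v - sinh v * 1)\<^sup>2 = exp (- 2 * v)"
    by (simp add: cosh_minus_sinh power2_eq_square exp_add[symmetric])
  ultimately show ?thesis by simp
qed

text \<open>\<open>E\<close> is the squared exponential of the Busemann function at \<open>e\<close>.\<close>

lemma busemann_along_geodesic:
  fixes \<sigma> :: "real \<Rightarrow> complex ^ 'n"
  assumes ball: "\<And>u. norm (\<sigma> u) < 1" and iso: "\<And>u v. ball_cosh2 (\<sigma> u) (\<sigma> v) = (cosh (u - v))\<^sup>2"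
    and e: "(\<sigma> \<longlongrightarrow> e) at_top"
  defines "E \<equiv> \<lambda>u. (cmod (1 - hprod (\<sigma> u) e))\<^sup>2 / (1 - (norm (\<sigma> u))\<^sup>2)"
  shows "E v = exp (- 2 * v) * E 0" and "((\<lambda>t. (cosh t)\<^sup>2 * (1 - (norm (\<sigma> t))\<^sup>2)) \<longlongrightarrow> E 0) at_top"
proof -
  \<comment> \<open>The isometry identity with \<open>\<sigma> t\<close>, multiplied by
    \<open>1 - (norm (\<sigma> t))^2\<close>, has a finite limit at the end \<open>e\<close>.
    Dividing its instances for \<open>v\<close> and 0 leaves the ratio of hyperbolic cosines, which
    produces the exponential.\<close>
  have lim: "((\<lambda>t. (cosh (v - t))\<^sup>2 * (1 - (norm (\<sigma> t))\<^sup>2)) \<longlongrightarrow> E v) at_top" for v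
  proof -
    have p: "1 - (norm (\<sigma> u))\<^sup>2 > 0" for u using norm_squared_less_1[OF ball[of u]] by simp
    have "((\<lambda>t. (cmod (1 - hprod (\<sigma> v) (\<sigma> t)))\<^sup>2 / (1 - (norm (\<sigma> v))\<^sup>2)) \<longlongrightarrow> E v) at_top"
      unfolding E_def using p[of v] by (intro tendsto_intros e) auto
    moreover have "(cmod (1 - hprod (\<sigma> v) (\<sigma> t)))\<^sup>2 / (1 - (norm (\<sigma> v))\<^sup>2) = (cosh (v - t))\<^sup>2 * (1 - (norm (\<sigma> t))\<^sup>2)" for t
      unfolding iso[symmetric] ball_cosh2_def using p[of v] p[of t] by simp
    ultimately show ?thesis by simp
  qed
  show lim0: "((\<lambda>t. (cosh t)\<^sup>2 * (1 - (norm (\<sigma> t))\<^sup>2)) \<longlongrightarrow> E 0) at_top"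
    using lim[of 0] by simp
  have "((\<lambda>t. (cosh (v - t))\<^sup>2 / (cosh t)\<^sup>2 * ((cosh t)\<^sup>2 * (1 - (norm (\<sigma> t))\<^sup>2))) \<longlongrightarrow> exp (- 2 * v) * E 0) at_top"
    by (intro tendsto_mult cosh_shift_ratio_at_top lim0)
  moreover have "(cosh (v - t))\<^sup>2 / (cosh t)\<^sup>2 * ((cosh t)\<^sup>2 * (1 - (norm (\<sigma> t))\<^sup>2)) = (cosh (v - t))\<^sup>2 * (1 - (norm (\<sigma> t))\<^sup>2)" for t
    by simp
  ultimately show "E v = exp (- 2 * v) * E 0"
    using lim[of v] tendsto_unique[OF trivial_limit_at_top_linorder] by simp
qed

lemma geodesic_line_meets_center:
  fixes \<sigma> :: "real \<Rightarrow> complex ^ 'n"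
  assumes ball: "\<And>u. norm (\<sigma> u) < 1" and iso: "\<And>u v. ball_cosh2 (\<sigma> u) (\<sigma> v) = (cosh (u - v))\<^sup>2"
    and e: "norm e = 1" "(\<sigma> \<longlongrightarrow> e) at_top" "(\<sigma> \<longlongrightarrow> - e) at_bot"
  obtains v where "\<sigma> v = 0"
proof -
  define E where "E u = (cmod (1 - hprod (\<sigma> u) e))\<^sup>2 / (1 - (norm (\<sigma> u))\<^sup>2)" for u
  define E' where "E' u = (cmod (1 + hprod (\<sigma> u) e))\<^sup>2 / (1 - (norm (\<sigma> u))\<^sup>2)" for u
  have p: "1 - (norm (\<sigma> u))\<^sup>2 > 0" for u using norm_squared_less_1[OF ball[of u]] by simp
  have E: "E v = exp (- 2 * v) * E 0" for v
    unfolding E_def by (rule busemann_along_geodesic(1)[OF ball iso e(2)])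
  have iso': "ball_cosh2 (\<sigma> (- u)) (\<sigma> (- v)) = (cosh (u - v))\<^sup>2" for u v
    using iso[of "- u" "- v"] cosh_minus[of "u - v"] by simp
  have e': "((\<lambda>u. \<sigma> (- u)) \<longlongrightarrow> - e) at_top"
    using filterlim_compose[OF e(3) filterlim_uminus_at_bot_at_top] .
  note bus = busemann_along_geodesic[of "\<lambda>u. \<sigma> (- u)" "- e", OF ball iso' e']
  have E': "E' v = exp (2 * v) * E' 0" for v
    using bus(1)[of "- v"] by (simp add: E'_def)
  have lim': "((\<lambda>t. (cosh t)\<^sup>2 * (1 - (norm (\<sigma> (- t)))\<^sup>2)) \<longlongrightarrow> E' 0) at_top"
    using bus(2) by (simp add: E'_def)
  have "1 - hprod (\<sigma> 0) e \<noteq> 0" by (rule one_minus_hprod_nonzero[OF ball]) (simp add: e(1))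
  then have E0: "E 0 > 0" using p[of 0] by (simp add: E_def)
  \<comment> \<open>The limit that defines \<open>E' 0\<close> is evaluated a second time, now
    through \<open>E (- t) = exp (2 * t) * E 0\<close>. At the end \<open>- e\<close> the factor
    \<open>cmod (1 - hprod (- e) e)\<close> is 2, which cancels the halves from the hyperbolic
    cosine.\<close>
  have "E' 0 = 1 / E 0"
  proof (rule tendsto_unique[OF trivial_limit_at_top_linorder lim'])
    have "((\<lambda>t. ((1 + exp (- 2 * t)) / 2)\<^sup>2 * (cmod (1 - hprod (\<sigma> (- t)) e))\<^sup>2 / E 0) \<longlongrightarrow>
        ((1 + 0) / 2)\<^sup>2 * (cmod (1 - hprod (- e) e))\<^sup>2 / E 0) at_top"
    proof (intro tendsto_intros e')
      have "filterlim (\<lambda>t::real. 2 * t) at_top at_top"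
        by (rule filterlim_tendsto_pos_mult_at_top[OF tendsto_const _ filterlim_ident]) simp
      then have "filterlim (\<lambda>t::real. - (2 * t)) at_bot at_top"
        by (simp add: filterlim_uminus_at_bot)
      then have "((\<lambda>t::real. exp (- (2 * t))) \<longlongrightarrow> 0) at_top"
        using filterlim_compose[OF exp_at_bot] by blast
      then show "((\<lambda>t::real. exp (- 2 * t)) \<longlongrightarrow> 0) at_top" by simp
    qed (use E0 in auto)
    moreover have "(1 + 0) / 2 = (1 / 2 :: real)" "cmod (1 - hprod (- e) e) = 2"
      using e(1) by (simp_all add: hprod_self)
    moreover have "((1 + exp (- 2 * t)) / 2)\<^sup>2 * (cmod (1 - hprod (\<sigma> (- t)) e))\<^sup>2 / E 0 = (cosh t)\<^sup>2 * (1 - (norm (\<sigma> (- t)))\<^sup>2)" for t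
    proof -
      have "(cmod (1 - hprod (\<sigma> (- t)) e))\<^sup>2 = exp (2 * t) * E 0 * (1 - (norm (\<sigma> (- t)))\<^sup>2)"
        using E[of "- t"] p[of "- t"] by (simp add: E_def field_simps)
      then have "((1 + exp (- 2 * t)) / 2)\<^sup>2 * (cmod (1 - hprod (\<sigma> (- t)) e))\<^sup>2 / E 0
          = (((1 + exp (- 2 * t)) / 2)\<^sup>2 * exp (2 * t)) * (1 - (norm (\<sigma> (- t)))\<^sup>2)"
        using E0 by simp
      also have "((1 + exp (- 2 * t)) / 2)\<^sup>2 * exp (2 * t) = (cosh t)\<^sup>2"
      proof -
        have "(1 + exp (- 2 * t)) / 2 * exp t = cosh t"
          by (simp add: cosh_def algebra_simps add_divide_distrib exp_add[symmetric])
        then have "((1 + exp (- 2 * t)) / 2 * exp t)\<^sup>2 = (cosh t)\<^sup>2" by simp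
        moreover have "(exp t)\<^sup>2 = exp (2 * t)" by (simp add: power2_eq_square exp_add[symmetric])
        ultimately show ?thesis by (simp only: power_mult_distrib)
      qed
      finally show ?thesis .
    qed
    ultimately show "((\<lambda>t. (cosh t)\<^sup>2 * (1 - (norm (\<sigma> (- t)))\<^sup>2)) \<longlongrightarrow> 1 / E 0) at_top"
      by (simp add: power2_eq_square)
  qed
  \<comment> \<open>\<open>E\<close> and \<open>E'\<close> scale by reciprocal exponentials and have
    reciprocal values at 0, so one time makes both equal to 1.\<close>
  define v where "v = ln (E 0) / 2"
  have "E v = 1" unfolding E[of v] using E0 by (simp add: v_def exp_minus)
  moreover have "E' v = 1" unfolding E'[of v] \<open>E' 0 = 1 / E 0\<close> using E0 by (simp add: v_def)
  ultimately have eq: "(cmod (1 - hprod (\<sigma> v) e))\<^sup>2 = 1 - (norm (\<sigma> v))\<^sup>2" "(cmod (1 + hprod (\<sigma> v) e))\<^sup>2 = 1 - (norm (\<sigma> v))\<^sup>2"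
    using p[of v] by (simp_all add: E_def E'_def)
  \<comment> \<open>The parallelogram law: adding the two equalities leaves a sum of squares equal
    to 0.\<close>
  have "(cmod (1 - w))\<^sup>2 + (cmod (1 + w))\<^sup>2 = 2 + 2 * (cmod w)\<^sup>2" for w
    unfolding cmod_power2 by (simp add: power2_eq_square algebra_simps)
  from this[of "hprod (\<sigma> v) e"] eq have "(norm (\<sigma> v))\<^sup>2 + (cmod (hprod (\<sigma> v) e))\<^sup>2 = 0" by linarith
  then have "(norm (\<sigma> v))\<^sup>2 = 0" using zero_le_power2[of "norm (\<sigma> v)"] zero_le_power2[of "cmod (hprod (\<sigma> v) e)"] by linarith
  then show ?thesis using that[of v] by simp
qed

section \<open>Blowing up along a geodesic ray\<close>

text \<open>To pick a map from below the supremum, the set of admissible radii must be nonempty. Any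
  injective map into the ball can be normalised at \<open>z\<close>: translation moves the value to
  0 and the factor \<open>1 / 2\<close> brings the image back into the unit ball.\<close>

lemma squeezing_map:
  fixes \<Omega> :: "(complex ^ 'n) set"
  assumes op: "open \<Omega>" and adm: "admits_squeezing \<Omega>" and z: "z \<in> \<Omega>" and s: "s < squeezing_function \<Omega> z"
  shows "\<exists>(\<phi> :: complex ^ 'n \<Rightarrow> complex ^ 'n) r. s < r \<and> 0 < r \<and> r \<le> 1 \<and> holomorphic_vec_on \<phi> \<Omega> \<and> inj_on \<phi> \<Omega> \<and>
    \<phi> ` \<Omega> \<subseteq> ball 0 1 \<and> \<phi> z = 0 \<and> ball 0 r \<subseteq> \<phi> ` \<Omega>"
proof -
  define S where "S = {r. 0 < r \<and> r \<le> 1 \<and> (\<exists>\<phi> :: complex ^ 'n \<Rightarrow> complex ^ 'n.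
               holomorphic_vec_on \<phi> \<Omega> \<and> inj_on \<phi> \<Omega> \<and> \<phi> ` \<Omega> \<subseteq> ball 0 1 \<and> \<phi> z = 0 \<and> ball 0 r \<subseteq> \<phi> ` \<Omega>)}"
  obtain \<phi> :: "complex ^ 'n \<Rightarrow> complex ^ 'n" where \<phi>: "holomorphic_vec_on \<phi> \<Omega>" "inj_on \<phi> \<Omega>" "\<phi> ` \<Omega> \<subseteq> ball 0 1"
    using adm unfolding admits_squeezing_def by blast
  define \<phi>' where "\<phi>' w = (1 / 2) *\<^sub>R (\<phi> w - \<phi> z)" for w
  have hol: "holomorphic_vec_on \<phi>' \<Omega>"
    unfolding holomorphic_vec_on_def
  proof
    fix w assume w: "w \<in> \<Omega>"
    then obtain D where D: "(\<phi> has_derivative D) (at w within \<Omega>)" "\<forall>c v. D (c *s v) = c *s D v"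
      using \<phi>(1) unfolding holomorphic_vec_on_def by blast
    have "(\<phi>' has_derivative (\<lambda>v. (1 / 2) *\<^sub>R (D v - 0))) (at w within \<Omega>)"
      unfolding \<phi>'_def by (intro has_derivative_scaleR_right has_derivative_diff D(1) has_derivative_const)
    moreover have "(1 / 2) *\<^sub>R (D (c *s v) - 0) = c *s ((1 / 2) *\<^sub>R (D v - 0))" for c v
      by (simp add: D(2) vec_eq_iff)
    ultimately show "\<exists>D. (\<phi>' has_derivative D) (at w within \<Omega>) \<and> (\<forall>c v. D (c *s v) = c *s D v)"
      by blast
  qed
  have inj: "inj_on \<phi>' \<Omega>" using \<phi>(2) by (auto simp: inj_on_def \<phi>'_def)
  have img: "\<phi>' ` \<Omega> \<subseteq> ball 0 1"
  proof
    fix y assume "y \<in> \<phi>' ` \<Omega>"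
    then obtain w where w: "w \<in> \<Omega>" "y = \<phi>' w" by blast
    have "norm (\<phi> w - \<phi> z) \<le> norm (\<phi> w) + norm (\<phi> z)" by (rule norm_triangle_ineq4)
    moreover have "norm (\<phi> w) < 1" "norm (\<phi> z) < 1" using \<phi>(3) w z by auto
    ultimately show "y \<in> ball 0 1" using w by (simp add: \<phi>'_def)
  qed
  have "open (\<phi>' ` \<Omega>)"
    by (rule invariance_of_domain[OF holomorphic_vec_on_continuous_on[OF hol] op inj])
  moreover have \<phi>'z: "\<phi>' z = 0" by (simp add: \<phi>'_def)
  then have "0 \<in> \<phi>' ` \<Omega>" using z by (metis imageI)
  ultimately obtain r where r: "r > 0" "ball 0 r \<subseteq> \<phi>' ` \<Omega>" using openE by blast
  have "ball 0 (min r 1) \<subseteq> \<phi>' ` \<Omega>" using r(2) by auto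
  then have "min r 1 \<in> S" unfolding S_def using r(1) hol inj img \<phi>'z by auto
  then have "S \<noteq> {}" by blast
  moreover have "s < Sup S" using s by (simp add: squeezing_function_def S_def)
  ultimately obtain r where "r \<in> S" "s < r" using less_cSupD by blast
  then show ?thesis unfolding S_def by blast
qed

text \<open>One constant serves all domains and all maps into the ball: discs push forward to discs
  of the ball, and the constant is that of the ball. This makes the rescaled rays
  equicontinuous.\<close>

lemma bounded_holomorphic_Lipschitz:
  obtains C where "0 \<le> C" "\<And>(\<Omega> :: (complex ^ 'n) set) (\<phi> :: complex ^ 'n \<Rightarrow> complex ^ 'm) x y. complex_domain \<Omega> \<Longrightarrow> holomorphic_vec_on \<phi> \<Omega> \<Longrightarrow>
    \<phi> ` \<Omega> \<subseteq> ball 0 1 \<Longrightarrow> x \<in> \<Omega> \<Longrightarrow> y \<in> \<Omega> \<Longrightarrow> dist (\<phi> x) (\<phi> y) \<le> C * kobayashi_dist \<Omega> x y"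
proof -
  have "complex_domain (ball (0 :: complex ^ 'm) 1)" by (simp add: complex_domain_def)
  then obtain C where C: "C > 0" "\<And>x y :: complex ^ 'm. x \<in> ball 0 1 \<Longrightarrow> y \<in> ball 0 1 \<Longrightarrow>
      dist x y \<le> C * kobayashi_dist (ball 0 1) x y"
    using dist_le_kobayashi_dist[OF _ bounded_ball] by metis
  have "dist (\<phi> x) (\<phi> y) \<le> C * kobayashi_dist \<Omega> x y"
    if dom: "complex_domain \<Omega>" and \<phi>: "holomorphic_vec_on \<phi> \<Omega>" "\<phi> ` \<Omega> \<subseteq> ball 0 1" and xy: "x \<in> \<Omega>" "y \<in> \<Omega>"
    for \<Omega> :: "(complex ^ 'n) set" and \<phi> :: "complex ^ 'n \<Rightarrow> complex ^ 'm" and x y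
  proof -
    have op: "open \<Omega>" using dom by (simp add: complex_domain_def)
    have "dist (\<phi> x) (\<phi> y) / C \<le> dist (\<phi> x) (\<phi> x) / C + kobayashi_dist \<Omega> x y"
    proof (rule kobayashi_dist_lower_bound[OF dom xy, of "\<lambda>y. dist (\<phi> x) (\<phi> y) / C"])
      fix f and a b :: complex assume f: "disc_map_into \<Omega> f" "a \<in> ball 0 1" "b \<in> ball 0 1"
      have d: "disc_map_into (ball 0 1) (\<lambda>l. \<phi> (f l))"
        unfolding disc_map_into_def
      proof (intro conjI allI)
        show "(\<lambda>l. \<phi> (f l) $ i) holomorphic_on ball 0 1" for i
          by (rule holomorphic_vec_on_compose_curve[OF \<phi>(1) op]) (use f(1) in \<open>simp_all add: disc_map_into_def\<close>)
        show "(\<lambda>l. \<phi> (f l)) ` ball 0 1 \<subseteq> ball 0 1"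
          using f(1) \<phi>(2) unfolding disc_map_into_def by blast
      qed
      have "dist (\<phi> (f a)) (\<phi> (f b)) \<le> C * kobayashi_dist (ball 0 1) (\<phi> (f a)) (\<phi> (f b))"
        by (rule C(2)[OF disc_map_into_mem[OF d f(2)] disc_map_into_mem[OF d f(3)]])
      also have "\<dots> \<le> C * poincare_dist a b"
        using C(1) kobayashi_dist_disc[OF d f(2,3)] by (intro mult_left_mono) auto
      finally have "dist (\<phi> x) (\<phi> (f b)) \<le> dist (\<phi> x) (\<phi> (f a)) + C * poincare_dist a b"
        using dist_triangle[of "\<phi> x" "\<phi> (f b)" "\<phi> (f a)"] by linarith
      then show "dist (\<phi> x) (\<phi> (f b)) / C \<le> dist (\<phi> x) (\<phi> (f a)) / C + poincare_dist a b"
        using C(1) by (simp add: field_simps)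
    qed
    then show ?thesis using C(1) by (simp add: field_simps)
  qed
  then show ?thesis using that[of C] C(1) by simp
qed

text \<open>Points at bounded Kobayashi distance from the centre of the rescaling stay in a smaller
  concentric ball, so limits of the rescaled rays remain inside the open ball.\<close>

lemma norm_le_tanh:
  assumes dom: "complex_domain \<Omega>" and \<phi>: "holomorphic_vec_on \<phi> \<Omega>" "\<phi> ` \<Omega> \<subseteq> ball 0 1"
    and xy: "x \<in> \<Omega>" "y \<in> \<Omega>" "\<phi> x = 0" and a: "0 \<le> kobayashi_dist \<Omega> x y" "kobayashi_dist \<Omega> x y \<le> a"
  shows "norm (\<phi> y) \<le> tanh a"
proof -
  have 1: "norm (\<phi> y) < 1" using \<phi>(2) xy(2) by auto
  have p: "0 < 1 - (norm (\<phi> y))\<^sup>2" using norm_squared_less_1[OF 1] by simp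
  have "ball_cosh2 0 (\<phi> y) \<le> (cosh (kobayashi_dist \<Omega> x y))\<^sup>2"
    using ball_cosh2_le_kobayashi[OF dom \<phi> xy(1,2)] xy(3) by simp
  also have "\<dots> \<le> (cosh a)\<^sup>2"
    using a by (intro power_mono) (simp_all add: cosh_real_nonneg_le_iff)
  finally have "1 / (1 - (norm (\<phi> y))\<^sup>2) \<le> (cosh a)\<^sup>2" by (simp add: ball_cosh2_0)
  then have "1 / (cosh a)\<^sup>2 \<le> 1 - (norm (\<phi> y))\<^sup>2"
    using p by (simp add: field_simps)
  then have "(norm (\<phi> y))\<^sup>2 \<le> (tanh a)\<^sup>2" using one_minus_tanh_squared[of a] by linarith
  then show ?thesis using a by (simp add: power2_le_iff_abs_le)
qed

text \<open>The shift \<open>T\<close> is an accumulation point of the differences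
  \<open>s n - \<theta> n\<close>, which are bounded through \<open>K\<close>. Given
  \<open>t\<close>, a much later time \<open>\<theta>'\<close> is chosen: the piece of
  \<open>\<gamma>\<close> from \<open>t\<close> to \<open>\<theta>'\<close> and the matching piece
  of \<open>\<sigma>\<close> have nearly equal lengths, so the time difference at \<open>t\<close>
  is nearly the one at \<open>\<theta>'\<close>, that is, nearly \<open>T\<close>.\<close>

lemma (in Metric_space) strongly_asymptotic_if_close:
  assumes \<gamma>: "geodesic_ray M d \<gamma>" and \<sigma>: "geodesic_ray M d \<sigma>" and K: "\<And>t. 0 \<le> t \<Longrightarrow> d (\<gamma> t) (\<sigma> t) \<le> K"
    and near: "\<And>\<epsilon>. 0 < \<epsilon> \<Longrightarrow> \<exists>T. \<forall>t\<ge>T. \<exists>s\<ge>0. d (\<gamma> t) (\<sigma> s) < \<epsilon>"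
  shows "strongly_asymptotic d \<gamma> \<sigma>"
proof -
  have mem: "\<gamma> t \<in> M" "\<sigma> t \<in> M" if "0 \<le> t" for t using \<gamma> \<sigma> that by (auto simp: geodesic_ray_def)
  have d\<gamma>: "d (\<gamma> s) (\<gamma> t) = \<bar>s - t\<bar>" and d\<sigma>: "d (\<sigma> s) (\<sigma> t) = \<bar>s - t\<bar>" if "0 \<le> s" "0 \<le> t" for s t
    using \<gamma> \<sigma> that by (auto simp: geodesic_ray_def)
  have shift: "\<bar>s - t\<bar> \<le> K + \<epsilon>" if "0 \<le> s" "0 \<le> t" "d (\<gamma> t) (\<sigma> s) < \<epsilon>" for s t \<epsilon>
    using triangle[OF mem(2) mem(1) mem(2), of s t t] d\<sigma>[of s t] K[of t] that commute[of "\<sigma> s" "\<gamma> t"] by simp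
  have "\<exists>t s. real n \<le> t \<and> 0 \<le> s \<and> d (\<gamma> t) (\<sigma> s) < 1 / Suc n" for n
  proof -
    obtain T where "\<forall>t\<ge>T. \<exists>s\<ge>0. d (\<gamma> t) (\<sigma> s) < 1 / Suc n" using near[of "1 / Suc n"] by auto
    then show ?thesis by (meson max.cobounded1 max.cobounded2)
  qed
  then obtain \<theta> s where \<theta>: "\<And>n. real n \<le> \<theta> n" "\<And>n. 0 \<le> s n" "\<And>n. d (\<gamma> (\<theta> n)) (\<sigma> (s n)) < 1 / Suc n"
    by metis
  have \<theta>0: "0 \<le> \<theta> n" for n using \<theta>(1)[of n] by (meson of_nat_0_le_iff order_trans)
  have bd: "\<bar>s n - \<theta> n\<bar> \<le> K + 1" for n
    using shift[OF \<theta>(2) \<theta>0 less_le_trans[OF \<theta>(3)], of n 1] by simp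
  have "s n - \<theta> n \<in> {- (K + 1)..K + 1}" for n
    using bd[of n] unfolding atLeastAtMost_iff by linarith
  then obtain T r where r: "strict_mono (r :: nat \<Rightarrow> nat)" "((\<lambda>n. s n - \<theta> n) \<circ> r) \<longlonglongrightarrow> T"
    using seq_compactE[OF compact_imp_seq_compact[OF compact_Icc], of "\<lambda>n. s n - \<theta> n" "- (K + 1)" "K + 1"] by blast
  have "((\<lambda>t. d (\<gamma> t) (\<sigma> (t + T))) \<longlongrightarrow> 0) at_top"
  proof (rule tendstoI)
    fix \<epsilon>' :: real assume "\<epsilon>' > 0"
    \<comment> \<open>Three parts pay for the time shift, two of them for the lengths and one for
      the limit \<open>T\<close>; the fourth is the distance from \<open>\<gamma> t\<close> to
      \<open>\<sigma> u\<close>.\<close>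
    define \<epsilon> where "\<epsilon> = \<epsilon>' / 4"
    have \<epsilon>: "\<epsilon> > 0" using \<open>\<epsilon>' > 0\<close> by (simp add: \<epsilon>_def)
    obtain T' where T': "\<And>t. T' \<le> t \<Longrightarrow> \<exists>s\<ge>0. d (\<gamma> t) (\<sigma> s) < \<epsilon>" using near[OF \<epsilon>] by blast
    have close: "d (\<gamma> t) (\<sigma> (t + T)) < \<epsilon>'" if t: "T' \<le> t" "0 \<le> t" "- T \<le> t" for t
    proof -
      obtain u where u: "0 \<le> u" "d (\<gamma> t) (\<sigma> u) < \<epsilon>" using T'[OF t(1)] by blast
      have ut: "\<bar>u - t\<bar> \<le> K + \<epsilon>" by (rule shift[OF u(1) t(2) u(2)])
      have "(\<lambda>n. 1 / real (Suc n)) \<longlonglongrightarrow> 0"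
        using LIMSEQ_inverse_real_of_nat by (simp add: inverse_eq_divide)
      then have "\<forall>\<^sub>F n in sequentially. 1 / real (Suc n) < \<epsilon>" using \<epsilon> by (rule order_tendstoD(2))
      then have e1: "\<forall>\<^sub>F n in sequentially. 1 / real (Suc (r n)) < \<epsilon>" by (rule eventually_subseq[OF r(1)])
      have e2: "\<forall>\<^sub>F n in sequentially. dist (((\<lambda>n. s n - \<theta> n) \<circ> r) n) T < \<epsilon>" using r(2) \<epsilon> by (rule tendstoD)
      \<comment> \<open>The index is so late that \<open>\<theta>'\<close> exceeds \<open>t\<close>
        and \<open>s'\<close> exceeds \<open>u\<close>, which fixes the signs in the two length
        comparisons.\<close>
      obtain N :: nat where N: "t + 2 * K + 2 * \<epsilon> + 2 \<le> N" using real_arch_simple by blast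
      have "\<forall>\<^sub>F n in sequentially. N \<le> r n"
        using eventually_subseq[OF r(1) eventually_ge_at_top[of N]] .
      then have "\<forall>\<^sub>F n in sequentially. 1 / real (Suc (r n)) < \<epsilon> \<and> dist (((\<lambda>n. s n - \<theta> n) \<circ> r) n) T < \<epsilon> \<and> N \<le> r n"
        using e1 e2 by eventually_elim simp
      then obtain n where n: "1 / real (Suc (r n)) < \<epsilon>" "\<bar>s (r n) - \<theta> (r n) - T\<bar> < \<epsilon>" "N \<le> r n"
        using eventually_happens'[OF sequentially_bot] by (auto simp: dist_real_def)
      define \<theta>' s' where "\<theta>' = \<theta> (r n)" and "s' = s (r n)"
      have p: "0 \<le> \<theta>'" "0 \<le> s'" "d (\<gamma> \<theta>') (\<sigma> s') < \<epsilon>"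
        using \<theta>0 \<theta>(2) less_trans[OF \<theta>(3) n(1)] by (simp_all add: \<theta>'_def s'_def)
      have "real N \<le> \<theta>'" using \<theta>(1)[of "r n"] n(3) by (simp add: \<theta>'_def)
      then have big: "t + 2 * K + 2 * \<epsilon> + 2 \<le> \<theta>'" using N by simp
      have K0: "0 \<le> K" using order_trans[OF nonneg K[of 0]] by simp
      have "\<bar>s' - \<theta>'\<bar> \<le> K + \<epsilon>" by (rule shift[OF p(2,1,3)])
      then have order: "u \<le> s'" "t \<le> \<theta>'" using big ut K0 \<epsilon> by linarith+
      have "s' - u \<le> (\<theta>' - t) + 2 * \<epsilon>"
        using triangle[OF mem(2)[OF p(2)] mem(1)[OF p(1)] mem(2)[OF u(1)]] triangle[OF mem(1)[OF p(1)] mem(1)[OF t(2)] mem(2)[OF u(1)]]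
          d\<sigma>[OF p(2) u(1)] d\<gamma>[OF p(1) t(2)] order u(2) p(3) commute[of "\<sigma> s'" "\<gamma> \<theta>'"] by linarith
      moreover have "\<theta>' - t \<le> (s' - u) + 2 * \<epsilon>"
        using triangle[OF mem(1)[OF p(1)] mem(2)[OF p(2)] mem(1)[OF t(2)]] triangle[OF mem(2)[OF p(2)] mem(2)[OF u(1)] mem(1)[OF t(2)]]
          d\<sigma>[OF p(2) u(1)] d\<gamma>[OF p(1) t(2)] order u(2) p(3) commute[of "\<sigma> u" "\<gamma> t"] by linarith
      moreover have "\<bar>s' - \<theta>' - T\<bar> < \<epsilon>" using n(2) by (simp add: \<theta>'_def s'_def)
      ultimately have "\<bar>u - (t + T)\<bar> < 3 * \<epsilon>" by linarith
      moreover have tT: "0 \<le> t + T" using t by simp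
      ultimately show ?thesis
        using triangle[OF mem(1)[OF t(2)] mem(2)[OF u(1)] mem(2)[OF tT]] d\<sigma>[OF u(1) tT] u(2) by (simp add: \<epsilon>_def)
    qed
    show "\<forall>\<^sub>F t in at_top. dist (d (\<gamma> t) (\<sigma> (t + T))) 0 < \<epsilon>'"
      using eventually_ge_at_top[of "max T' (max 0 (- T))"] by eventually_elim (use close in auto)
  qed
  then show ?thesis unfolding strongly_asymptotic_def by blast
qed

lemma rays_approach_if_squeezing:
  fixes \<Omega> :: "(complex ^ 'n) set"
  assumes dom: "complex_domain \<Omega>" and hyp: "kobayashi_hyperbolic \<Omega>" and adm: "admits_squeezing \<Omega>"
    and \<xi>: "\<xi> \<notin> \<Omega>" and sq: "(squeezing_function \<Omega> \<longlongrightarrow> 1) (at \<xi> within \<Omega>)"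
    and \<gamma>: "geodesic_ray \<Omega> (kobayashi_dist \<Omega>) \<gamma>" "(\<gamma> \<longlongrightarrow> \<xi>) at_top"
    and \<sigma>: "geodesic_ray \<Omega> (kobayashi_dist \<Omega>) \<sigma>"
    and K: "\<And>t. 0 \<le> t \<Longrightarrow> kobayashi_dist \<Omega> (\<gamma> t) (\<sigma> t) \<le> K" and \<epsilon>: "0 < \<epsilon>"
  shows "\<exists>T. \<forall>t\<ge>T. \<exists>s\<ge>0. kobayashi_dist \<Omega> (\<gamma> t) (\<sigma> s) < \<epsilon>"
proof (rule ccontr)
  assume neg: "\<not> ?thesis"
  interpret Metric_space \<Omega> "kobayashi_dist \<Omega>"
    using hyp by (simp add: kobayashi_hyperbolic_def)
  let ?k = "kobayashi_dist \<Omega>"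
  have op: "open \<Omega>" using dom by (simp add: complex_domain_def)
  have mem: "\<gamma> t \<in> \<Omega>" "\<sigma> t \<in> \<Omega>" if "0 \<le> t" for t using \<gamma>(1) \<sigma> that by (auto simp: geodesic_ray_def)
  have d\<gamma>: "?k (\<gamma> s) (\<gamma> t) = \<bar>s - t\<bar>" and d\<sigma>: "?k (\<sigma> s) (\<sigma> t) = \<bar>s - t\<bar>" if "0 \<le> s" "0 \<le> t" for s t
    using \<gamma>(1) \<sigma> that by (auto simp: geodesic_ray_def)
  have "\<forall>\<^sub>F t in at_top. \<gamma> t \<in> \<Omega> \<and> \<gamma> t \<noteq> \<xi>"
    using eventually_ge_at_top[of "0::real"] by eventually_elim (use mem \<xi> in auto)
  then have "filterlim \<gamma> (at \<xi> within \<Omega>) at_top"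
    using \<gamma>(2) by (simp add: filterlim_at)
  then have sq\<gamma>: "((\<lambda>t. squeezing_function \<Omega> (\<gamma> t)) \<longlongrightarrow> 1) at_top"
    by (rule filterlim_compose[OF sq])
  \<comment> \<open>The negated claim provides arbitrarily late times at which
    \<open>\<gamma>\<close> is \<open>\<epsilon>\<close>-far from all of \<open>\<sigma>\<close>;
    late times also have squeezing function close to 1.\<close>
  have "\<exists>t\<ge>real n. 1 - 1 / real (Suc n) < squeezing_function \<Omega> (\<gamma> t) \<and> (\<forall>s\<ge>0. \<epsilon> \<le> ?k (\<gamma> t) (\<sigma> s))" for n
  proof -
    have "\<forall>\<^sub>F t in at_top. 1 - 1 / real (Suc n) < squeezing_function \<Omega> (\<gamma> t)"
      using sq\<gamma> by (rule order_tendstoD(1)) simp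
    then obtain T where T: "\<And>t. T \<le> t \<Longrightarrow> 1 - 1 / real (Suc n) < squeezing_function \<Omega> (\<gamma> t)"
      unfolding eventually_at_top_linorder by blast
    have "\<exists>t\<ge>max T (real n). \<forall>s\<ge>0. \<epsilon> \<le> ?k (\<gamma> t) (\<sigma> s)"
      using neg by (meson not_le)
    then show ?thesis using T by (meson max.boundedE)
  qed
  then obtain \<theta> where \<theta>: "\<And>n. real n \<le> \<theta> n" "\<And>n. 1 - 1 / real (Suc n) < squeezing_function \<Omega> (\<gamma> (\<theta> n))"
      "\<And>n s. 0 \<le> s \<Longrightarrow> \<epsilon> \<le> ?k (\<gamma> (\<theta> n)) (\<sigma> s)"
    by metis
  have \<theta>0: "0 \<le> \<theta> n" for n using \<theta>(1)[of n] by (meson of_nat_0_le_iff order_trans)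
  have "\<exists>(\<phi> :: complex ^ 'n \<Rightarrow> complex ^ 'n) r. 1 - 1 / real (Suc n) < r \<and> 0 < r \<and> r \<le> 1 \<and>
      holomorphic_vec_on \<phi> \<Omega> \<and> inj_on \<phi> \<Omega> \<and> \<phi> ` \<Omega> \<subseteq> ball 0 1 \<and> \<phi> (\<gamma> (\<theta> n)) = 0 \<and> ball 0 r \<subseteq> \<phi> ` \<Omega>" for n
    by (rule squeezing_map[OF op adm mem(1)[OF \<theta>0] \<theta>(2)])
  then obtain \<phi> r where r: "\<And>n. 1 - 1 / real (Suc n) < r n" "\<And>n. 0 < r n" "\<And>n. r n \<le> 1" and
      \<phi>: "\<And>n. holomorphic_vec_on (\<phi> n) \<Omega>" "\<And>n. inj_on (\<phi> n) \<Omega>" "\<And>n. \<phi> n ` \<Omega> \<subseteq> ball (0 :: complex ^ 'n) 1"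
      "\<And>n. \<phi> n (\<gamma> (\<theta> n)) = 0" "\<And>n. ball 0 (r n) \<subseteq> \<phi> n ` \<Omega>"
    by metis
  have inj_hol: "injective_holomorphic (\<phi> n) \<Omega> 1" for n
    using \<phi>(1-3)[of n] op by unfold_locales (auto intro: less_imp_le)
  have rlim: "r \<longlonglongrightarrow> 1"
  proof (rule tendsto_sandwich[OF _ _ _ tendsto_const])
    have "(\<lambda>n. 1 - 1 / real (Suc n)) \<longlonglongrightarrow> 1 - 0"
      using LIMSEQ_inverse_real_of_nat by (intro tendsto_intros) (simp add: inverse_eq_divide)
    then show "(\<lambda>n. 1 - 1 / real (Suc n)) \<longlonglongrightarrow> 1" by simp
    show "\<forall>\<^sub>F n in sequentially. 1 - 1 / real (Suc n) \<le> r n"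
      by (intro always_eventually allI less_imp_le r(1))
    show "\<forall>\<^sub>F n in sequentially. r n \<le> 1"
      by (intro always_eventually allI r(3))
  qed
  \<comment> \<open>The maximum keeps the argument in the domain of the rays for every real
    \<open>u\<close>. For fixed \<open>u\<close> it has no effect once \<open>\<theta> n\<close> is
    large, so the limits are lines and not rays.\<close>
  define \<tau> where "\<tau> n u = max 0 (\<theta> n + u)" for n u
  have \<tau>0: "0 \<le> \<tau> n u" for n u by (simp add: \<tau>_def)
  have \<tau>lip: "\<bar>\<tau> n u - \<tau> n v\<bar> \<le> \<bar>u - v\<bar>" "\<bar>\<theta> n - \<tau> n u\<bar> \<le> \<bar>u\<bar>" for n u v
    using \<theta>0[of n] by (auto simp: \<tau>_def)
  define G where "G n u = \<phi> n (\<gamma> (\<tau> n u))" for n u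
  define H where "H n u = \<phi> n (\<sigma> (\<tau> n u))" for n u
  have k\<gamma>: "?k (\<gamma> (\<theta> n)) (\<gamma> (\<tau> n u)) \<le> \<bar>u\<bar>" for n u
    using d\<gamma>[OF \<theta>0 \<tau>0] \<tau>lip(2) by simp
  have k\<sigma>: "?k (\<gamma> (\<theta> n)) (\<sigma> (\<tau> n u)) \<le> K + \<bar>u\<bar>" for n u
    using triangle[OF mem(1)[OF \<theta>0] mem(1)[OF \<tau>0] mem(2)[OF \<tau>0], of n n u n u] k\<gamma>[of n u] K[OF \<tau>0, of n u] by linarith
  have normG: "norm (G n u) \<le> tanh \<bar>u\<bar>" for n u
    unfolding G_def by (rule norm_le_tanh[OF dom \<phi>(1,3) mem(1)[OF \<theta>0] mem(1)[OF \<tau>0] \<phi>(4) nonneg k\<gamma>])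
  have normH: "norm (H n u) \<le> tanh (K + \<bar>u\<bar>)" for n u
    unfolding H_def by (rule norm_le_tanh[OF dom \<phi>(1,3) mem(1)[OF \<theta>0] mem(2)[OF \<tau>0] \<phi>(4) nonneg k\<sigma>])
  obtain C where C: "0 \<le> C" "\<And>(\<Omega> :: (complex ^ 'n) set) (\<phi> :: complex ^ 'n \<Rightarrow> complex ^ 'n) x y. complex_domain \<Omega> \<Longrightarrow> holomorphic_vec_on \<phi> \<Omega> \<Longrightarrow>
    \<phi> ` \<Omega> \<subseteq> ball 0 1 \<Longrightarrow> x \<in> \<Omega> \<Longrightarrow> y \<in> \<Omega> \<Longrightarrow> dist (\<phi> x) (\<phi> y) \<le> C * kobayashi_dist \<Omega> x y"
    by (rule bounded_holomorphic_Lipschitz) blast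
  have lipG: "dist (G n u) (G n v) \<le> C * \<bar>u - v\<bar>" and lipH: "dist (H n u) (H n v) \<le> C * \<bar>u - v\<bar>" for n u v
  proof -
    have "dist (G n u) (G n v) \<le> C * ?k (\<gamma> (\<tau> n u)) (\<gamma> (\<tau> n v))"
      unfolding G_def by (rule C(2)[OF dom \<phi>(1,3) mem(1)[OF \<tau>0] mem(1)[OF \<tau>0]])
    also have "\<dots> \<le> C * \<bar>u - v\<bar>" using \<tau>lip(1) d\<gamma>[OF \<tau>0 \<tau>0] C(1) by (intro mult_left_mono) auto
    finally show "dist (G n u) (G n v) \<le> C * \<bar>u - v\<bar>" .
    have "dist (H n u) (H n v) \<le> C * ?k (\<sigma> (\<tau> n u)) (\<sigma> (\<tau> n v))"
      unfolding H_def by (rule C(2)[OF dom \<phi>(1,3) mem(2)[OF \<tau>0] mem(2)[OF \<tau>0]])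
    also have "\<dots> \<le> C * \<bar>u - v\<bar>" using \<tau>lip(1) d\<sigma>[OF \<tau>0 \<tau>0] C(1) by (intro mult_left_mono) auto
    finally show "dist (H n u) (H n v) \<le> C * \<bar>u - v\<bar>" .
  qed
  have tanh1: "tanh x < 1" for x :: real using tanh_real_lt_1 by blast
  have "norm (G n 0) \<le> 1" "norm (H n 0) \<le> 1" for n
    using normG[of n 0] normH[of n 0] tanh1[of "K + \<bar>0\<bar>"] by simp_all
  note norm0 = this
  obtain r1 g where r1: "strict_mono (r1 :: nat \<Rightarrow> nat)" "\<And>t. (\<lambda>n. G (r1 n) t) \<longlonglongrightarrow> g t"
    using Lipschitz_pointwise_convergent_subsequence[of C G 1, OF C(1) lipG norm0(1)] by blast
  obtain r2 h where r2: "strict_mono (r2 :: nat \<Rightarrow> nat)" "\<And>t. (\<lambda>n. H (r1 (r2 n)) t) \<longlonglongrightarrow> h t"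
    using Lipschitz_pointwise_convergent_subsequence[of C "\<lambda>n. H (r1 n)" 1, OF C(1) lipH norm0(2)] by blast
  define q where "q n = r1 (r2 n)" for n
  have q: "strict_mono q" using r1(1) r2(1) by (simp add: q_def strict_mono_def)
  have gl: "(\<lambda>n. G (q n) t) \<longlonglongrightarrow> g t" and hl: "(\<lambda>n. H (q n) t) \<longlonglongrightarrow> h t" for t
    using LIMSEQ_subseq_LIMSEQ[OF r1(2) r2(1)] r2(2) by (simp_all add: q_def comp_def)
  have rq: "(\<lambda>n. r (q n)) \<longlonglongrightarrow> 1" using LIMSEQ_subseq_LIMSEQ[OF rlim q] by (simp add: comp_def)
  have normg: "norm (g u) < 1" for u
    using LIMSEQ_le_const2[OF tendsto_norm[OF gl[of u]], of "tanh \<bar>u\<bar>"] normG tanh1[of "\<bar>u\<bar>"] by fastforce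
  have normh: "norm (h u) < 1" for u
    using LIMSEQ_le_const2[OF tendsto_norm[OF hl[of u]], of "tanh (K + \<bar>u\<bar>)"] normH tanh1[of "K + \<bar>u\<bar>"] by fastforce
  have \<theta>top: "\<forall>\<^sub>F n in sequentially. \<tau> (q n) u = \<theta> (q n) + u" for u
  proof -
    obtain N :: nat where N: "\<bar>u\<bar> \<le> N" using real_arch_simple by blast
    have "\<forall>\<^sub>F n in sequentially. N \<le> q n" using eventually_subseq[OF q eventually_ge_at_top[of N]] .
    then show ?thesis
    proof eventually_elim
      case (elim n)
      then have "real N \<le> \<theta> (q n)" using \<theta>(1)[of "q n"] by (meson of_nat_mono order_trans)
      then show ?case using N by (simp add: \<tau>_def)
    qed
  qed
  \<comment> \<open>One inequality holds because the rescaling maps take values in the unit ball,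
    the other because their images contain balls of radius \<open>r (q n)\<close>; since these radii
    tend to 1, the scaling disappears in the limit.\<close>
  have isometric: "ball_cosh2 (f u) (f v) = (cosh (u - v))\<^sup>2"
    if lim: "\<And>t. (\<lambda>n. \<phi> (q n) (\<rho> (\<tau> (q n) t))) \<longlonglongrightarrow> f t" and f1: "\<And>t. norm (f t) < 1"
      and \<rho>: "\<And>t. 0 \<le> t \<Longrightarrow> \<rho> t \<in> \<Omega>" "\<And>s t. 0 \<le> s \<Longrightarrow> 0 \<le> t \<Longrightarrow> ?k (\<rho> s) (\<rho> t) = \<bar>s - t\<bar>" for f \<rho> u v
  proof (rule antisym)
    have coshk: "\<forall>\<^sub>F n in sequentially. (cosh (?k (\<rho> (\<tau> (q n) u)) (\<rho> (\<tau> (q n) v))))\<^sup>2 = (cosh (u - v))\<^sup>2"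
      using \<theta>top[of u] \<theta>top[of v]
    proof eventually_elim
      case (elim n)
      have "?k (\<rho> (\<tau> (q n) u)) (\<rho> (\<tau> (q n) v)) = \<bar>u - v\<bar>" using \<rho>(2)[OF \<tau>0 \<tau>0, of "q n" u "q n" v] elim by simp
      then show ?case by (simp only: cosh_real_abs)
    qed
    show "ball_cosh2 (f u) (f v) \<le> (cosh (u - v))\<^sup>2"
    proof (rule tendsto_upperbound[OF tendsto_ball_cosh2[OF lim lim f1 f1, of u v]])
      show "\<forall>\<^sub>F n in sequentially. ball_cosh2 (\<phi> (q n) (\<rho> (\<tau> (q n) u))) (\<phi> (q n) (\<rho> (\<tau> (q n) v))) \<le> (cosh (u - v))\<^sup>2"
        using coshk
      proof eventually_elim
        case (elim n)
        then show ?case using ball_cosh2_le_kobayashi[OF dom \<phi>(1,3) \<rho>(1)[OF \<tau>0] \<rho>(1)[OF \<tau>0]] by metis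
      qed
    qed simp
    have scaled: "(\<lambda>n. (1 / r (q n)) *\<^sub>R \<phi> (q n) (\<rho> (\<tau> (q n) t))) \<longlonglongrightarrow> f t" for t
      using tendsto_scaleR[OF tendsto_divide[OF tendsto_const rq] lim[of t], of 1] by simp
    have inside: "\<forall>\<^sub>F n in sequentially. norm (\<phi> (q n) (\<rho> (\<tau> (q n) t))) < r (q n)" for t
    proof -
      have "(\<lambda>n. r (q n) - norm (\<phi> (q n) (\<rho> (\<tau> (q n) t)))) \<longlonglongrightarrow> 1 - norm (f t)"
        by (intro tendsto_intros rq lim)
      then have "\<forall>\<^sub>F n in sequentially. 0 < r (q n) - norm (\<phi> (q n) (\<rho> (\<tau> (q n) t)))"
        using f1[of t] by (intro order_tendstoD(1)) auto
      then show ?thesis by eventually_elim simp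
    qed
    show "(cosh (u - v))\<^sup>2 \<le> ball_cosh2 (f u) (f v)"
    proof (rule tendsto_lowerbound[OF tendsto_ball_cosh2[OF scaled scaled f1 f1, of u v]])
      show "\<forall>\<^sub>F n in sequentially. (cosh (u - v))\<^sup>2 \<le>
          ball_cosh2 ((1 / r (q n)) *\<^sub>R \<phi> (q n) (\<rho> (\<tau> (q n) u))) ((1 / r (q n)) *\<^sub>R \<phi> (q n) (\<rho> (\<tau> (q n) v)))"
        using coshk inside[of u] inside[of v]
      proof eventually_elim
        case (elim n)
        show ?case
          unfolding elim(1)[symmetric]
          by (rule injective_holomorphic.kobayashi_le_ball_cosh2[OF inj_hol hyp r(2) \<phi>(5)
                \<rho>(1)[OF \<tau>0] \<rho>(1)[OF \<tau>0] elim(2,3)])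
      qed
    qed simp
  qed
  have iso_g: "ball_cosh2 (g u) (g v) = (cosh (u - v))\<^sup>2" for u v
    by (rule isometric[OF gl[unfolded G_def] normg mem(1) d\<gamma>])
  have iso_h: "ball_cosh2 (h u) (h v) = (cosh (u - v))\<^sup>2" for u v
    by (rule isometric[OF hl[unfolded H_def] normh mem(2) d\<sigma>])
  have "G n 0 = 0" for n using \<phi>(4)[of n] \<theta>0[of n] by (simp add: G_def \<tau>_def)
  then have "g 0 = 0" using gl[of 0] by (simp add: LIMSEQ_const_iff)
  then obtain e where e: "norm e = 1" "(g \<longlongrightarrow> e) at_top" "(g \<longlongrightarrow> - e) at_bot"
    using geodesic_line_through_0[of g] normg iso_g by blast
  have bd: "ball_cosh2 (g u) (h u) \<le> (cosh K)\<^sup>2" for u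
  proof (rule tendsto_upperbound[OF tendsto_ball_cosh2[OF gl hl normg normh, of u u]])
    have "ball_cosh2 (G n u) (H n u) \<le> (cosh K)\<^sup>2" for n
    proof -
      have "ball_cosh2 (G n u) (H n u) \<le> (cosh (?k (\<gamma> (\<tau> n u)) (\<sigma> (\<tau> n u))))\<^sup>2"
        unfolding G_def H_def by (rule ball_cosh2_le_kobayashi[OF dom \<phi>(1,3) mem(1)[OF \<tau>0] mem(2)[OF \<tau>0]])
      also have "\<dots> \<le> (cosh K)\<^sup>2"
        using K[OF \<tau>0, of n u] nonneg[of "\<gamma> (\<tau> n u)" "\<sigma> (\<tau> n u)"]
        by (intro power_mono) (simp_all add: cosh_real_nonneg_le_iff order_trans[OF nonneg])
      finally show ?thesis .
    qed
    then show "\<forall>\<^sub>F n in sequentially. ball_cosh2 (G (q n) u) (H (q n) u) \<le> (cosh K)\<^sup>2"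
      by (intro always_eventually) blast
  qed simp
  have he: "(h \<longlongrightarrow> e) at_top" "(h \<longlongrightarrow> - e) at_bot"
    using bounded_ball_cosh2_same_limit[of g h, OF normg normh bd] e by auto
  obtain v where v: "h v = 0"
    using geodesic_line_meets_center[OF normh iso_h e(1) he] by blast
  have scaled: "(\<lambda>n. (1 / r (q n)) *\<^sub>R H (q n) v) \<longlonglongrightarrow> 0"
    using tendsto_scaleR[OF tendsto_divide[OF tendsto_const rq] hl[of v], of 1] v by simp
  have "(\<lambda>n. r (q n) - norm (H (q n) v)) \<longlonglongrightarrow> 1 - norm (h v)"
    by (intro tendsto_intros rq hl)
  then have inside: "\<forall>\<^sub>F n in sequentially. 0 < r (q n) - norm (H (q n) v)"
    using v by (intro order_tendstoD(1)) auto
  \<comment> \<open>At parameter \<open>v\<close> both rescaled points tend to 0, yet the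
    corresponding points of \<open>\<gamma>\<close> and \<open>\<sigma>\<close> are at least
    \<open>\<epsilon>\<close> apart. Pulling back a disc of the ball transfers this lower bound to
    the limit, where the distance is 0.\<close>
  have "(cosh \<epsilon>)\<^sup>2 \<le> ball_cosh2 (0 :: complex ^ 'n) 0"
  proof (rule tendsto_lowerbound[OF tendsto_ball_cosh2[OF tendsto_const scaled, of 0]])
    show "\<forall>\<^sub>F n in sequentially. (cosh \<epsilon>)\<^sup>2 \<le> ball_cosh2 0 ((1 / r (q n)) *\<^sub>R H (q n) v)"
      using inside
    proof eventually_elim
      case (elim n)
      have "(cosh \<epsilon>)\<^sup>2 \<le> (cosh (?k (\<gamma> (\<theta> (q n))) (\<sigma> (\<tau> (q n) v))))\<^sup>2"
        using \<theta>(3)[OF \<tau>0, of "q n" "q n" v] \<epsilon> by (intro power_mono) (simp_all add: cosh_real_nonneg_le_iff)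
      also have "\<dots> \<le> ball_cosh2 ((1 / r (q n)) *\<^sub>R \<phi> (q n) (\<gamma> (\<theta> (q n)))) ((1 / r (q n)) *\<^sub>R \<phi> (q n) (\<sigma> (\<tau> (q n) v)))"
        by (rule injective_holomorphic.kobayashi_le_ball_cosh2[OF inj_hol hyp r(2) \<phi>(5) mem(1)[OF \<theta>0] mem(2)[OF \<tau>0]])
          (use elim r(2) \<phi>(4) in \<open>simp_all add: H_def\<close>)
      finally show ?case by (simp add: \<phi>(4) H_def)
    qed
  qed simp_all
  then have "(cosh \<epsilon>)\<^sup>2 \<le> 1" by (simp add: ball_cosh2_0)
  moreover have "1 < cosh \<epsilon>" using \<epsilon> cosh_real_nonneg_less_iff[of 0 \<epsilon>] by simp
  then have "1 < (cosh \<epsilon>)\<^sup>2" by (simp add: one_less_power)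
  ultimately show False by simp
qed

theorem theorem1p4:
  fixes \<Omega> :: "(complex ^ 'n) set"
  assumes "local_gromov_model_domain \<Omega>"
    and "hyperbolically_embedded \<Omega>"
    and "admits_squeezing \<Omega>"
    and "\<forall>\<xi>\<in>frontier \<Omega>. (squeezing_function \<Omega> \<longlongrightarrow> 1) (at \<xi> within \<Omega>)"
  shows "\<forall>\<xi>\<in>frontier \<Omega>. \<forall>\<gamma> \<sigma>.
           geodesic_ray \<Omega> (kobayashi_dist \<Omega>) \<gamma> \<and> (\<gamma> \<longlongrightarrow> \<xi>) at_top \<and>
           geodesic_ray \<Omega> (kobayashi_dist \<Omega>) \<sigma> \<and> (\<sigma> \<longlongrightarrow> \<xi>) at_top \<longrightarrow>
           strongly_asymptotic (kobayashi_dist \<Omega>) \<gamma> \<sigma>"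
proof (intro ballI allI impI)
  fix \<xi> \<gamma> \<sigma> assume \<xi>: "\<xi> \<in> frontier \<Omega>"
    and "geodesic_ray \<Omega> (kobayashi_dist \<Omega>) \<gamma> \<and> (\<gamma> \<longlongrightarrow> \<xi>) at_top \<and>
           geodesic_ray \<Omega> (kobayashi_dist \<Omega>) \<sigma> \<and> (\<sigma> \<longlongrightarrow> \<xi>) at_top"
  then have \<gamma>: "geodesic_ray \<Omega> (kobayashi_dist \<Omega>) \<gamma>" "(\<gamma> \<longlongrightarrow> \<xi>) at_top"
    and \<sigma>: "geodesic_ray \<Omega> (kobayashi_dist \<Omega>) \<sigma>" "(\<sigma> \<longlongrightarrow> \<xi>) at_top" by auto
  have dom: "complex_domain \<Omega>" and hyp: "kobayashi_hyperbolic \<Omega>"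
    using assms(1) by (auto simp: local_gromov_model_domain_def)
  have \<xi>\<Omega>: "\<xi> \<notin> \<Omega>" using \<xi> dom by (simp add: complex_domain_def frontier_def interior_open)
  obtain K where K: "\<And>t. 0 \<le> t \<Longrightarrow> kobayashi_dist \<Omega> (\<gamma> t) (\<sigma> t) \<le> K"
    using geodesic_rays_bounded_distance[OF assms(1,2) \<xi> \<gamma> \<sigma>] by blast
  show "strongly_asymptotic (kobayashi_dist \<Omega>) \<gamma> \<sigma>"
  proof (rule Metric_space.strongly_asymptotic_if_close[OF hyp[unfolded kobayashi_hyperbolic_def] \<gamma>(1) \<sigma>(1) K])
    show "\<exists>T. \<forall>t\<ge>T. \<exists>s\<ge>0. kobayashi_dist \<Omega> (\<gamma> t) (\<sigma> s) < \<epsilon>" if "0 < \<epsilon>" for \<epsilon>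
      using rays_approach_if_squeezing[OF dom hyp assms(3) \<xi>\<Omega> bspec[OF assms(4) \<xi>] \<gamma> \<sigma>(1) K that] .
  qed
qed

end
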